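(* Let $b,r\ge1$, let $S$ be a standard skew tableau with $b$ rows each of size $r$, let $k=\operatorname{stab}(S)$, and let $a\ge 2k-1$ be an integer. Then $R_a(S)$ is a standard Young tableau of rectangular shape $((ar)^b)$ and $\operatorname{pr}^{br}(R_a(S))=R_a(S)$.
   Context: Tableaux in English notation, rows indexed top to bottom. $\operatorname{Rect}$ is jeu de taquin rectification. For a skew tableau $U$ with $b$ rows, $\operatorname{Rect}^\ast(U)$ is obtained by repeatedly performing outer jeu de taquin slides inside a rectangle $(a'^b)$ containing $U$ until the cells occupied have complement a partition (pushed to the southeast corner); its row contents do not depend on $a'$. $U+x$ adds $x$ to each entry. For a standard skew tableau $S$ with $m$ cells whose row lengths weakly decrease from top to bottom and $k\ge1$, $S^{(k)}$ is obtained by attaching $k-1$ shifted copies of $S$ to the right of $S$: row $i$ of $S^{(k)}$ begins in the same column as row $i$ of $S$ and consists of the entries of row $i$ of $S$, followed by these entries plus $m$, ..., followed by these entries plus $(k-1)m$; $S^{(0)}$ is empty. $S$ stabilizes at $k$ if every entry in $[(k-1)m+1,km]$ lies in the same row of $\operatorname{Rect}(S^{(k)})$ as in $S^{(k)}$; $\operatorname{stab}(S)$ is the least such $k\ge1$. With $k=\operatorname{stab}(S)$ and $a\ge 2k-1$, $R_a(S)$ is the left-justified filling with $b$ rows whose $i$-th row is the concatenation of the $i$-th rows (entries read left to right) of $\operatorname{Rect}(S^{(k-1)})$, of $S^{(a-2k+2)}+(k-1)br$, and of $\operatorname{Rect}^\ast(S^{(k-1)})+(a-k+1)br$, in this order.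 Promotion $\operatorname{pr}$ on a standard tableau with $n$ cells: erase $1$, slide the empty cell by jeu de taquin until it reaches an outer corner, fill that corner with $n+1$, subtract $1$ from all entries. *)

theory Defs
  imports Main "HOL-Library.While_Combinator"
begin

text \<open>Fillings: cells are pairs (row, column), rows indexed top to bottom from 0,
columns left to right from 0 (English notation).  A filling maps a cell to
Some entry or None (empty cell).\<close>

type_synonym tab = "nat \<times> nat \<Rightarrow> nat option"

definition standard_filling :: "tab \<Rightarrow> nat \<Rightarrow> bool" where
  "standard_filling T n \<longleftrightarrow>
     finite (dom T) \<and>
     bij_betw (\<lambda>c. the (T c)) (dom T) {1..n} \<and>
     (\<forall>i j j' x y. T (i,j) = Some x \<longrightarrow> T (i,j') = Some y \<longrightarrow> j < j' \<longrightarrow> x < y) \<and>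
     (\<forall>i i' j x y. T (i,j) = Some x \<longrightarrow> T (i',j) = Some y \<longrightarrow> i < i' \<longrightarrow> x < y)"

text \<open>Standard skew tableau of skew shape lambda/mu with b rows, each of size r:
mu_i = c i, lambda_i = c i + r with c weakly decreasing.\<close>
definition std_skew_rows :: "tab \<Rightarrow> nat \<Rightarrow> nat \<Rightarrow> bool" where
  "std_skew_rows S b r \<longleftrightarrow>
     (\<exists>c :: nat \<Rightarrow> nat. (\<forall>i i'. i \<le> i' \<longrightarrow> i' < b \<longrightarrow> c i' \<le> c i) \<and>
        dom S = {(i,j). i < b \<and> c i \<le> j \<and> j < c i + r}) \<and>
     standard_filling S (b * r)"

definition rect_syt :: "tab \<Rightarrow> nat \<Rightarrow> nat \<Rightarrow> bool" where
  "rect_syt T b p \<longleftrightarrow> dom T = {(i,j). i < b \<and> j < p} \<and> standard_filling T (b * p)"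

definition row_list :: "tab \<Rightarrow> nat \<Rightarrow> nat list" where
  "row_list T i = map (\<lambda>j. the (T (i,j))) (sorted_list_of_set {j. T (i,j) \<noteq> None})"

definition shift :: "tab \<Rightarrow> nat \<Rightarrow> tab" where
  "shift T x = (\<lambda>c. map_option (\<lambda>v. v + x) (T c))"

definition of_rows :: "nat list list \<Rightarrow> tab" where
  "of_rows rows = (\<lambda>(i,j). if i < length rows \<and> j < length (rows ! i)
                            then Some (rows ! i ! j) else None)"

definition slide_step :: "tab \<times> (nat \<times> nat) \<Rightarrow> tab \<times> (nat \<times> nat)" where
  "slide_step = (\<lambda>(T,(i,j)).
     (case (T (i, Suc j), T (Suc i, j)) of
        (Some x, Some y) \<Rightarrow>
          if x < y then (T((i,j) := Some x, (i, Suc j) := None), (i, Suc j))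
          else (T((i,j) := Some y, (Suc i, j) := None), (Suc i, j))
      | (Some x, None) \<Rightarrow> (T((i,j) := Some x, (i, Suc j) := None), (i, Suc j))
      | (None, Some y) \<Rightarrow> (T((i,j) := Some y, (Suc i, j) := None), (Suc i, j))
      | (None, None) \<Rightarrow> (T, (i,j))))"

definition can_slide :: "tab \<times> (nat \<times> nat) \<Rightarrow> bool" where
  "can_slide = (\<lambda>(T,(i,j)). T (i, Suc j) \<noteq> None \<or> T (Suc i, j) \<noteq> None)"

definition jdt_slide :: "tab \<Rightarrow> nat \<times> nat \<Rightarrow> tab \<times> (nat \<times> nat)" where
  "jdt_slide T h = while can_slide slide_step (T, h)"

text \<open>Cells of the inner shape that still matter: empty cells weakly northwest of
some filled cell.\<close>
definition inner_holes :: "tab \<Rightarrow> (nat \<times> nat) set" where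
  "inner_holes T = {(i,j). T (i,j) = None \<and> (\<exists>i' j'. T (i',j') \<noteq> None \<and> i \<le> i' \<and> j \<le> j')}"

definition inner_corner :: "tab \<Rightarrow> nat \<times> nat" where
  "inner_corner T = (let H = inner_holes T; i = Max (fst ` H) in (i, Max {j. (i,j) \<in> H}))"

definition Rect :: "tab \<Rightarrow> tab" where
  "Rect T0 = while (\<lambda>T. inner_holes T \<noteq> {}) (\<lambda>T. fst (jdt_slide T (inner_corner T))) T0"

definition out_slide_step :: "tab \<times> (nat \<times> nat) \<Rightarrow> tab \<times> (nat \<times> nat)" where
  "out_slide_step = (\<lambda>(T,(i,j)).
     (case (if 0 < j then T (i, j - 1) else None, if 0 < i then T (i - 1, j) else None) of
        (Some x, Some y) \<Rightarrow>
          if y < x then (T((i,j) := Some x, (i, j - 1) := None), (i, j - 1))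
          else (T((i,j) := Some y, (i - 1, j) := None), (i - 1, j))
      | (Some x, None) \<Rightarrow> (T((i,j) := Some x, (i, j - 1) := None), (i, j - 1))
      | (None, Some y) \<Rightarrow> (T((i,j) := Some y, (i - 1, j) := None), (i - 1, j))
      | (None, None) \<Rightarrow> (T, (i,j))))"

definition can_out_slide :: "tab \<times> (nat \<times> nat) \<Rightarrow> bool" where
  "can_out_slide = (\<lambda>(T,(i,j)). (0 < j \<and> T (i, j - 1) \<noteq> None) \<or> (0 < i \<and> T (i - 1, j) \<noteq> None))"

definition jdt_out_slide :: "tab \<Rightarrow> nat \<times> nat \<Rightarrow> tab \<times> (nat \<times> nat)" where
  "jdt_out_slide T h = while can_out_slide out_slide_step (T, h)"

definition outer_holes :: "nat \<Rightarrow> nat \<Rightarrow> tab \<Rightarrow> (nat \<times> nat) set" where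
  "outer_holes b a' T = {(i,j). i < b \<and> j < a' \<and> T (i,j) = None \<and>
                            (\<exists>i' j'. T (i',j') \<noteq> None \<and> i' \<le> i \<and> j' \<le> j)}"

definition outer_corner :: "nat \<Rightarrow> nat \<Rightarrow> tab \<Rightarrow> nat \<times> nat" where
  "outer_corner b a' T = (let H = outer_holes b a' T; i = Min (fst ` H) in (i, Min {j. (i,j) \<in> H}))"

text \<open>Rect^*: outer slides inside the rectangle with b rows and a' columns, where a'
is one more than the largest occupied column (row contents do not depend on a').\<close>
definition RectStar :: "nat \<Rightarrow> tab \<Rightarrow> tab" where
  "RectStar b T0 = (let a' = Suc (Max (snd ` dom T0)) in
     while (\<lambda>T. outer_holes b a' T \<noteq> {}) (\<lambda>T. fst (jdt_out_slide T (outer_corner b a' T))) T0)"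

definition row_start :: "tab \<Rightarrow> nat \<Rightarrow> nat" where
  "row_start S i = Min {j. S (i,j) \<noteq> None}"

definition tab_power :: "tab \<Rightarrow> nat \<Rightarrow> tab" where
  "tab_power S k = (\<lambda>(i,j).
     (let m = card (dom S); c = row_start S i;
          L = concat (map (\<lambda>t. map (\<lambda>v. v + t * m) (row_list S i)) [0..<k])
      in if c \<le> j \<and> j - c < length L then Some (L ! (j - c)) else None))"

definition in_row :: "tab \<Rightarrow> nat \<Rightarrow> nat \<Rightarrow> bool" where
  "in_row T v i \<longleftrightarrow> (\<exists>j. T (i,j) = Some v)"

definition stabilizes_at :: "tab \<Rightarrow> nat \<Rightarrow> bool" where
  "stabilizes_at S k \<longleftrightarrow>
     (let m = card (dom S); P = tab_power S k in
      \<forall>v \<in> {(k - 1) * m + 1 .. k * m}. \<forall>i. in_row (Rect P) v i \<longleftrightarrow> in_row P v i)"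

definition stab :: "tab \<Rightarrow> nat" where
  "stab S = (LEAST k. 1 \<le> k \<and> stabilizes_at S k)"

definition R_a :: "nat \<Rightarrow> nat \<Rightarrow> nat \<Rightarrow> tab \<Rightarrow> tab" where
  "R_a a b r S = (let k = stab S in
     of_rows (map (\<lambda>i.
        row_list (Rect (tab_power S (k - 1))) i
      @ row_list (shift (tab_power S (a + 2 - 2 * k)) ((k - 1) * b * r)) i
      @ row_list (shift (RectStar b (tab_power S (k - 1))) ((a + 1 - k) * b * r)) i)
      [0..<b]))"

definition promotion :: "tab \<Rightarrow> tab" where
  "promotion T = (let n = card (dom T); h = (THE c. T c = Some 1);
                      (T', p) = jdt_slide (T(h := None)) h
                  in (\<lambda>c. map_option (\<lambda>v. v - 1) ((T'(p := Some (n + 1))) c)))"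

end

(*
  A standard tableau with b rows is encoded by its word, whose v-th letter is the row of v.  A jeu de
  taquin slide acts on words by crystal raising operators: the letter i+1 turned into i is the one
  where the excess of (i+1)'s over i's in prefixes first attains its maximum.  Hence Rect produces
  the highest weight word of the component (unique by Stembridge's local relations and Newman's
  lemma), and Rect* the lowest weight word, whose content is reversed.

  Let w be the word of S, K = stab S - 1, and u, v the top and bottom words of w^K.  Stability means
  top (w^(K+1)) = u w.  Comparing contents this is equivalent to bot (w^(K+1)) = w v, and the raising
  path from w^K to u can be replayed in front of any power of w, so top (w^(K+c)) = u w^c and
  dually.  If g is a highest weight word just high enough to absorb w, then g w^K has bottom word
  g v; comparing contents, u and v have complementary contents and u w^c v is the word of a
  rectangular tableau.  Each promotion step deletes the first letter, raises the rest and appends b;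
  over b*r steps the prefix u w runs through the top words of the suffixes of w^(K+1), while the top
  word of the complementary suffix grows by the letters of w, so that the word u w^c v returns.
*)
theory Submission
  imports Defs
begin

section \<open>Raising operators on words\<close>

text \<open>The obstacle behind the concatenation lemmas: a raising step of a product is a raising
  step of one factor, but a raising step of a factor need not be one of the product. A path can be
  replayed next to another block when that block reaches no higher excess than the old one. For a
  balanced \<open>w\<close> (each letter \<open>r\<close> times, so the excess ends at 0) all powers
  of \<open>w\<close> satisfy this bound, which is where equal row sizes enter. No lowering
  operators are defined. Reversing a word and complementing its letters turns raising steps
  backwards, and the bottom word is obtained by conjugating the top word with this involution.
  Contents decide what cannot be tracked letter by letter: a raising step strictly decreases the
  letter sum, so two words on one raising path with equal content are equal. The auxiliary word
  \<open>g\<close> serves such comparisons only; its content cancels, or its length bounds an error.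
  A rectangular word is highest and lowest at once. Its suffixes are therefore lowest weight words
  and are determined by their top words, which is how the final equality of words is
  obtained.\<close>

definition exc :: "nat \<Rightarrow> nat list \<Rightarrow> nat \<Rightarrow> int" where
  "exc i y t = int (count_list (take t y) (Suc i)) - int (count_list (take t y) i)"

text \<open>The case \<open>t = 0\<close> forces a positive peak, so nothing is raised when the
  maximal excess is 0. If each \<open>i\<close> is bracketed with a later \<open>Suc i\<close> in
  the usual way, \<open>p\<close> carries the last unbracketed \<open>Suc i\<close>.\<close>

definition first_peak :: "nat \<Rightarrow> nat list \<Rightarrow> nat \<Rightarrow> bool" where
  "first_peak i y p \<longleftrightarrow> p < length y \<and> (\<forall>t\<le>p. exc i y t < exc i y (Suc p)) \<and>
     (\<forall>t. exc i y t \<le> exc i y (Suc p))"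

definition raise :: "nat \<Rightarrow> nat list \<Rightarrow> nat list \<Rightarrow> bool" where
  "raise b y z \<longleftrightarrow> (\<exists>i p. Suc i < b \<and> first_peak i y p \<and> z = y[p := i])"

abbreviation raises :: "nat \<Rightarrow> nat list \<Rightarrow> nat list \<Rightarrow> bool" where
  "raises b \<equiv> (raise b)\<^sup>*\<^sup>*"

definition hw :: "nat \<Rightarrow> nat list \<Rightarrow> bool" where
  "hw b y \<longleftrightarrow> (\<forall>i t. Suc i < b \<longrightarrow> exc i y t \<le> 0)"

text \<open>Equivalently, every suffix has at least as many \<open>Suc i\<close> as
  \<open>i\<close>; \<open>lw_dual\<close> relates this to \<open>hw\<close>.\<close>

definition lw :: "nat \<Rightarrow> nat list \<Rightarrow> bool" where
  "lw b y \<longleftrightarrow> (\<forall>i t. Suc i < b \<longrightarrow> exc i y t \<le> exc i y (length y))"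

lemma exc_0 [simp]: "exc i y 0 = 0"
  by (simp add: exc_def)

lemma exc_Suc:
  "t < length y \<Longrightarrow>
   exc i y (Suc t) = exc i y t + (if y ! t = Suc i then 1 else if y ! t = i then - 1 else 0)"
  by (simp add: exc_def take_Suc_conv_app_nth)

lemma exc_Suc_le: "exc i y (Suc t) \<le> exc i y t + 1"
proof (cases "t < length y")
  case False
  then show ?thesis by (simp add: exc_def)
qed (simp add: exc_Suc)

lemma exc_beyond: "length y \<le> t \<Longrightarrow> exc i y t = exc i y (length y)"
  by (simp add: exc_def)

lemma exc_append: "exc i (x @ y) t = exc i x t + exc i y (t - length x)"
  by (simp add: exc_def)

lemma exc_length_append:
  "exc i (x @ y) (length (x @ y)) = exc i x (length x) + exc i y (length y)"
  by (simp add: exc_def)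

lemma count_list_update:
  "p < length y \<Longrightarrow>
   int (count_list (y[p := x]) l) = int (count_list y l) + of_bool (x = l) - of_bool (y ! p = l)"
proof (induction y arbitrary: p)
  case (Cons a y)
  then show ?case by (cases p) auto
qed simp

text \<open>The increments -2, 1 and 0 are the negated entries of the Cartan matrix of type A; all
  interaction between different operators comes from the neighbouring value 1.\<close>

lemma exc_update:
  assumes "p < length y" "y ! p = Suc i"
  shows "exc j (y[p := i]) t = exc j y t +
    (if p < t then (if j = i then - 2 else if j = Suc i \<or> i = Suc j then 1 else 0) else 0)"
proof (cases "p < t")
  case True
  have "int (count_list (take t (y[p := i])) l)
      = int (count_list (take t y) l) + of_bool (i = l) - of_bool (Suc i = l)" for l
    using assms True by (simp add: take_update_swap count_list_update)
  with True show ?thesis by (auto simp: exc_def)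
next
  case False
  then have "take t (y[p := i]) = take t y" by simp
  with False show ?thesis by (simp add: exc_def)
qed

lemma first_peak_nth: assumes "first_peak i y p" shows "y ! p = Suc i"
proof -
  have "exc i y p < exc i y (Suc p)" "p < length y" using assms by (auto simp: first_peak_def)
  then show ?thesis by (auto simp: exc_Suc split: if_splits)
qed

lemma first_peak_exc_update:
  assumes "first_peak i y p"
  shows "exc j (y[p := i]) t = exc j y t +
    (if p < t then (if j = i then - 2 else if j = Suc i \<or> i = Suc j then 1 else 0) else 0)"
  using exc_update[of p y i j t] first_peak_nth[OF assms] assms by (simp add: first_peak_def)

text \<open>The least position attaining the maximum ends the peak; it is nonzero because some
  excess is positive. The height bound is kept for counting repeated raisings in
  \<open>raise_times\<close>.\<close>

lemma first_peak_ex: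
  assumes "exc i y t > 0"
  obtains p where "first_peak i y p" "exc i y t \<le> exc i y (Suc p)"
proof -
  let ?M = "Max (exc i y ` {..length y})"
  have le: "exc i y s \<le> ?M" for s
  proof (cases "s \<le> length y")
    case False
    then show ?thesis using exc_beyond[of y s i] by simp
  qed simp
  have "?M \<in> exc i y ` {..length y}" by (rule Max_in) auto
  then obtain s where s: "s \<le> length y" "exc i y s = ?M" by (metis atMost_iff imageE)
  let ?q = "LEAST s. exc i y s = ?M"
  have q: "exc i y ?q = ?M" using s(2) by (rule LeastI)
  have ql: "?q \<le> length y" using s by (meson Least_le le_trans)
  have "?q \<noteq> 0" using q le[of t] assms by (metis exc_0 not_le)
  then obtain p where p: "?q = Suc p" using not0_implies_Suc by blast
  have "exc i y t' < ?M" if "t' \<le> p" for t'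
  proof -
    have "t' < ?q" using that p by simp
    then have "exc i y t' \<noteq> ?M" by (rule not_less_Least)
    then show ?thesis using le[of t'] by simp
  qed
  then have "first_peak i y p" using p q ql le by (simp add: first_peak_def)
  then show ?thesis using that p q le by simp
qed

text \<open>A positive excess always produces a peak, so the ballot words are the normal forms of
  \<open>raise\<close> and rewriting arguments apply.\<close>

lemma hw_iff: "hw b y \<longleftrightarrow> (\<nexists>z. raise b y z)"
proof
  assume "hw b y"
  then have False if i: "Suc i < b" and p: "first_peak i y p" for i p
  proof -
    have "exc i y 0 < exc i y (Suc p)" using p unfolding first_peak_def by blast
    moreover have "exc i y (Suc p) \<le> 0" using \<open>hw b y\<close> i unfolding hw_def by blast
    ultimately show False by simp
  qed
  then show "\<nexists>z. raise b y z" unfolding raise_def by blast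
next
  assume *: "\<nexists>z. raise b y z"
  show "hw b y"
    unfolding hw_def
  proof (intro allI impI)
    fix i t assume "Suc i < b"
    then have "\<not> exc i y t > 0"
      using * first_peak_ex[of i y t] unfolding raise_def by blast
    then show "exc i y t \<le> 0" by simp
  qed
qed

lemma first_peak_unique:
  assumes "first_peak i y p" "first_peak i y q"
  shows "p = q"
proof -
  have "\<not> p < q" if "first_peak i y p" "first_peak i y q" for p q
    using that unfolding first_peak_def by (meson Suc_leI not_le)
  from this[OF assms] this[OF assms(2,1)] show ?thesis by simp
qed

lemma raise_length: "raise b y z \<Longrightarrow> length z = length y"
  by (auto simp: raise_def)

lemma raises_length: "raises b y z \<Longrightarrow> length z = length y"
  by (induction rule: rtranclp_induct) (auto dest: raise_length)

lemma raise_set: assumes "raise b y z" "set y \<subseteq> {..<b}" shows "set z \<subseteq> {..<b}"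
proof -
  obtain i p where "Suc i < b" "z = y[p := i]" using assms(1) by (auto simp: raise_def)
  then show ?thesis using assms(2) set_update_subset_insert[of y p i] by auto
qed

lemma raises_set: "raises b y z \<Longrightarrow> set y \<subseteq> {..<b} \<Longrightarrow> set z \<subseteq> {..<b}"
  by (induction rule: rtranclp_induct) (auto dest: raise_set)

lemma raise_nth_le: assumes "raise b y z" shows "z ! t \<le> y ! t"
proof -
  obtain i p where p: "first_peak i y p" "z = y[p := i]" using assms by (auto simp: raise_def)
  then show ?thesis
    using first_peak_nth[OF p(1)] p(1) by (cases "p = t") (auto simp: first_peak_def)
qed

lemma raises_nth_le: "raises b y z \<Longrightarrow> z ! t \<le> y ! t"
  by (induction rule: rtranclp_induct) (auto dest: raise_nth_le intro: le_trans)

lemma raise_sum_list: assumes "raise b y z" shows "sum_list z < sum_list y"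
proof -
  obtain i p where p: "first_peak i y p" "z = y[p := i]" using assms by (auto simp: raise_def)
  have "p < length y" "y ! p = Suc i" using p first_peak_nth by (auto simp: first_peak_def)
  moreover from this have "sum_list y \<ge> Suc i"
    by (metis elem_le_sum_list)
  ultimately show ?thesis using p(2) by (simp add: sum_list_update)
qed

text \<open>The adjacent case is Stembridge's degree-four relation: two raising paths of length four
  that touch the same positions in different orders.\<close>

lemma raise_diamond_aux:
  assumes ij: "Suc i < b" "Suc j < b" "i \<noteq> j" and p: "first_peak i y p" and q: "first_peak j y q"
    and "p < q"
  shows "\<exists>z. raises b (y[p := i]) z \<and> raises b (y[q := j]) z"
proof -
  note e1 = first_peak_exc_update[OF p] and e2 = first_peak_exc_update[OF q]
  have pl: "p < length y" and pp: "\<And>t. t \<le> p \<Longrightarrow> exc i y t < exc i y (Suc p)"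
    and pm: "\<And>t. exc i y t \<le> exc i y (Suc p)" using p unfolding first_peak_def by blast+
  have ql: "q < length y" and qp: "\<And>t. t \<le> q \<Longrightarrow> exc j y t < exc j y (Suc q)"
    and qm: "\<And>t. exc j y t \<le> exc j y (Suc q)" using q unfolding first_peak_def by blast+
  \<comment> \<open>The change at \<open>p < q\<close> adds one and the same amount, 0 or 1, to
    \<open>exc j\<close> at every position after \<open>p\<close>, so the first maximum ending at
    \<open>Suc q\<close> survives.\<close>
  have top1: "first_peak j (y[p := i]) q"
    unfolding first_peak_def
  proof (intro conjI allI impI)
    fix t assume "t \<le> q"
    then show "exc j (y[p := i]) t < exc j (y[p := i]) (Suc q)"
      using qp[of t] ij \<open>p < q\<close> by (auto simp: e1)
  next
    fix t
    show "exc j (y[p := i]) t \<le> exc j (y[p := i]) (Suc q)"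
      using qm[of t] ij \<open>p < q\<close> by (auto simp: e1)
  qed (use ql in simp)
  let ?adj = "j = Suc i \<or> i = Suc j"
  show ?thesis
  \<comment> \<open>In the other order the increment starts only after \<open>q\<close>. It disturbs
    the peak of \<open>i\<close> exactly when the letters are adjacent and \<open>exc i\<close>
    returns to its maximum after \<open>q\<close>; otherwise the two steps commute.\<close>
  proof (cases "?adj \<and> (\<exists>t>q. exc i y t = exc i y (Suc p))")
    case False
    have "first_peak i (y[q := j]) p"
      unfolding first_peak_def
    proof (intro conjI allI impI)
      fix t assume "t \<le> p"
      then show "exc i (y[q := j]) t < exc i (y[q := j]) (Suc p)"
        using pp[of t] ij \<open>p < q\<close> by (auto simp: e2)
    next
      fix t
      have "exc i y t + 1 \<le> exc i y (Suc p)" if "t > q" ?adj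
        using False that pm[of t] by force
      then show "exc i (y[q := j]) t \<le> exc i (y[q := j]) (Suc p)"
        using pm[of t] ij \<open>p < q\<close> by (auto simp: e2)
    qed (use pl in simp)
    then have "raise b (y[q := j]) (y[q := j, p := i])"
      using ij by (auto simp: raise_def)
    moreover have "raise b (y[p := i]) (y[p := i, q := j])"
      using ij top1 by (auto simp: raise_def)
    moreover have "y[q := j, p := i] = y[p := i, q := j]"
      using \<open>p < q\<close> list_update_swap[of q p y] by simp
    ultimately show ?thesis by (metis r_into_rtranclp)
  next
    case True
    then have adj: ?adj and ex: "\<exists>t. t > q \<and> exc i y t = exc i y (Suc p)" by auto
    \<comment> \<open>The first return of \<open>exc i\<close> to its maximum after
      \<open>q\<close>: once \<open>q\<close> has been changed, the extra 1 makes this the first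
      peak of \<open>i\<close>.\<close>
    define t1 where "t1 = (LEAST t. t > q \<and> exc i y t = exc i y (Suc p))"
    have t1: "t1 > q" "exc i y t1 = exc i y (Suc p)"
      using LeastI_ex[OF ex] by (auto simp: t1_def)
    have t1_min: "exc i y t < exc i y (Suc p)" if "q < t" "t < t1" for t
      using that not_less_Least[of t "\<lambda>t. t > q \<and> exc i y t = exc i y (Suc p)"] pm[of t]
      by (force simp: t1_def)
    have t1_le: "t1 \<le> length y"
    proof (rule ccontr)
      assume "\<not> t1 \<le> length y"
      then show False using t1_min[of "length y"] ql exc_beyond[of y t1 i] t1 by simp
    qed
    obtain p' where p': "t1 = Suc p'" using t1(1) by (cases t1) auto
    have "q \<le> p'" "p' < length y" using p' t1 t1_le by auto
    have exq: "exc j y q = exc j y (Suc q) - 1"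
      using qp[of q] exc_Suc_le[of j y q] by simp
    then have ex2: "\<exists>t. t > p \<and> exc j y t = exc j y (Suc q) - 1" using \<open>p < q\<close> by blast
    \<comment> \<open>The first position after \<open>p\<close> at which \<open>exc j\<close> is one
      below its maximum. With the extra 1 from \<open>p\<close>, and 2 lost after \<open>q\<close>,
      this is the peak of \<open>j\<close> once \<open>p\<close> and \<open>q\<close> are
      changed.\<close>
    define t2 where "t2 = (LEAST t. t > p \<and> exc j y t = exc j y (Suc q) - 1)"
    have t2: "t2 > p" "exc j y t2 = exc j y (Suc q) - 1"
      using LeastI_ex[OF ex2] by (auto simp: t2_def)
    have "t2 \<le> q" unfolding t2_def by (rule Least_le) (use exq \<open>p < q\<close> in auto)
    have t2_min: "exc j y t < exc j y (Suc q) - 1" if "p < t" "t < t2" for t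
    proof -
      have "exc j y t \<noteq> exc j y (Suc q) - 1"
        using that not_less_Least[of t "\<lambda>t. t > p \<and> exc j y t = exc j y (Suc q) - 1"]
        by (force simp: t2_def)
      then show ?thesis using qp[of t] that \<open>t2 \<le> q\<close> by simp
    qed
    obtain q' where q': "t2 = Suc q'" using t2(1) by (cases t2) auto
    have "p \<le> q'" "q' < q" using q' t2 \<open>t2 \<le> q\<close> by auto
    note ord = \<open>p < q\<close> \<open>p \<le> q'\<close> \<open>q' < q\<close> \<open>q \<le> p'\<close>
    have A1: "first_peak i (y[q := j]) p'"
      unfolding first_peak_def
    proof (intro conjI allI impI)
      fix t assume "t \<le> p'"
      then show "exc i (y[q := j]) t < exc i (y[q := j]) (Suc p')"
        using pm[of t] t1_min[of t] t1 p' ij ord adj by (auto simp: e2)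
    next
      fix t
      show "exc i (y[q := j]) t \<le> exc i (y[q := j]) (Suc p')"
        using pm[of t] t1 p' ij ord adj by (auto simp: e2)
    qed (use \<open>p' < length y\<close> in simp)
    note e3 = first_peak_exc_update[OF A1]
    have A2: "first_peak i (y[q := j, p' := i]) p"
      unfolding first_peak_def
    proof (intro conjI allI impI)
      fix t assume "t \<le> p"
      then show "exc i (y[q := j, p' := i]) t < exc i (y[q := j, p' := i]) (Suc p)"
        using pp[of t] ij ord adj by (auto simp: e2 e3)
    next
      fix t
      show "exc i (y[q := j, p' := i]) t \<le> exc i (y[q := j, p' := i]) (Suc p)"
        using pm[of t] t1_min[of t] p' ij ord adj by (auto simp: e2 e3)
    qed (use pl in simp)
    note e4 = first_peak_exc_update[OF A2]
    have A3: "first_peak j (y[q := j, p' := i, p := i]) q'"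
      unfolding first_peak_def
    proof (intro conjI allI impI)
      fix t assume "t \<le> q'"
      then show "exc j (y[q := j, p' := i, p := i]) t < exc j (y[q := j, p' := i, p := i]) (Suc q')"
        using qp[of t] t2_min[of t] t2 q' ij ord adj by (auto simp: e2 e3 e4)
    next
      fix t
      show "exc j (y[q := j, p' := i, p := i]) t \<le> exc j (y[q := j, p' := i, p := i]) (Suc q')"
        using qm[of t] qp[of t] t2 q' ij ord adj by (auto simp: e2 e3 e4)
    qed (use ord ql in simp)
    note f1 = first_peak_exc_update[OF top1]
    have B1: "first_peak j (y[p := i, q := j]) q'"
      unfolding first_peak_def
    proof (intro conjI allI impI)
      fix t assume "t \<le> q'"
      then show "exc j (y[p := i, q := j]) t < exc j (y[p := i, q := j]) (Suc q')"
        using qp[of t] t2_min[of t] t2 q' ij ord adj by (auto simp: e1 f1)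
    next
      fix t
      show "exc j (y[p := i, q := j]) t \<le> exc j (y[p := i, q := j]) (Suc q')"
        using qm[of t] qp[of t] t2 q' ij ord adj by (auto simp: e1 f1)
    qed (use ord ql in simp)
    note f2 = first_peak_exc_update[OF B1]
    have B2: "first_peak i (y[p := i, q := j, q' := j]) p'"
      unfolding first_peak_def
    proof (intro conjI allI impI)
      fix t assume "t \<le> p'"
      then show "exc i (y[p := i, q := j, q' := j]) t < exc i (y[p := i, q := j, q' := j]) (Suc p')"
        using pp[of t] pm[of t] t1_min[of t] t1 p' ij ord adj by (auto simp: e1 f1 f2)
    next
      fix t
      show "exc i (y[p := i, q := j, q' := j]) t \<le> exc i (y[p := i, q := j, q' := j]) (Suc p')"
        using pp[of t] pm[of t] t1 p' ij ord adj by (auto simp: e1 f1 f2)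
    qed (use \<open>p' < length y\<close> in simp)
    \<comment> \<open>The positions \<open>p\<close> and \<open>q'\<close> may coincide, and so may
      \<open>q\<close> and \<open>p'\<close>; only updates at distinct positions are
      exchanged.\<close>
    have "y[q := j, p' := i, p := i, q' := j] = y[p := i, q := j, q' := j, p' := i]"
    proof -
      have "y[q := j, p' := i, p := i, q' := j] = y[q := j, p := i, p' := i, q' := j]"
        using ord list_update_swap[of p' p "y[q := j]"] by simp
      also have "\<dots> = y[p := i, q := j, p' := i, q' := j]"
        using ord list_update_swap[of q p y] by simp
      also have "\<dots> = y[p := i, q := j, q' := j, p' := i]"
        using ord list_update_swap[of p' q' "y[p := i, q := j]"] by simp
      finally show ?thesis .
    qed
    moreover have "raises b (y[q := j]) (y[q := j, p' := i, p := i, q' := j])"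
      using A1 A2 A3 ij
      by (intro rtranclp.rtrancl_into_rtrancl[OF rtranclp.rtrancl_into_rtrancl[OF r_into_rtranclp]])
         (auto simp: raise_def)
    moreover have "raises b (y[p := i]) (y[p := i, q := j, q' := j, p' := i])"
      using top1 B1 B2 ij
      by (intro rtranclp.rtrancl_into_rtrancl[OF rtranclp.rtrancl_into_rtrancl[OF r_into_rtranclp]])
         (auto simp: raise_def)
    ultimately show ?thesis by metis
  qed
qed

lemma raise_diamond:
  assumes "raise b y y1" "raise b y y2"
  shows "\<exists>z. raises b y1 z \<and> raises b y2 z"
proof -
  obtain i p where p: "Suc i < b" "first_peak i y p" "y1 = y[p := i]"
    using assms(1) by (auto simp: raise_def)
  obtain j q where q: "Suc j < b" "first_peak j y q" "y2 = y[q := j]"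
    using assms(2) by (auto simp: raise_def)
  show ?thesis
  proof (cases "i = j")
    case True
    then have "y1 = y2" using p q first_peak_unique by blast
    then show ?thesis by blast
  next
    case False
    then have "p \<noteq> q" using first_peak_nth[OF p(2)] first_peak_nth[OF q(2)] by auto
    then show ?thesis
      using raise_diamond_aux[OF p(1) q(1) _ p(2) q(2)] raise_diamond_aux[OF q(1) p(1) _ q(2) p(2)]
        p q False by (metis linorder_neqE_nat)
  qed
qed

section \<open>Existence and uniqueness of the highest weight word\<close>

lemma raises_hw_ex: "\<exists>h. raises b y h \<and> hw b h"
proof (induction "sum_list y" arbitrary: y rule: less_induct)
  case less
  show ?case
  proof (cases "hw b y")
    case False
    then obtain z where z: "raise b y z" using hw_iff by blast
    then obtain h where "raises b z h" "hw b h" using less raise_sum_list by blast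
    then show ?thesis using z by (meson converse_rtranclp_into_rtranclp)
  qed blast
qed

lemma hw_raises_eq: "hw b y \<Longrightarrow> raises b y z \<Longrightarrow> z = y"
  by (metis converse_rtranclpE hw_iff)

text \<open>The induction is on the letter sum: the first steps of both paths are joined by
  \<open>raise_diamond\<close>, and a highest weight word reached from the join must equal both
  ends.\<close>

lemma raises_hw_unique:
  "raises b y h \<Longrightarrow> hw b h \<Longrightarrow> raises b y h' \<Longrightarrow> hw b h' \<Longrightarrow> h = h'"
proof (induction "sum_list y" arbitrary: y h h' rule: less_induct)
  case less
  show ?case
  proof (cases "hw b y")
    case True
    then show ?thesis using less.prems hw_raises_eq by metis
  next
    case False
    obtain y1 where y1: "raise b y y1" "raises b y1 h"
      using less.prems False by (metis converse_rtranclpE)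
    obtain y2 where y2: "raise b y y2" "raises b y2 h'"
      using less.prems False by (metis converse_rtranclpE)
    obtain z where z: "raises b y1 z" "raises b y2 z" using raise_diamond y1 y2 by blast
    obtain g where g: "raises b z g" "hw b g" using raises_hw_ex by blast
    have "h = g"
      using less.hyps[of y1 h g] y1 z g less.prems raise_sum_list by (meson rtranclp_trans)
    moreover have "h' = g"
      using less.hyps[of y2 h' g] y2 z g less.prems raise_sum_list by (meson rtranclp_trans)
    ultimately show ?thesis by simp
  qed
qed

definition top_word :: "nat \<Rightarrow> nat list \<Rightarrow> nat list" where
  "top_word b y = (THE h. raises b y h \<and> hw b h)"

lemma top_word: "raises b y (top_word b y)" "hw b (top_word b y)"
proof -
  have "\<exists>!h. raises b y h \<and> hw b h" using raises_hw_ex raises_hw_unique by metis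
  from theI'[OF this] show "raises b y (top_word b y)" "hw b (top_word b y)"
    by (auto simp: top_word_def)
qed

lemma top_word_eqI: "raises b y h \<Longrightarrow> hw b h \<Longrightarrow> top_word b y = h"
  using top_word raises_hw_unique by blast

lemma top_word_hw: "hw b y \<Longrightarrow> top_word b y = y"
  by (simp add: top_word_eqI)

lemma top_word_raises: "raises b y z \<Longrightarrow> top_word b y = top_word b z"
  by (meson rtranclp_trans top_word top_word_eqI)

lemma top_word_length [simp]: "length (top_word b y) = length y"
  using raises_length top_word(1) by blast

lemma top_word_set: "set y \<subseteq> {..<b} \<Longrightarrow> set (top_word b y) \<subseteq> {..<b}"
  using raises_set top_word(1) by blast

section \<open>Duality and concatenation\<close>

text \<open>The Schuetzenberger involution on words. It replaces lowering operators throughout;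
  truncated subtraction makes it an involution only on words over \<open>{..<b}\<close>.\<close>

definition dual :: "nat \<Rightarrow> nat list \<Rightarrow> nat list" where
  "dual b y = rev (map (\<lambda>l. b - Suc l) y)"

lemma dual_length [simp]: "length (dual b y) = length y"
  by (simp add: dual_def)

lemma dual_set: "set y \<subseteq> {..<b} \<Longrightarrow> set (dual b y) \<subseteq> {..<b}"
  by (auto simp: dual_def)

lemma dual_dual: "set y \<subseteq> {..<b} \<Longrightarrow> dual b (dual b y) = y"
  by (induction y) (auto simp: dual_def)

lemma count_list_dual:
  "set y \<subseteq> {..<b} \<Longrightarrow> l < b \<Longrightarrow> count_list (dual b y) l = count_list y (b - Suc l)"
  by (induction y) (auto simp: dual_def)

lemma take_dual: "take t (dual b y) = dual b (drop (length y - t) y)"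
  by (simp add: dual_def take_rev take_map drop_map)

text \<open>A prefix of the dual comes from a suffix of \<open>y\<close>, whose excess is the total
  minus that of the remaining prefix. Complementing exchanges the two letters of the pair, which
  flips the sign and gives the index \<open>b - Suc (Suc i)\<close>.\<close>

lemma exc_dual:
  assumes "set y \<subseteq> {..<b}" "Suc i < b"
  shows "exc i (dual b y) t =
    exc (b - Suc (Suc i)) y (length y - t) - exc (b - Suc (Suc i)) y (length y)"
proof -
  have count: "int (count_list (take t (dual b y)) l) =
      int (count_list y (b - Suc l)) - int (count_list (take (length y - t) y) (b - Suc l))"
    if "l < b" for l
  proof -
    have "count_list (take t (dual b y)) l = count_list (drop (length y - t) y) (b - Suc l)"
      using assms that set_drop_subset[of "length y - t" y] by (simp add: take_dual count_list_dual)
    moreover have "count_list y (b - Suc l) = count_list (take (length y - t) y) (b - Suc l)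
        + count_list (drop (length y - t) y) (b - Suc l)"
      by (metis append_take_drop_id count_list_append)
    ultimately show ?thesis by simp
  qed
  have "b - Suc i = Suc (b - Suc (Suc i))" using assms by simp
  then show ?thesis using assms count[of i] count[of "Suc i"] by (simp add: exc_def)
qed

text \<open>After the step the excess drops by 2 beyond \<open>p\<close>, so in \<open>z\<close> the
  maximum is attained at \<open>p\<close> for the last time. Read from the right this is a first
  peak, and raising it there restores \<open>y\<close>.\<close>

lemma raise_dual:
  assumes "raise b y z" "set y \<subseteq> {..<b}"
  shows "raise b (dual b z) (dual b y)"
proof -
  obtain i p where i: "Suc i < b" and p: "first_peak i y p" and z: "z = y[p := i]"
    using assms(1) by (auto simp: raise_def)
  note e = first_peak_exc_update[OF p, folded z]
  let ?i = "b - Suc (Suc i)" and ?p = "length y - Suc p"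
  have pl: "p < length y" and pp: "\<And>t. t \<le> p \<Longrightarrow> exc i y t < exc i y (Suc p)"
    and pm: "\<And>t. exc i y t \<le> exc i y (Suc p)" using p unfolding first_peak_def by blast+
  have zl: "length z = length y" using z by simp
  have zs: "set z \<subseteq> {..<b}" using raise_set assms by blast
  have i2: "b - Suc (Suc ?i) = i" "Suc ?i < b" using i by auto
  have d: "exc ?i (dual b z) t = exc i z (length y - t) - exc i z (length y)" for t
    using exc_dual[OF zs i2(2)] i2(1) zl by simp
  have sp: "length y - Suc ?p = p" using pl by simp
  have pk: "exc i z p = exc i y (Suc p) - 1"
    using pp[of p] exc_Suc_le[of i y p] e[of i p] by simp
  have "first_peak ?i (dual b z) ?p"
    unfolding first_peak_def
  proof (intro conjI allI impI)
    show "?p < length (dual b z)" using pl zl by simp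
  next
    fix t assume "t \<le> ?p"
    then have "length y - t > p" using pl by simp
    then show "exc ?i (dual b z) t < exc ?i (dual b z) (Suc ?p)"
      using pm[of "length y - t"] e[of i "length y - t"] pk unfolding d sp by simp
  next
    fix t
    show "exc ?i (dual b z) t \<le> exc ?i (dual b z) (Suc ?p)"
      using pm[of "length y - t"] pp[of "length y - t"] e[of i "length y - t"] pk
      unfolding d sp by (simp split: if_splits)
  qed
  moreover have "dual b y = (dual b z)[?p := ?i]"
  proof -
    have "y = z[p := Suc i]" using z first_peak_nth[OF p] by (metis list_update_id list_update_overwrite)
    then have "dual b y = dual b (z[p := Suc i])" by simp
    also have "\<dots> = (dual b z)[?p := ?i]"
      using pl zl by (simp add: dual_def map_update rev_update)
    finally show ?thesis .
  qed
  ultimately show ?thesis using i2(2) unfolding raise_def by blast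
qed

lemma raises_dual:
  assumes "raises b y z" "set y \<subseteq> {..<b}"
  shows "raises b (dual b z) (dual b y)"
  using assms
proof (induction rule: rtranclp_induct)
  case (step z z')
  then show ?case using raise_dual raises_set by (metis converse_rtranclp_into_rtranclp)
qed simp

lemma lw_dual:
  assumes "set y \<subseteq> {..<b}"
  shows "lw b y \<longleftrightarrow> hw b (dual b y)"
proof
  assume lw: "lw b y"
  show "hw b (dual b y)"
    unfolding hw_def
  proof (intro allI impI)
    fix i t assume i: "Suc i < b"
    then have "Suc (b - Suc (Suc i)) < b" by simp
    then show "exc i (dual b y) t \<le> 0"
      using lw exc_dual[OF assms i] by (simp add: lw_def)
  qed
next
  assume hw: "hw b (dual b y)"
  show "lw b y"
    unfolding lw_def
  proof (intro allI impI)
    fix i t assume i: "Suc i < b"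
    then have i2: "Suc (b - Suc (Suc i)) < b" "b - Suc (Suc (b - Suc (Suc i))) = i" by auto
    have "exc i y t - exc i y (length y) \<le> 0" if "t \<le> length y" for t
    proof -
      have "exc (b - Suc (Suc i)) (dual b y) (length y - t) \<le> 0"
        using hw i2(1) unfolding hw_def by blast
      then show ?thesis using exc_dual[OF assms i2(1), of "length y - t"] i2(2) that by simp
    qed
    then show "exc i y t \<le> exc i y (length y)"
      using exc_beyond[of y t i] by (cases "t \<le> length y") auto
  qed
qed

definition bot_word :: "nat \<Rightarrow> nat list \<Rightarrow> nat list" where
  "bot_word b y = dual b (top_word b (dual b y))"

lemma bot_word_length [simp]: "length (bot_word b y) = length y"
  by (simp add: bot_word_def)

context
  fixes b :: nat and y :: "nat list"
  assumes y: "set y \<subseteq> {..<b}"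
begin

lemma bot_word_set: "set (bot_word b y) \<subseteq> {..<b}"
  using y by (simp add: bot_word_def dual_set top_word_set)

lemma bot_word_raises: "raises b (bot_word b y) y"
  using raises_dual[OF top_word(1) dual_set[OF y]] y by (simp add: bot_word_def dual_dual)

lemma lw_bot_word: "lw b (bot_word b y)"
  using lw_dual[OF bot_word_set] top_word(2) dual_dual[OF top_word_set[OF dual_set[OF y]]]
  by (simp add: bot_word_def)

lemma bot_word_lw: "lw b y \<Longrightarrow> bot_word b y = y"
  using lw_dual[OF y] top_word_hw dual_dual[OF y] by (simp add: bot_word_def)

lemma bot_word_cong: "raises b y z \<Longrightarrow> bot_word b y = bot_word b z"
  using raises_dual[OF _ y] top_word_raises by (metis bot_word_def)

lemma bot_word_top_word: "bot_word b (top_word b y) = bot_word b y"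
  using bot_word_cong top_word(1) by metis

lemma top_word_bot_word: "top_word b (bot_word b y) = top_word b y"
  using top_word_raises bot_word_raises by metis

end

lemma bot_word_eqI:
  "raises b z y \<Longrightarrow> set z \<subseteq> {..<b} \<Longrightarrow> lw b z \<Longrightarrow> bot_word b y = z"
  using bot_word_cong bot_word_lw by metis

text \<open>The tensor product rule. The first maximum lies in one factor, and the excess on that
  factor differs from the factor's own excess by a constant, so the position is the factor's own
  peak. The converse fails in general, because the other factor may hold a higher peak.\<close>

lemma raise_appendE:
  assumes "raise b (x @ y) z"
  obtains x' where "raise b x x'" "z = x' @ y" | y' where "raise b y y'" "z = x @ y'"
proof -
  obtain i p where i: "Suc i < b" and p: "first_peak i (x @ y) p" and z: "z = (x @ y)[p := i]"
    using assms(1) by (auto simp: raise_def)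
  have pl: "p < length (x @ y)" and pp: "\<And>t. t \<le> p \<Longrightarrow> exc i (x @ y) t < exc i (x @ y) (Suc p)"
    and pm: "\<And>t. exc i (x @ y) t \<le> exc i (x @ y) (Suc p)"
    using p unfolding first_peak_def by blast+
  show ?thesis
  proof (cases "p < length x")
    case True
    have ex: "exc i (x @ y) t = exc i x t" if "t \<le> length x" for t
      using that by (simp add: exc_append)
    have "first_peak i x p"
      unfolding first_peak_def
    proof (intro conjI allI impI)
      fix t assume "t \<le> p"
      then show "exc i x t < exc i x (Suc p)" using pp[of t] ex True by simp
    next
      fix t
      show "exc i x t \<le> exc i x (Suc p)"
        using pm[of t] pm[of "length x"] ex[of t] ex[of "length x"] ex[of "Suc p"] True
          exc_beyond[of x t i]
        by (cases "t \<le> length x") auto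
    qed (use True in simp)
    then have "raise b x (x[p := i])" using i by (auto simp: raise_def)
    moreover have "z = x[p := i] @ y" using z True by (simp add: list_update_append)
    ultimately show ?thesis using that(1) by blast
  next
    case False
    then obtain q where q: "p = length x + q" using le_Suc_ex not_less by blast
    have ex: "exc i (x @ y) (length x + t) = exc i x (length x) + exc i y t" for t
      using exc_beyond[of x "length x + t" i] by (simp add: exc_append)
    have "first_peak i y q"
      unfolding first_peak_def
    proof (intro conjI allI impI)
      fix t assume "t \<le> q"
      then show "exc i y t < exc i y (Suc q)"
        using pp[of "length x + t"] ex[of t] ex[of "Suc q"] q by simp
    next
      fix t
      show "exc i y t \<le> exc i y (Suc q)"
        using pm[of "length x + t"] ex[of t] ex[of "Suc q"] q by simp
    qed (use pl q in simp)
    then have "raise b y (y[q := i])" using i by (auto simp: raise_def)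
    moreover have "z = x @ y[q := i]" using z q by (simp add: list_update_append)
    ultimately show ?thesis using that(2) by blast
  qed
qed

lemma raises_append:
  assumes "raises b (x @ y) z"
  shows "\<exists>x' y'. z = x' @ y' \<and> raises b x x' \<and> raises b y y'"
  using assms
proof (induction rule: rtranclp_induct)
  case (step z z')
  then obtain x' y' where xy: "z = x' @ y'" "raises b x x'" "raises b y y'" by blast
  from step(2)[unfolded xy(1)] show ?case
  proof (cases rule: raise_appendE)
    case (1 x'')
    then show ?thesis using xy rtranclp.rtrancl_into_rtrancl[OF xy(2)] by blast
  next
    case (2 y'')
    then show ?thesis using xy rtranclp.rtrancl_into_rtrancl[OF xy(3)] by blast
  qed
qed blast

lemma raises_append2:
  assumes "raises b (x @ y) (x' @ y')" "length x' = length x"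
  shows "raises b x x'" "raises b y y'"
  using raises_append[OF assms(1)] assms(2) raises_length by (metis append_eq_append_conv)+

lemma hw_appendD: assumes "hw b (x @ y)" shows "hw b x"
proof -
  have "\<not> exc i x t > 0" if "Suc i < b" for i t
  proof
    assume "exc i x t > 0"
    moreover have "exc i x t = exc i (x @ y) (min t (length x))"
      using exc_beyond[of x t i] by (auto simp: exc_append min_def)
    moreover have "exc i (x @ y) (min t (length x)) \<le> 0"
      using assms that unfolding hw_def by blast
    ultimately show False by simp
  qed
  then show ?thesis unfolding hw_def by (meson not_less)
qed

lemma lw_appendD: assumes "lw b (x @ y)" shows "lw b y"
  unfolding lw_def
proof (intro allI impI)
  fix i t assume "Suc i < b"
  then have "exc i (x @ y) (length x + t) \<le> exc i (x @ y) (length (x @ y))"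
    using assms unfolding lw_def by blast
  then show "exc i y t \<le> exc i y (length y)"
    using exc_beyond[of x "length x + t" i] exc_beyond[of x "length x + length y" i]
    by (simp add: exc_append)
qed

text \<open>Prefixes of highest weight words are highest, so the front of the result must be
  \<open>top_word b x\<close>. The rest is only some raised form of \<open>y\<close>, in general not
  its top word.\<close>

lemma top_word_append:
  obtains y' where "top_word b (x @ y) = top_word b x @ y'" "raises b y y'"
proof -
  obtain x' y' where xy: "top_word b (x @ y) = x' @ y'" "raises b x x'" "raises b y y'"
    using raises_append[OF top_word(1)] by blast
  then have "hw b x'" using hw_appendD top_word(2) by metis
  then show ?thesis using that xy top_word_eqI by metis
qed

text \<open>Suffixes of lowest weight words are lowest, so here the back is determined and the front
  is only known to raise to \<open>x\<close>.\<close>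

lemma bot_word_append:
  assumes "set (x @ y) \<subseteq> {..<b}"
  obtains x' where "bot_word b (x @ y) = x' @ bot_word b y" "raises b x' x"
proof -
  let ?z = "bot_word b (x @ y)"
  let ?x = "take (length x) ?z" and ?y = "drop (length x) ?z"
  have "raises b (?x @ ?y) (x @ y)" using bot_word_raises[OF assms] by simp
  then have r: "raises b ?x x" "raises b ?y y" by (rule raises_append2; simp)+
  have "lw b ?y" using lw_appendD[of b ?x ?y] lw_bot_word[OF assms] by simp
  moreover have "set ?y \<subseteq> {..<b}"
    using bot_word_set[OF assms] set_drop_subset[of "length x" ?z] by blast
  ultimately have "bot_word b y = ?y" using r bot_word_eqI by blast
  then show ?thesis using that[of ?x] r by simp
qed

text \<open>Just before the peak the excess is at least its height minus 1 and is untouched by the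
  change, so each raising costs at most 1 of the attained height.\<close>

lemma raise_times:
  assumes "Suc i < b" "int l \<le> exc i y t"
  shows "\<exists>z. raises b y z \<and> (\<forall>c. int (count_list z c) =
    int (count_list y c) + (if c = i then int l else if c = Suc i then - int l else 0))"
  using assms(2)
proof (induction l arbitrary: y t)
  case 0
  show ?case by (rule exI[of _ y]) auto
next
  case (Suc l)
  then have "exc i y t > 0" by simp
  from first_peak_ex[OF this] obtain p where p: "first_peak i y p" "exc i y t \<le> exc i y (Suc p)" .
  define y1 where "y1 = y[p := i]"
  have "exc i y1 p = exc i y p" using first_peak_exc_update[OF p(1), of i p] by (simp add: y1_def)
  then have "int l \<le> exc i y1 p" using exc_Suc_le[of i y p] p(2) Suc.prems by linarith
  from Suc.IH[OF this] obtain z where z: "raises b y1 z" "\<And>c. int (count_list z c) =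
    int (count_list y1 c) + (if c = i then int l else if c = Suc i then - int l else 0)" by blast
  have "raise b y y1" using p(1) assms(1) by (auto simp: raise_def y1_def)
  then have "raises b y z" using z(1) by (rule converse_rtranclp_into_rtranclp)
  moreover have "p < length y" using p(1) unfolding first_peak_def by blast
  then have "int (count_list y1 c) = int (count_list y c) + of_bool (i = c) - of_bool (Suc i = c)" for c
    using first_peak_nth[OF p(1)] by (simp add: y1_def count_list_update)
  ultimately show ?case using z(2) by (intro exI[of _ z]) auto
qed

section \<open>Contents of top and bottom words\<close>

text \<open>Contents occurring in the crystal component of \<open>y\<close>, where a component is
  recognised by its common top word.\<close>

definition weights :: "nat \<Rightarrow> nat list \<Rightarrow> (nat \<Rightarrow> nat) set" where
  "weights b y = {count_list z |z. set z \<subseteq> {..<b} \<and> top_word b z = top_word b y}"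

text \<open>The simple reflection of the Weyl group. If \<open>f i\<close> is the smaller value, the
  final excess is the difference, so that many raisings exchange the two counts; otherwise the same
  is done in the dual word.\<close>

lemma weights_swap:
  assumes f: "f \<in> weights b y" and i: "Suc i < b"
  shows "f(i := f (Suc i), Suc i := f i) \<in> weights b y"
proof -
  obtain z where z: "f = count_list z" "set z \<subseteq> {..<b}" "top_word b z = top_word b y"
    using f by (auto simp: weights_def)
  show ?thesis
  proof (cases "f i \<le> f (Suc i)")
    case True
    then have "int (f (Suc i) - f i) \<le> exc i z (length z)" using z(1) by (simp add: exc_def)
    from raise_times[OF i this] obtain z' where z': "raises b z z'"
      "\<And>c. int (count_list z' c) = int (count_list z c) +
        (if c = i then int (f (Suc i) - f i) else if c = Suc i then - int (f (Suc i) - f i) else 0)"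
      by blast
    have "count_list z' = f(i := f (Suc i), Suc i := f i)"
    proof
      fix c
      show "count_list z' c = (f(i := f (Suc i), Suc i := f i)) c"
        using z'(2)[of c] z(1) True by (auto split: if_splits)
    qed
    moreover have "top_word b z' = top_word b y" using top_word_raises z' z by metis
    ultimately show ?thesis using raises_set[OF z'(1) z(2)] unfolding weights_def
      by (metis (mono_tags, lifting) mem_Collect_eq)
  next
    case False
    let ?i = "b - Suc (Suc i)" and ?d = "dual b z"
    have i2: "Suc ?i < b" "b - Suc (Suc ?i) = i" using i by auto
    have d: "set ?d \<subseteq> {..<b}" using dual_set z by blast
    have "int (f i - f (Suc i)) \<le> exc ?i ?d (length z)"
      using False z(1) exc_dual[OF z(2) i2(1), of "length z"] i2(2) by (simp add: exc_def)
    from raise_times[OF i2(1) this] obtain z2 where z2: "raises b ?d z2"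
      "\<And>c. int (count_list z2 c) = int (count_list ?d c) +
        (if c = ?i then int (f i - f (Suc i)) else if c = Suc ?i then - int (f i - f (Suc i)) else 0)"
      by blast
    have s2: "set z2 \<subseteq> {..<b}" using raises_set z2 d by blast
    let ?z = "dual b z2"
    have "raises b ?z z" using raises_dual[OF z2(1) d] z by (simp add: dual_dual)
    then have "top_word b ?z = top_word b y" using top_word_raises z by metis
    moreover have "count_list ?z = f(i := f (Suc i), Suc i := f i)"
    proof
      fix c
      show "count_list ?z c = (f(i := f (Suc i), Suc i := f i)) c"
      proof (cases "c < b")
        case True
        then have "b - Suc c < b" "b - Suc (b - Suc c) = c" by auto
        moreover have "b - Suc c = ?i \<longleftrightarrow> c = Suc i" "b - Suc c = Suc ?i \<longleftrightarrow> c = i"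
          using True i by auto
        ultimately show ?thesis
          using z2(2)[of "b - Suc c"] count_list_dual[OF s2 True]
            count_list_dual[OF z(2), of "b - Suc c"] z(1) False
          by (auto split: if_splits)
      next
        case F: False
        then have "c \<notin> set ?z" "c \<notin> set z" using z(2) dual_set[OF s2] by auto
        then show ?thesis using F i z(1) by (auto simp: count_list_0_iff)
      qed
    qed
    ultimately show ?thesis using dual_set[OF s2] unfolding weights_def
      by (metis (mono_tags, lifting) mem_Collect_eq)
  qed
qed

lemma weights_transpose:
  assumes "f \<in> weights b y" "i < j" "j < b"
  shows "f(i := f j, j := f i) \<in> weights b y"
proof -
  have "Suc i \<le> j" using assms by simp
  then show ?thesis using assms(1,3)
  proof (induction j arbitrary: f rule: dec_induct)
    case base
    then show ?case using weights_swap by blast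
  next
    case (step j)
    let ?g = "f(j := f (Suc j), Suc j := f j)"
    have "?g \<in> weights b y" using weights_swap step.prems by blast
    then have "?g(i := ?g j, j := ?g i) \<in> weights b y" (is "?h \<in> _")
      by (rule step.IH) (use step.prems in simp)
    then have "?h(j := ?h (Suc j), Suc j := ?h j) \<in> weights b y"
      using weights_swap step.prems by blast
    moreover have "?h(j := ?h (Suc j), Suc j := ?h j) = f(i := f (Suc j), Suc j := f i)"
      using step.hyps by (auto simp: fun_eq_iff)
    ultimately show ?case by (simp only:)
  qed
qed

text \<open>Reversal is a product of \<open>b div 2\<close> disjoint transpositions exchanging
  \<open>n\<close> and \<open>b - Suc n\<close>; the claim proved by induction applies the first
  \<open>n\<close> of them. Contents are functions on all of \<open>nat\<close>, hence the default
  value outside \<open>{..<b}\<close>.\<close>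

lemma weights_reverse:
  assumes "f \<in> weights b y"
  shows "(\<lambda>l. if l < b then f (b - Suc l) else f l) \<in> weights b y"
proof -
  have *: "(\<lambda>l. if l < b \<and> (l < n \<or> b - Suc l < n) then f (b - Suc l) else f l) \<in> weights b y"
    if "2 * n \<le> b" for n
    using that
  proof (induction n)
    case 0
    then show ?case using assms by simp
  next
    case (Suc n)
    let ?g = "\<lambda>l. if l < b \<and> (l < n \<or> b - Suc l < n) then f (b - Suc l) else f l"
    let ?h = "\<lambda>l. if l < b \<and> (l < Suc n \<or> b - Suc l < Suc n) then f (b - Suc l) else f l"
    have swap: "G(n := G k, k := G n) = H"
      if "\<And>l. l \<noteq> n \<Longrightarrow> l \<noteq> k \<Longrightarrow> G l = H l" "H n = G k" "H k = G n" for k and G H :: "nat \<Rightarrow> nat"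
      using that by (auto simp: fun_eq_iff)
    define k where "k = b - Suc n"
    have k: "b - Suc n = k" "b - Suc k = n" "n < k" "k < b" "n < b" "n \<noteq> k" "\<not> k < n"
      using Suc.prems by (auto simp: k_def)
    have g: "?g n = f n" "?g k = f k" by (simp_all only: k) simp_all
    have h: "?h n = f k" "?h k = f n" by (simp_all only: k lessI simp_thms if_True)
    have "?g(n := ?g k, k := ?g n) \<in> weights b y"
    proof (rule weights_transpose[where f = ?g and i = n and j = k])
      show "?g \<in> weights b y" by (rule Suc.IH) (use Suc.prems in simp)
    qed (use k in simp_all)
    moreover have "?g(n := ?g k, k := ?g n) = ?h"
    proof (rule swap[where G = ?g and H = ?h and k = k])
      fix l assume "l \<noteq> n" "l \<noteq> k"
      then have "l < n \<longleftrightarrow> l < Suc n" "l < b \<Longrightarrow> b - Suc l < n \<longleftrightarrow> b - Suc l < Suc n"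
        using k by auto
      then show "?g l = ?h l" by (cases "l < b") simp_all
    qed (simp_all only: g h)
    ultimately show ?case by (simp only:)
  qed
  have "(\<lambda>l. if l < b \<and> (l < b div 2 \<or> b - Suc l < b div 2) then f (b - Suc l) else f l) \<in> weights b y"
    by (rule *) simp
  moreover have "(\<lambda>l. if l < b \<and> (l < b div 2 \<or> b - Suc l < b div 2) then f (b - Suc l) else f l)
      = (\<lambda>l. if l < b then f (b - Suc l) else f l)"
  proof
    fix l
    show "(if l < b \<and> (l < b div 2 \<or> b - Suc l < b div 2) then f (b - Suc l) else f l)
      = (if l < b then f (b - Suc l) else f l)"
    proof (cases "l < b \<and> \<not> (l < b div 2 \<or> b - Suc l < b div 2)")
      case True
      then obtain m where m: "b = Suc (l + m)" using less_imp_Suc_add by blast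
      then have "b - Suc l = m" by simp
      moreover have "m = l" using True m calculation by linarith
      ultimately have "b - Suc l = l" by simp
      then show ?thesis by (simp only: if_cancel)
    qed auto
  qed
  ultimately show ?thesis by (simp only:)
qed

lemma sum_count_list:
  fixes y :: "nat list"
  shows "(\<Sum>l<s. count_list y l) = length (filter (\<lambda>l. l < s) y)"
proof (induction y)
  case (Cons a y)
  have "(\<Sum>l<s. count_list (a # y) l) = (\<Sum>l<s. count_list y l + (if l = a then 1 else 0))"
    by (intro sum.cong) auto
  also have "\<dots> = (\<Sum>l<s. count_list y l) + (\<Sum>l<s. if l = a then 1 else 0)"
    by (rule sum.distrib)
  also have "(\<Sum>l<s. if l = a then 1 else 0) = (if a < s then 1 else 0 :: nat)"
    by (subst sum.delta) auto
  finally show ?case using Cons by simp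
qed simp

text \<open>Letters never increase along a raising path, so contents rise in dominance
  order.\<close>

lemma sum_count_list_raises:
  assumes "raises b y z"
  shows "(\<Sum>l<s. count_list y l) \<le> (\<Sum>l<s. count_list z l)"
proof -
  have "{t. t < length y \<and> y ! t < s} \<subseteq> {t. t < length z \<and> z ! t < s}"
    using raises_length[OF assms] raises_nth_le[OF assms] by (auto intro: le_less_trans)
  then have "card {t. t < length y \<and> y ! t < s} \<le> card {t. t < length z \<and> z ! t < s}"
    by (intro card_mono) auto
  then show ?thesis by (simp add: sum_count_list length_filter_conv_card)
qed

lemma sum_lessThan_rev:
  fixes f :: "nat \<Rightarrow> nat"
  assumes "s \<le> b"
  shows "(\<Sum>l<s. f (b - Suc l)) + (\<Sum>l<b - s. f l) = (\<Sum>l<b. f l)"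
  using assms
proof (induction s)
  case (Suc s)
  then have "b - s = Suc (b - Suc s)" by simp
  with Suc show ?case by simp
qed simp

text \<open>The weights of a component are stable under permutations of the letters, its top word has
  the dominant maximum among them and its bottom word the minimum.\<close>

lemma count_bot_word:
  assumes y: "set y \<subseteq> {..<b}" and "l < b"
  shows "count_list (bot_word b y) l = count_list (top_word b y) (b - Suc l)"
proof -
  let ?f = "count_list (top_word b y)" and ?g = "count_list (bot_word b y)"
  let ?r = "\<lambda>h l. if l < b then h (b - Suc l) else h l :: nat"
  have f: "?f \<in> weights b y"
    using top_word_set[OF y] top_word_hw[OF top_word(2)] unfolding weights_def by blast
  have g: "?g \<in> weights b y"
    using bot_word_set[OF y] top_word_bot_word[OF y] unfolding weights_def by blast
  have up: "sum h {..<s} \<le> sum ?f {..<s}" if h: "h \<in> weights b y" for h s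
  proof -
    obtain z where z: "h = count_list z" "top_word b z = top_word b y"
      using h unfolding weights_def by blast
    then show ?thesis using sum_count_list_raises[OF top_word(1)[of b z]] by simp
  qed
  have down: "sum ?g {..<s} \<le> sum h {..<s}" if h: "h \<in> weights b y" for h s
  proof -
    obtain z where z: "h = count_list z" "set z \<subseteq> {..<b}" "top_word b z = top_word b y"
      using h unfolding weights_def by blast
    have "bot_word b z = bot_word b y"
      using bot_word_top_word[OF z(2)] bot_word_top_word[OF y] z(3) by simp
    then have "raises b (bot_word b y) z" using bot_word_raises[OF z(2)] by simp
    from sum_count_list_raises[OF this] show ?thesis using z(1) by simp
  qed
  have total: "sum ?f {..<b} = sum ?g {..<b}"
  proof -
    have "sum (count_list z) {..<b} = length z" if "set z \<subseteq> {..<b}" for z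
      using that by (simp add: sum_count_list filter_True subset_iff)
    then show ?thesis using top_word_set[OF y] bot_word_set[OF y] by simp
  qed
  have r: "sum (?r h) {..<s} + sum h {..<b - s} = sum h {..<b}" if "s \<le> b" for h s
  proof -
    have "sum (?r h) {..<s} = (\<Sum>l<s. h (b - Suc l))" using that by (intro sum.cong) auto
    then show ?thesis using sum_lessThan_rev[OF that] by simp
  qed
  \<comment> \<open>The reversed bottom content is a weight, hence dominated by \<open>?f\<close>.
    The reversed top content is a weight too, hence dominates \<open>?g\<close>; taking complements
    in the common total gives the other inequality.\<close>
  have eq: "sum ?f {..<s} = sum (?r ?g) {..<s}" if s: "s \<le> b" for s
  proof (rule antisym)
    have "sum ?g {..<b - s} \<le> sum (?r ?f) {..<b - s}" by (rule down[OF weights_reverse[OF f]])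
    then show "sum ?f {..<s} \<le> sum (?r ?g) {..<s}"
      using r[of "b - s" ?f] r[OF s, of ?g] s total by simp
  qed (rule up[OF weights_reverse[OF g]])
  have "?f k = ?r ?g k" if "k < b" for k
    using eq[of k] eq[of "Suc k"] that by simp
  from this[of "b - Suc l"] show ?thesis using \<open>l < b\<close> by simp
qed

section \<open>Powers of a balanced word\<close>

lemma exc_Nil [simp]: "exc i [] t = 0"
  by (simp add: exc_def)

text \<open>Inside \<open>x\<close> the excess does not see what follows, and behind
  \<open>x\<close> the bound keeps \<open>z\<close> below a height that \<open>w\<close> already
  reached without destroying the peak.\<close>

lemma first_peak_append_left:
  assumes p: "first_peak i (x @ w) p" and "p < length x"
    and bound: "\<And>t. \<exists>s. exc i z t \<le> exc i w s"
  shows "first_peak i (x @ z) p"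
proof -
  have pp: "\<And>t. t \<le> p \<Longrightarrow> exc i (x @ w) t < exc i (x @ w) (Suc p)"
    and pm: "\<And>t. exc i (x @ w) t \<le> exc i (x @ w) (Suc p)"
    using p unfolding first_peak_def by blast+
  have ex: "exc i (x @ v) t = exc i x t" if "t \<le> length x" for t v
    using that by (simp add: exc_append)
  show ?thesis
    unfolding first_peak_def
  proof (intro conjI allI impI)
    fix t assume "t \<le> p"
    then show "exc i (x @ z) t < exc i (x @ z) (Suc p)"
      using pp[of t] ex[of t] ex[of "Suc p"] \<open>p < length x\<close> by simp
  next
    fix t
    show "exc i (x @ z) t \<le> exc i (x @ z) (Suc p)"
    proof (cases "t \<le> length x")
      case True
      then show ?thesis using pm[of t] ex[of t] ex[of "Suc p"] \<open>p < length x\<close> by simp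
    next
      case False
      obtain s where s: "exc i z (t - length x) \<le> exc i w s" using bound by blast
      have "exc i (x @ w) (length x + s) = exc i x (length x) + exc i w s"
        using exc_beyond[of x "length x + s" i] by (simp add: exc_append)
      moreover have "exc i (x @ z) t = exc i x (length x) + exc i z (t - length x)"
        using exc_beyond[of x t i] False by (simp add: exc_append)
      ultimately show ?thesis
        using pm[of "length x + s"] s ex[of "Suc p"] \<open>p < length x\<close> by simp
    qed
  qed (use assms(2) in simp)
qed

lemma raises_sum_list: "raises b y z \<Longrightarrow> sum_list z \<le> sum_list y \<and> (sum_list z = sum_list y \<longrightarrow> z = y)"
  by (induction rule: rtranclp_induct) (auto dest: raise_sum_list)

text \<open>Supplies the missing converse of \<open>raise_appendE\<close>: a path that leaves the
  block \<open>w\<close> fixed depends on \<open>w\<close> only through the heights reached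
  there.\<close>

lemma raises_append_left:
  assumes "raises b (x @ w) (u @ w)" "length u = length x"
    and bound: "\<And>i t. Suc i < b \<Longrightarrow> \<exists>s. exc i z t \<le> exc i w s"
  shows "raises b (x @ z) (u @ z)"
proof -
  have "\<forall>x. y = x @ w \<longrightarrow> length u = length x \<longrightarrow> raises b (x @ z) (u @ z)"
    if "raises b y (u @ w)" for y
    using that
  proof (induction rule: converse_rtranclp_induct)
    case base
    then show ?case by auto
  next
    case (step y y')
    show ?case
    proof (intro allI impI)
      fix x assume y: "y = x @ w" and len: "length u = length x"
      obtain i p where i: "Suc i < b" and p: "first_peak i y p" and y': "y' = y[p := i]"
        using step.hyps(1) by (auto simp: raise_def)
      \<comment> \<open>A step inside the block would lower one of its letters, and letters never
        rise again, but the path ends with \<open>w\<close> intact.\<close>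
      have "p < length x"
      proof (rule ccontr)
        assume "\<not> p < length x"
        then obtain q where q: "p = length x + q" using le_Suc_ex not_less by blast
        have "p < length y" using p unfolding first_peak_def by blast
        then have "y' ! p = i" using y' by simp
        moreover have "(u @ w) ! p \<le> y' ! p" using raises_nth_le step.hyps(2) by blast
        moreover have "(u @ w) ! p = y ! p" using y q len by (simp add: nth_append)
        ultimately show False using first_peak_nth[OF p] by simp
      qed
      then have "y' = x[p := i] @ w" using y y' by (simp add: list_update_append)
      then have "raises b (x[p := i] @ z) (u @ z)" using step.IH len by simp
      moreover have "first_peak i (x @ z) p"
        using first_peak_append_left[OF _ \<open>p < length x\<close>] p y bound[OF i] by blast
      then have "raise b (x @ z) (x[p := i] @ z)"
        using i \<open>p < length x\<close> unfolding raise_def by (metis list_update_append1)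
      ultimately show "raises b (x @ z) (u @ z)" by (meson converse_rtranclp_into_rtranclp)
    qed
  qed
  then show ?thesis using assms by blast
qed

text \<open>A peak behind \<open>w\<close> is strictly higher than everything in \<open>w\<close>.
  Since \<open>w\<close> ends at 0, heights in \<open>g\<close> have to be compared relative to the
  end of \<open>g\<close>, which is the form of the bound.\<close>

lemma first_peak_append_right:
  assumes p: "first_peak i (w @ x) (length w + q)" and w: "exc i w (length w) = 0"
    and bound: "\<And>t. \<exists>s. exc i g t - exc i g (length g) \<le> exc i w s"
  shows "first_peak i (g @ x) (length g + q)"
proof -
  have pp: "\<And>t. t \<le> length w + q \<Longrightarrow> exc i (w @ x) t < exc i (w @ x) (Suc (length w + q))"
    and pm: "\<And>t. exc i (w @ x) t \<le> exc i (w @ x) (Suc (length w + q))"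
    and pl: "length w + q < length (w @ x)"
    using p unfolding first_peak_def by blast+
  have ew: "exc i (w @ x) (length w + t) = exc i x t" for t
    using exc_beyond[of w "length w + t" i] w by (simp add: exc_append)
  have eg: "exc i (g @ x) (length g + t) = exc i g (length g) + exc i x t" for t
    using exc_beyond[of g "length g + t" i] by (simp add: exc_append)
  have x: "exc i x t \<le> exc i x (Suc q)" for t
    using pm[of "length w + t"] ew[of t] ew[of "Suc q"] by simp
  have g: "exc i g t < exc i g (length g) + exc i x (Suc q)" for t
  proof -
    obtain s where s: "exc i g t - exc i g (length g) \<le> exc i w s" using bound by blast
    have "exc i w s = exc i (w @ x) (min s (length w))"
      using exc_beyond[of w s i] by (auto simp: exc_append min_def)
    then have "exc i w s < exc i x (Suc q)"
      using pp[of "min s (length w)"] ew[of "Suc q"] by simp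
    with s show ?thesis by simp
  qed
  have gt: "exc i (g @ x) t = exc i g t" if "t \<le> length g" for t
    using that by (simp add: exc_append)
  show ?thesis
    unfolding first_peak_def
  proof (intro conjI allI impI)
    fix t assume t: "t \<le> length g + q"
    show "exc i (g @ x) t < exc i (g @ x) (Suc (length g + q))"
    proof (cases "t \<le> length g")
      case True
      then show ?thesis using g[of t] gt eg[of "Suc q"] by simp
    next
      case False
      then obtain t' where t': "t = length g + t'" by (metis le_Suc_ex nat_le_linear)
      then have "exc i x t' < exc i x (Suc q)"
        using t pp[of "length w + t'"] ew[of t'] ew[of "Suc q"] by simp
      then show ?thesis using t' eg[of t'] eg[of "Suc q"] by simp
    qed
  next
    fix t
    show "exc i (g @ x) t \<le> exc i (g @ x) (Suc (length g + q))"
    proof (cases "t \<le> length g")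
      case True
      then show ?thesis using g[of t] gt eg[of "Suc q"] by simp
    next
      case False
      then obtain t' where t': "t = length g + t'" by (metis le_Suc_ex nat_le_linear)
      then show ?thesis using x[of t'] eg[of t'] eg[of "Suc q"] by simp
    qed
  qed (use pl in simp)
qed

lemma raises_append_right:
  assumes "raises b (w @ x) (w @ u)"
    and w: "\<And>i. Suc i < b \<Longrightarrow> exc i w (length w) = 0"
    and bound: "\<And>i t. Suc i < b \<Longrightarrow> \<exists>s. exc i g t - exc i g (length g) \<le> exc i w s"
  shows "raises b (g @ x) (g @ u)"
proof -
  have "\<forall>x. y = w @ x \<longrightarrow> raises b (g @ x) (g @ u)"
    if "raises b y (w @ u)" for y
    using that
  proof (induction rule: converse_rtranclp_induct)
    case base
    then show ?case by auto
  next
    case (step y y')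
    show ?case
    proof (intro allI impI)
      fix x assume y: "y = w @ x"
      obtain i p where i: "Suc i < b" and p: "first_peak i y p" and y': "y' = y[p := i]"
        using step.hyps(1) by (auto simp: raise_def)
      have pl: "p < length y" using p unfolding first_peak_def by blast
      have "\<not> p < length w"
      proof
        assume "p < length w"
        moreover have "y' ! p = i" using y' pl by simp
        moreover have "(w @ u) ! p \<le> y' ! p" using raises_nth_le step.hyps(2) by blast
        ultimately show False using first_peak_nth[OF p] y by (simp add: nth_append)
      qed
      then obtain q where q: "p = length w + q" using le_Suc_ex not_less by blast
      then have "y' = w @ x[q := i]" using y y' by (simp add: list_update_append)
      then have "raises b (g @ x[q := i]) (g @ u)" using step.IH by blast
      moreover have "first_peak i (g @ x) (length g + q)"
        using first_peak_append_right[OF _ w[OF i] bound[OF i]] p y q by blast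
      then have "raise b (g @ x) (g @ x[q := i])"
        using i unfolding raise_def
        by (intro exI[of _ i] exI[of _ "length g + q"]) (simp add: list_update_append)
      ultimately show "raises b (g @ x) (g @ u)" by (meson converse_rtranclp_into_rtranclp)
    qed
  qed
  then show ?thesis using assms(1) by blast
qed

lemma hw_append: "hw b x \<Longrightarrow> hw b y \<Longrightarrow> hw b (x @ y)"
  unfolding hw_def by (simp add: exc_append add_nonpos_nonpos)

section \<open>Powers of words and words of prescribed weight\<close>

definition power_word :: "nat list \<Rightarrow> nat \<Rightarrow> nat list" where
  "power_word w k = concat (replicate k w)"

lemma power_word_0 [simp]: "power_word w 0 = []"
  by (simp add: power_word_def)

lemma power_word_Suc: "power_word w (Suc k) = w @ power_word w k"
  by (simp add: power_word_def)

lemma power_word_add: "power_word w (j + k) = power_word w j @ power_word w k"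
  by (simp add: power_word_def replicate_add)

lemma power_word_Suc_right: "power_word w (Suc k) = power_word w k @ w"
  using power_word_add[of w k 1] by (simp add: power_word_Suc)

lemma count_list_power_word: "count_list (power_word w k) l = k * count_list w l"
  by (induction k) (auto simp: power_word_Suc)

lemma length_power_word: "length (power_word w k) = k * length w"
  by (induction k) (auto simp: power_word_Suc)

lemma set_power_word: "set (power_word w k) \<subseteq> set w"
  by (induction k) (auto simp: power_word_Suc)

lemma set_power_word_subset: "set w \<subseteq> A \<Longrightarrow> set (power_word w k) \<subseteq> A"
  using set_power_word by blast

lemma hw_power_word: "hw b w \<Longrightarrow> hw b (power_word w k)"
  by (induction k) (auto simp: power_word_Suc hw_append hw_def[of b "[]"])

lemma exc_power_word_length:
  "exc i (power_word w k) (length (power_word w k)) = int k * exc i w (length w)"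
proof (induction k)
  case (Suc k)
  then show ?case by (simp only: power_word_Suc exc_length_append) (simp add: algebra_simps)
qed simp

lemma exc_upt: "exc j [0..<n] t = (if j < min n t \<and> \<not> Suc j < min n t then - 1 else 0)"
proof -
  have "count_list [0..<m] l = (if l < m then 1 else 0)" for m l :: nat
    by (induction m) auto
  moreover have "take t [0..<n] = [0..<min n t]" by (simp add: take_upt min_def)
  ultimately show ?thesis by (simp add: exc_def)
qed

text \<open>The column word \<open>[0..<Suc n]\<close> has final excess -1 at \<open>n\<close> and 0
  at all other indices, a fundamental weight; taking \<open>e n\<close> copies of each column
  realises every dominant weight.\<close>

lemma column_word_ex:
  fixes e :: "nat \<Rightarrow> nat"
  obtains g where "set g \<subseteq> {..<b}" "hw b g"
    "\<And>i. Suc i < b \<Longrightarrow> exc i g (length g) = - int (e i)"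
proof -
  have "\<exists>g. set g \<subseteq> {..<b} \<and> hw b g \<and>
      (\<forall>i. exc i g (length g) = (if i < n then - int (e i) else 0))" if "n \<le> b" for n
    using that
  proof (induction n)
    case 0
    show ?case by (rule exI[of _ "[]"]) (simp add: hw_def exc_def)
  next
    case (Suc n)
    then obtain g where g: "set g \<subseteq> {..<b}" "hw b g"
      "\<And>i. exc i g (length g) = (if i < n then - int (e i) else 0)" by auto
    let ?c = "power_word [0..<Suc n] (e n)"
    have "set (g @ ?c) \<subseteq> {..<b}"
      using g(1) set_power_word[of "[0..<Suc n]" "e n"] Suc.prems by auto
    moreover have "hw b [0..<Suc n]" by (simp add: hw_def exc_upt del: upt_Suc)
    then have "hw b (g @ ?c)" using g(2) hw_append hw_power_word by blast
    moreover have "exc i (g @ ?c) (length (g @ ?c)) = (if i < Suc n then - int (e i) else 0)" for i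
      unfolding exc_length_append exc_power_word_length g(3)
      by (auto simp: exc_upt less_Suc_eq simp del: upt_Suc)
    ultimately show ?case by blast
  qed
  from this[of b] show ?thesis using that by auto
qed

context
  fixes b r :: nat and w :: "nat list"
  assumes w: "set w \<subseteq> {..<b}" and count_w: "\<And>l. l < b \<Longrightarrow> count_list w l = r"
begin

lemma exc_w_length: "Suc i < b \<Longrightarrow> exc i w (length w) = 0"
  using count_w by (simp add: exc_def)

text \<open>As \<open>w\<close> ends at excess 0, every copy repeats the same walk, and a power
  climbs no higher than one copy.\<close>

lemma exc_power_le: 
  assumes "Suc i < b"
  shows "\<exists>s. exc i (power_word w c) t \<le> exc i w s"
proof (induction c arbitrary: t)
  case 0
  show ?case by (rule exI[of _ 0]) simp
next
  case (Suc c)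
  show ?case
  proof (cases "t \<le> length w")
    case True
    then have "exc i (power_word w (Suc c)) t = exc i w t"
      by (simp add: power_word_Suc exc_append)
    then show ?thesis by (metis order_refl)
  next
    case False
    then have "exc i (power_word w (Suc c)) t = exc i (power_word w c) (t - length w)"
      using exc_beyond[of w t i] exc_w_length[OF assms] by (simp add: power_word_Suc exc_append)
    then show ?thesis using Suc.IH by metis
  qed
qed

lemma exc_power_length: "Suc i < b \<Longrightarrow> exc i (power_word w k) (length (power_word w k)) = 0"
  by (simp only: exc_power_word_length exc_w_length)

lemma top_word_power_stable:
  assumes "top_word b (power_word w (Suc K)) = top_word b (power_word w K) @ w"
  shows "top_word b (power_word w (K + c)) = top_word b (power_word w K) @ power_word w c"
proof (rule top_word_eqI)
  let ?u = "top_word b (power_word w K)"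
  have uw: "raises b (power_word w K @ w) (?u @ w)" "hw b (?u @ w)"
    using top_word[of b "power_word w (Suc K)"] assms by (simp_all add: power_word_Suc_right)
  show "raises b (power_word w (K + c)) (?u @ power_word w c)"
    unfolding power_word_add
    by (rule raises_append_left[OF uw(1)]) (simp_all add: exc_power_le)
  show "hw b (?u @ power_word w c)"
    unfolding hw_def
  proof (intro allI impI)
    fix i t assume i: "Suc i < b"
    obtain s where s: "exc i (power_word w c) (t - length ?u) \<le> exc i w s"
      using exc_power_le[OF i] by blast
    show "exc i (?u @ power_word w c) t \<le> 0"
    proof (cases "t \<le> length ?u")
      case True
      then show ?thesis using top_word(2)[of b "power_word w K"] i by (simp add: exc_append hw_def)
    next
      case False
      \<comment> \<open>The single copy of \<open>w\<close> behind \<open>?u\<close> shows that the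
        end of \<open>?u\<close> lies low enough for the highest point of \<open>w\<close>, hence
        for that of any power.\<close>
      have "exc i (?u @ w) (length ?u + s) \<le> 0" using uw(2) i unfolding hw_def by blast
      then show ?thesis
        using s False exc_beyond[of ?u t i] exc_beyond[of ?u "length ?u + s" i]
        by (simp add: exc_append)
    qed
  qed
qed

text \<open>Prepending \<open>w\<close> can only enlarge its letters in the bottom word, and comparing contents shows
  that it leaves them unchanged: stability from the right implies stability from the left.\<close>

lemma bot_word_power_Suc:
  assumes "top_word b (power_word w (Suc K)) = top_word b (power_word w K) @ w"
  shows "bot_word b (power_word w (Suc K)) = w @ bot_word b (power_word w K)"
proof -
  have "set (w @ power_word w K) \<subseteq> {..<b}" using w set_power_word_subset[OF w] by simp
  from bot_word_append[OF this] obtain x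
    where x: "bot_word b (power_word w (Suc K)) = x @ bot_word b (power_word w K)" "raises b x w"
    by (metis power_word_Suc)
  have xs: "set x \<subseteq> {..<b}"
    using bot_word_set[OF set_power_word_subset[OF w], of "Suc K"] x(1) by simp
  \<comment> \<open>Passing from top to bottom reverses contents, both for the power
    \<open>Suc K\<close> and for \<open>K\<close>. The difference of the two identities is
    \<open>r\<close> for every letter, the content of \<open>w\<close>.\<close>
  have "count_list x l = count_list w l" if "l < b" for l
  proof -
    have "count_list (x @ bot_word b (power_word w K)) l
        = count_list (top_word b (power_word w K) @ w) (b - Suc l)"
      using count_bot_word[OF set_power_word_subset[OF w] that, of "Suc K"] assms x(1) by simp
    then show ?thesis
      using count_bot_word[OF set_power_word_subset[OF w] that, of K] count_w that by simp
  qed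
  \<comment> \<open>Each raising step lowers the letter sum, so equal sums leave only the empty path
    from \<open>x\<close> to \<open>w\<close>.\<close>
  then have "sum_list x = sum_list w"
    using sum_list_map_eq_sum_count2[OF xs, of id] sum_list_map_eq_sum_count2[OF w, of id] by simp
  then have "x = w" using raises_sum_list[OF x(2)] by simp
  then show ?thesis using x(1) by simp
qed

text \<open>Lowest weight of \<open>w @ v\<close> says that the end of \<open>v\<close> is at least
  as high as any point of \<open>w\<close>. This is the room that lets other blocks stand in front
  of \<open>v\<close>.\<close>

lemma exc_w_le_bot:
  assumes "bot_word b (power_word w (Suc K)) = w @ bot_word b (power_word w K)" and i: "Suc i < b"
  shows "exc i w s \<le>
    exc i (bot_word b (power_word w K)) (length (bot_word b (power_word w K)))"
proof -
  let ?v = "bot_word b (power_word w K)"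
  have "lw b (w @ ?v)" using lw_bot_word[OF set_power_word_subset[OF w], of "Suc K"] assms(1) by simp
  then have "exc i (w @ ?v) (min s (length w)) \<le> exc i (w @ ?v) (length (w @ ?v))"
    using i unfolding lw_def by blast
  moreover have "exc i (w @ ?v) (min s (length w)) = exc i w s"
    using exc_beyond[of w s i] by (auto simp: exc_append min_def)
  ultimately show ?thesis using exc_w_length[OF i] by (simp only: exc_length_append)
qed

lemma bot_word_power_stable:
  assumes st: "bot_word b (power_word w (Suc K)) = w @ bot_word b (power_word w K)"
  shows "bot_word b (power_word w (c + K)) = power_word w c @ bot_word b (power_word w K)"
proof (rule bot_word_eqI)
  let ?v = "bot_word b (power_word w K)"
  have wv: "raises b (w @ ?v) (w @ power_word w K)"
    using bot_word_raises[OF set_power_word_subset[OF w], of "Suc K"] st by (simp add: power_word_Suc)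
  show "raises b (power_word w c @ ?v) (power_word w (c + K))"
    unfolding power_word_add
    by (rule raises_append_right[OF wv]) (simp_all add: exc_w_length exc_power_length exc_power_le)
  show "set (power_word w c @ ?v) \<subseteq> {..<b}"
    using bot_word_set[OF set_power_word_subset[OF w]] set_power_word_subset[OF w] by simp
  show "lw b (power_word w c @ ?v)"
    unfolding lw_def
  proof (intro allI impI)
    fix i t assume i: "Suc i < b"
    obtain s where s: "exc i (power_word w c) t \<le> exc i w s" using exc_power_le[OF i] by blast
    have "exc i (power_word w c @ ?v) t \<le> exc i ?v (length ?v)"
    proof (cases "t \<le> length (power_word w c)")
      case True
      then show ?thesis using s exc_w_le_bot[OF st i, of s] by (simp add: exc_append)
    next
      case False
      have "exc i ?v (t - length (power_word w c)) \<le> exc i ?v (length ?v)"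
        using lw_bot_word[OF set_power_word_subset[OF w]] i unfolding lw_def by blast
      then show ?thesis
        using False exc_beyond[of "power_word w c" t i] exc_power_length[OF i] by (simp add: exc_append)
    qed
    then show "exc i (power_word w c @ ?v) t \<le> exc i (power_word w c @ ?v) (length (power_word w c @ ?v))"
      using exc_power_length[OF i] by (simp only: exc_length_append)
  qed
qed

text \<open>The final excess of \<open>g\<close> is minus the maximum of the walk of
  \<open>w\<close>, low enough to keep every \<open>g @ power_word w j\<close> a ballot word. That
  the maximum is attained is recorded too: it is the bound needed to put \<open>g\<close> in place
  of \<open>w\<close> in \<open>raises_append_right\<close>.\<close>

lemma absorbing_word_ex:
  obtains g where "set g \<subseteq> {..<b}" "\<And>j. hw b (g @ power_word w j)" "hw b g"
    "\<And>i. Suc i < b \<Longrightarrow> \<exists>s. - exc i g (length g) = exc i w s"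
proof -
  define m where "m i = Max (exc i w ` {..length w})" for i
  have le: "exc i w s \<le> m i" for i s
  proof (cases "s \<le> length w")
    case True
    then show ?thesis by (simp add: m_def)
  next
    case False
    then show ?thesis using exc_beyond[of w s i] by (simp add: m_def)
  qed
  have at: "\<exists>s. m i = exc i w s" for i
  proof -
    have "m i \<in> exc i w ` {..length w}" unfolding m_def by (rule Max_in) auto
    then show ?thesis by blast
  qed
  have m0: "int (nat (m i)) = m i" for i using le[of i 0] by simp
  obtain g where g: "set g \<subseteq> {..<b}" "hw b g"
    "\<And>i. Suc i < b \<Longrightarrow> exc i g (length g) = - m i"
    using column_word_ex[of b "\<lambda>i. nat (m i)"] unfolding m0 by blast
  have "hw b (g @ power_word w j)" for j
    unfolding hw_def
  proof (intro allI impI)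
    fix i t assume i: "Suc i < b"
    obtain s where s: "exc i (power_word w j) (t - length g) \<le> exc i w s"
      using exc_power_le[OF i] by blast
    show "exc i (g @ power_word w j) t \<le> 0"
    proof (cases "t \<le> length g")
      case True
      then show ?thesis using g(2) i by (simp add: exc_append hw_def)
    next
      case False
      then show ?thesis using s le[of i s] g(3)[OF i] exc_beyond[of g t i] by (simp add: exc_append)
    qed
  qed
  then show ?thesis using that[of g] g at by simp
qed

text \<open>\<open>D K\<close> is the letter sum lost on the way from the power to its top word.
  Every unstable \<open>K\<close> increases it by at least 1, whereas the absorbing word bounds it
  independently of \<open>K\<close>.\<close>

lemma top_word_power_stable_ex:
  "\<exists>K. top_word b (power_word w (Suc K)) = top_word b (power_word w K) @ w"
proof (rule ccontr)
  assume none: "\<nexists>K. top_word b (power_word w (Suc K)) = top_word b (power_word w K) @ w"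
  define D where "D K = sum_list (power_word w K) - sum_list (top_word b (power_word w K))" for K
  have mono: "sum_list (top_word b y) \<le> sum_list y" for y
    using raises_sum_list[OF top_word(1)] by blast
  have "K \<le> D K" for K
  proof (induction K)
    case (Suc K)
    obtain y where y: "top_word b (power_word w (Suc K)) = top_word b (power_word w K) @ y"
      "raises b w y" using top_word_append power_word_Suc_right by metis
    then have "y \<noteq> w" using none by metis
    then have "sum_list y < sum_list w" using raises_sum_list[OF y(2)] by auto
    then have "D K < D (Suc K)"
      using y(1) mono[of "power_word w K"] by (simp add: D_def power_word_Suc_right)
    with Suc show ?case by simp
  qed simp
  moreover obtain g where g: "set g \<subseteq> {..<b}" "\<And>j. hw b (g @ power_word w j)"
    using absorbing_word_ex by metis
  \<comment> \<open>The word \<open>g @ ?y\<close> is its own top word, so its reversed content is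
    that of its bottom word, which ends in the bottom word of \<open>?y\<close>. Hence
    \<open>?y\<close> and its top word differ in content by at most \<open>length g\<close> per
    letter.\<close>
  have "D K \<le> length g * (\<Sum>l<b. l)" for K
  proof -
    let ?y = "power_word w K"
    have gy: "set (g @ ?y) \<subseteq> {..<b}" using g(1) set_power_word_subset[OF w] by simp
    from bot_word_append[OF gy] obtain x
      where x: "bot_word b (g @ ?y) = x @ bot_word b ?y" "raises b x g" by metis
    have "count_list ?y l \<le> count_list (top_word b ?y) l + length g" if l: "l < b" for l
    proof -
      have l': "b - Suc l < b" "b - Suc (b - Suc l) = l" using l by auto
      have "count_list (x @ bot_word b ?y) (b - Suc l) = count_list (g @ ?y) l"
        using count_bot_word[OF gy l'(1)] x(1) l'(2) top_word_hw[OF g(2)] by simp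
      moreover have "count_list (bot_word b ?y) (b - Suc l) = count_list (top_word b ?y) l"
        using count_bot_word[OF set_power_word_subset[OF w] l'(1)] l'(2) by simp
      moreover have "count_list x (b - Suc l) \<le> length g"
        using raises_length[OF x(2)] count_le_length by metis
      ultimately show ?thesis by simp
    qed
    then have "(\<Sum>l<b. count_list ?y l * l) \<le> (\<Sum>l<b. (count_list (top_word b ?y) l + length g) * l)"
      by (intro sum_mono mult_right_mono) auto
    moreover have "sum_list ?y = (\<Sum>l<b. count_list ?y l * l)"
      using sum_list_map_eq_sum_count2[OF set_power_word_subset[OF w], of id] by simp
    moreover have "sum_list (top_word b ?y) = (\<Sum>l<b. count_list (top_word b ?y) l * l)"
      using sum_list_map_eq_sum_count2[OF top_word_set[OF set_power_word_subset[OF w]], of id] by simp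
    ultimately show ?thesis
      by (simp add: D_def algebra_simps sum.distrib sum_distrib_left)
  qed
  ultimately show False by (meson Suc_n_not_le_n le_trans)
qed

end

section \<open>Promotion of rectangular words\<close>

definition rect_word :: "nat \<Rightarrow> nat \<Rightarrow> nat list \<Rightarrow> bool" where
  "rect_word b p y \<longleftrightarrow> set y \<subseteq> {..<b} \<and> hw b y \<and> (\<forall>l<b. count_list y l = p)"

text \<open>Only \<open>raises\<close> is demanded of \<open>z'\<close>: that it is a highest weight
  word follows where needed, because \<open>z\<close> is rectangular.\<close>

definition promotes :: "nat \<Rightarrow> nat list \<Rightarrow> nat list \<Rightarrow> bool" where
  "promotes b y z \<longleftrightarrow> (\<exists>y' z'. y = 0 # y' \<and> z = z' @ [b - 1] \<and> raises b y' z')"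

text \<open>Equal letter counts bring the final excess to 0, the upper bound given by
  \<open>hw\<close>, so the maximum is attained at the end.\<close>

lemma rect_word_lw: "rect_word b p y \<Longrightarrow> lw b y"
  by (simp add: rect_word_def lw_def hw_def exc_def)

lemma rect_word_appendD:
  assumes "rect_word b p (x @ y)"
  shows "set y \<subseteq> {..<b}" "lw b y"
  using assms lw_appendD[OF rect_word_lw[OF assms]] by (auto simp: rect_word_def)

context
  fixes b r :: nat and w :: "nat list" and K :: nat
  assumes w: "set w \<subseteq> {..<b}" and count_w: "\<And>l. l < b \<Longrightarrow> count_list w l = r"
    and stable: "top_word b (power_word w (Suc K)) = top_word b (power_word w K) @ w"
begin

private abbreviation "u \<equiv> top_word b (power_word w K)"
private abbreviation "v \<equiv> bot_word b (power_word w K)"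

private lemma v_set: "set v \<subseteq> {..<b}"
  using bot_word_set[OF set_power_word_subset[OF w]] .

private lemma st_bot: "bot_word b (power_word w (Suc K)) = w @ v"
  using bot_word_power_Suc[OF w count_w stable] .

text \<open>The word \<open>g @ power_word w K\<close> is highest and has bottom word
  \<open>g @ v\<close>, so its content is known at both ends of the component and can be compared by
  \<open>count_bot_word\<close>.\<close>

lemma count_bot_word_symmetric:
  assumes "l < b"
  shows "count_list v l + count_list v (b - Suc l) = 2 * K * r"
proof -
  obtain g where g: "set g \<subseteq> {..<b}" "hw b (g @ power_word w K)" "hw b g"
    "\<And>i. Suc i < b \<Longrightarrow> \<exists>s. - exc i g (length g) = exc i w s"
    using absorbing_word_ex[OF w count_w] by metis
  have wv: "raises b (w @ v) (w @ power_word w K)"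
    using bot_word_raises[OF set_power_word_subset[OF w], of "Suc K"] st_bot by (simp add: power_word_Suc)
  have "raises b (g @ v) (g @ power_word w K)"
  \<comment> \<open>Excesses of \<open>g\<close> are at most 0, so relative to its end they are at
    most minus the final excess, a height that \<open>w\<close> reaches.\<close>
  proof (rule raises_append_right[OF wv])
    fix i t assume i: "Suc i < b"
    obtain s where "- exc i g (length g) = exc i w s" using g(4)[OF i] by blast
    moreover have "exc i g t \<le> 0" using g(3) i unfolding hw_def by blast
    ultimately have "exc i g t - exc i g (length g) \<le> exc i w s" by simp
    then show "\<exists>s. exc i g t - exc i g (length g) \<le> exc i w s" by blast
  qed (rule exc_w_length[OF w count_w])
  moreover have "lw b (g @ v)"
    unfolding lw_def exc_length_append
  proof (intro allI impI)
    fix i t assume i: "Suc i < b"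
    obtain s where s: "- exc i g (length g) = exc i w s" using g(4)[OF i] by blast
    show "exc i (g @ v) t \<le> exc i g (length g) + exc i v (length v)"
    proof (cases "t \<le> length g")
      case True
      moreover have "exc i g t \<le> 0" using g(3) i unfolding hw_def by blast
      ultimately show ?thesis
        using s exc_w_le_bot[OF w count_w st_bot i, of s] by (simp add: exc_append)
    next
      case False
      have "exc i v (t - length g) \<le> exc i v (length v)"
        using lw_bot_word[OF set_power_word_subset[OF w]] i unfolding lw_def by blast
      then show ?thesis using False exc_beyond[of g t i] by (simp add: exc_append)
    qed
  qed
  moreover have "set (g @ v) \<subseteq> {..<b}" using g(1) v_set by simp
  ultimately have bot: "bot_word b (g @ power_word w K) = g @ v" using bot_word_eqI by blast
  have gs: "set (g @ power_word w K) \<subseteq> {..<b}" using g(1) set_power_word_subset[OF w] by simp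
  have eq: "count_list (g @ v) l = count_list (g @ power_word w K) (b - Suc l)" if "l < b" for l
    using count_bot_word[OF gs that] bot top_word_hw[OF g(2)] by simp
  have l: "b - Suc l < b" "b - Suc (b - Suc l) = l" using assms by auto
  \<comment> \<open>In the sum of the equations for \<open>l\<close> and \<open>b - Suc l\<close>
    the contents of \<open>g\<close> cancel and \<open>2 * K * r\<close> remains.\<close>
  show ?thesis
    using eq[OF assms] eq[OF l(1)] l count_w by (simp add: count_list_power_word assms)
qed

lemma count_top_word_eq: "l < b \<Longrightarrow> count_list u l + count_list v l = 2 * K * r"
  using count_bot_word_symmetric[of l] count_bot_word[OF set_power_word_subset[OF w, of K], of "b - Suc l"]
  by simp

text \<open>The ballot condition inside \<open>v\<close> holds because the final excess of
  \<open>u\<close> is minus that of \<open>v\<close>, the powers between contribute 0, and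
  \<open>v\<close> is highest at its end.\<close>

lemma rect_word_stable: "rect_word b ((2 * K + c) * r) (u @ power_word w c @ v)"
  unfolding rect_word_def
proof (intro conjI allI impI)
  show "set (u @ power_word w c @ v) \<subseteq> {..<b}"
    using v_set set_power_word_subset[OF w] top_word_set[OF set_power_word_subset[OF w]] by simp
next
  fix l assume "l < b"
  then show "count_list (u @ power_word w c @ v) l = (2 * K + c) * r"
    using count_top_word_eq[of l] count_w by (simp add: count_list_power_word algebra_simps)
next
  have uw: "hw b (u @ power_word w c)"
    using top_word_power_stable[OF w count_w stable, of c] top_word(2) by metis
  show "hw b (u @ power_word w c @ v)"
    unfolding hw_def
  proof (intro allI impI)
    fix i t assume i: "Suc i < b"
    let ?y = "u @ power_word w c"
    have le: "exc i ?y t \<le> 0" using uw i unfolding hw_def by blast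
    show "exc i (u @ power_word w c @ v) t \<le> 0"
    proof (cases "t \<le> length ?y")
      case True
      then show ?thesis using le exc_append[of i ?y v t] by simp
    next
      case False
      then have "exc i (u @ power_word w c @ v) t = exc i ?y (length ?y) + exc i v (t - length ?y)"
        using exc_append[of i ?y v t] exc_beyond[of ?y t i] by simp
      moreover have "exc i ?y (length ?y) = exc i u (length u)"
        using exc_power_length[OF w count_w i] by (simp only: exc_length_append)
      moreover have "exc i v (t - length ?y) \<le> exc i v (length v)"
        using lw_bot_word[OF set_power_word_subset[OF w]] i unfolding lw_def by blast
      moreover have "exc i u (length u) + exc i v (length v) = 0"
        using count_top_word_eq[of i] count_top_word_eq[of "Suc i"] i by (simp add: exc_def)
      ultimately show ?thesis by simp
    qed
  qed
qed

text \<open>While the first \<open>length w\<close> letters are promoted away, the prefix that began as \<open>u @ w\<close>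
  runs through the top words of the suffixes of \<open>power_word w (Suc K)\<close>.  Comparing contents inside
  the rectangle, the top word of the complementary suffix grows exactly by the letters of \<open>w\<close>.\<close>

lemma promotes_power:
  assumes Y0: "Y 0 = u @ power_word w (Suc c) @ v"
    and step: "\<And>s. s < length w \<Longrightarrow> promotes b (Y s) (Y (Suc s))"
    and rect: "\<And>s. s \<le> length w \<Longrightarrow> rect_word b p (Y s)"
  shows "Y (length w) = Y 0"
proof -
  let ?W = "power_word w (Suc K)"
  have Ws: "set (drop s ?W) \<subseteq> {..<b}" for s
    using set_power_word_subset[OF w, of "Suc K"] set_drop_subset[of s ?W] by blast
  \<comment> \<open>Cutting the path from \<open>w @ v\<close> to \<open>?W\<close> at position
    \<open>s\<close> leaves a path between the suffixes, and suffixes of lowest weight words are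
    lowest.\<close>
  have bot_drop: "bot_word b (drop s ?W) = drop s w @ v" if "s \<le> length w" for s
  proof (rule bot_word_eqI)
    have "raises b (take s w @ (drop s w @ v)) (take s ?W @ drop s ?W)"
      using bot_word_raises[OF set_power_word_subset[OF w], of "Suc K"] st_bot
      by (metis append.assoc append_take_drop_id)
    then show "raises b (drop s w @ v) (drop s ?W)"
      by (rule raises_append2) (simp add: power_word_Suc that)
    have "lw b (take s w @ (drop s w @ v))"
      using lw_bot_word[OF set_power_word_subset[OF w], of "Suc K"] st_bot
      by (metis append.assoc append_take_drop_id)
    then show "lw b (drop s w @ v)" by (rule lw_appendD)
    show "set (drop s w @ v) \<subseteq> {..<b}"
      using v_set w set_drop_subset[of s w] by auto
  qed
  \<comment> \<open>\<open>Q\<close> is lowest as a suffix of a rectangular word, so its top word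
    has the reversed content; the same reversal relates the prefix of \<open>Y s\<close> to
    \<open>drop s w @ v\<close>. The two parts share \<open>p\<close> copies of each letter.\<close>
  have content: "count_list (top_word b Q) l + count_list (drop s w @ v) l = p"
    if "s \<le> length w" "Y s = top_word b (drop s ?W) @ Q" "l < b" for s Q l
  proof -
    have l: "b - Suc l < b" "b - Suc (b - Suc l) = l" using that by auto
    have Y: "rect_word b p (Y s)" using rect that by blast
    then have Q: "set Q \<subseteq> {..<b}" "lw b Q"
      using rect_word_appendD that(2) by metis+
    have "count_list (Y s) (b - Suc l) = p" using Y l unfolding rect_word_def by blast
    moreover have "count_list Q (b - Suc l) = count_list (top_word b Q) l"
      using count_bot_word[OF Q(1) l(1)] bot_word_lw[OF Q] l(2) by simp
    moreover have "count_list (top_word b (drop s ?W)) (b - Suc l) = count_list (drop s w @ v) l"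
      using count_bot_word[OF Ws[of s] that(3)] bot_drop[OF that(1)] by simp
    ultimately show ?thesis using that(2) by simp
  qed
  have inv: "\<exists>Q. Y s = top_word b (drop s ?W) @ Q \<and>
      top_word b Q = top_word b (power_word w (c + K)) @ take s w" if "s \<le> length w" for s
    using that
  proof (induction s)
    case 0
    have "Y 0 = (u @ w) @ power_word w c @ v" using Y0 by (simp add: power_word_Suc)
    moreover have "top_word b (power_word w c @ v) = top_word b (power_word w (c + K))"
      using top_word_bot_word[OF set_power_word_subset[OF w]] bot_word_power_stable[OF w count_w st_bot]
      by metis
    ultimately show ?case using stable by (intro exI[of _ "power_word w c @ v"]) simp
  next
    case (Suc s)
    then have s: "s < length w" by simp
    obtain Q where Q: "Y s = top_word b (drop s ?W) @ Q"
      "top_word b Q = top_word b (power_word w (c + K)) @ take s w" using Suc by auto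
    obtain y z where yz: "Y s = 0 # y" "Y (Suc s) = z @ [b - 1]" "raises b y z"
      using step[OF s] by (auto simp: promotes_def)
    have "s < length ?W" using s by (simp add: power_word_Suc)
    then have dr: "drop s ?W = [?W ! s] @ drop (Suc s) ?W" by (simp add: Cons_nth_drop_Suc)
    then have "length (top_word b (drop s ?W)) = Suc (length (drop (Suc s) ?W))"
      by (metis append_Cons append_Nil length_Cons top_word_length)
    then obtain a P where aP: "top_word b (drop s ?W) = a # P" by (metis length_Suc_conv)
    then have P: "top_word b (drop s ?W) = [0] @ P" "y = P @ Q" using Q(1) yz(1) by auto
    have "raises b ([?W ! s] @ drop (Suc s) ?W) ([0] @ P)"
      using top_word(1)[of b "drop s ?W"] P(1) dr by simp
    then have rP: "raises b (drop (Suc s) ?W) P" by (rule raises_append2) simp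
    obtain P' Q' where z: "z = P' @ Q'" "raises b P P'" "raises b Q Q'"
      using raises_append yz(3) P(2) by metis
    \<comment> \<open>Being a prefix of the rectangular word \<open>Y (Suc s)\<close> makes
      \<open>P'\<close> highest, hence the top word of the shortened suffix.\<close>
    have "hw b (P' @ (Q' @ [b - 1]))"
      using rect[of "Suc s"] s yz(2) z(1) by (simp add: rect_word_def)
    then have "hw b P'" by (rule hw_appendD)
    then have P': "top_word b (drop (Suc s) ?W) = P'"
      using top_word_eqI rP z(2) by (meson rtranclp_trans)
    have YS: "Y (Suc s) = top_word b (drop (Suc s) ?W) @ (Q' @ [b - 1])"
      using yz(2) z(1) P' by simp
    obtain x where x: "top_word b (Q' @ [b - 1]) = top_word b Q' @ x" "raises b [b - 1] x"
      by (rule top_word_append)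
    have "length x = 1" using raises_length[OF x(2)] by simp
    then obtain l where l: "x = [l]" by (metis One_nat_def length_0_conv length_Suc_conv)
    have top: "top_word b (Q' @ [b - 1]) = top_word b Q @ [l]"
      using x(1) l top_word_raises[OF z(3)] by simp
    have "w ! s < b" using w s nth_mem by fastforce
    moreover have "drop s w = w ! s # drop (Suc s) w" using s by (simp add: Cons_nth_drop_Suc)
    \<comment> \<open>From \<open>s\<close> to \<open>Suc s\<close> the complementary part loses the
      letter \<open>w ! s\<close>; as the total stays \<open>p\<close>, the top word of the rest has
      to gain that very letter.\<close>
    ultimately have "l = w ! s"
      using content[of s Q "w ! s"] content[of "Suc s" "Q' @ [b - 1]" "w ! s"] s Q(1) YS top
      by (auto split: if_splits)
    then have "top_word b (Q' @ [b - 1]) = top_word b (power_word w (c + K)) @ take (Suc s) w"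
      using top Q(2) s by (simp add: take_Suc_conv_app_nth)
    then show ?case using YS by blast
  qed
  obtain Q where Q: "Y (length w) = u @ Q"
    "top_word b Q = top_word b (power_word w (c + K)) @ w"
    using inv[of "length w"] by (auto simp: power_word_Suc)
  have "top_word b Q = u @ power_word w (Suc c)"
    using Q(2) top_word_power_stable[OF w count_w stable, of c]
    by (simp add: power_word_Suc_right add.commute)
  then have top: "top_word b Q = top_word b (power_word w (Suc c + K))"
    using top_word_power_stable[OF w count_w stable, of "Suc c"] by (simp add: add.commute)
  have "set Q \<subseteq> {..<b}" "lw b Q"
    using rect[of "length w"] Q(1) rect_word_appendD by (metis order_refl)+
  \<comment> \<open>A lowest weight word is recovered from its top word, so knowing
    \<open>top_word b Q\<close> fixes \<open>Q\<close> itself.\<close>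
  then have "Q = bot_word b (top_word b Q)" using bot_word_lw bot_word_top_word by metis
  also have "\<dots> = power_word w (Suc c) @ v"
    unfolding top using bot_word_top_word[OF set_power_word_subset[OF w]]
      bot_word_power_stable[OF w count_w st_bot] by metis
  finally show ?thesis using Q(1) Y0 by simp
qed

end

section \<open>Tableaux and their reading words\<close>

definition nw :: "nat \<times> nat \<Rightarrow> nat \<times> nat \<Rightarrow> bool" where
  "nw c d \<longleftrightarrow> fst c \<le> fst d \<and> snd c \<le> snd d"

definition nbr :: "nat \<times> nat \<Rightarrow> nat \<times> nat \<Rightarrow> bool" where
  "nbr c d \<longleftrightarrow> d = (fst c, Suc (snd c)) \<or> d = (Suc (fst c), snd c)"

text \<open>Order convexity stands for being a skew shape; the inner and outer partitions never have
  to be named.\<close>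

definition convex_cells :: "(nat \<times> nat) set \<Rightarrow> bool" where
  "convex_cells D \<longleftrightarrow> (\<forall>c\<in>D. \<forall>e\<in>D. \<forall>d. nw c d \<longrightarrow> nw d e \<longrightarrow> d \<in> D)"

definition fills :: "tab \<Rightarrow> nat set \<Rightarrow> bool" where
  "fills T A \<longleftrightarrow> finite (dom T) \<and> ran T = A \<and> (\<forall>c d x. T c = Some x \<longrightarrow> T d = Some x \<longrightarrow> c = d)"

definition increasing :: "tab \<Rightarrow> bool" where
  "increasing T \<longleftrightarrow>
     (\<forall>c d x y. T c = Some x \<longrightarrow> T d = Some y \<longrightarrow> nw c d \<longrightarrow> c \<noteq> d \<longrightarrow> x < y)"

definition skew_tab :: "nat set \<Rightarrow> nat \<Rightarrow> tab \<Rightarrow> bool" where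
  "skew_tab A b T \<longleftrightarrow> fills T A \<and> increasing T \<and> convex_cells (dom T) \<and> (\<forall>c\<in>dom T. fst c < b)"

text \<open>The state in the middle of a slide. Only together with the hole are the cells convex;
  the entry set is a parameter since promotion slides the entries from 2 on.\<close>

definition punctured_tab :: "nat set \<Rightarrow> nat \<Rightarrow> tab \<Rightarrow> nat \<times> nat \<Rightarrow> bool" where
  "punctured_tab A b T h \<longleftrightarrow> fills T A \<and> increasing T \<and> T h = None \<and>
     convex_cells (insert h (dom T)) \<and> (\<forall>c\<in>insert h (dom T). fst c < b)"

lemma nw_refl [simp]: "nw c c"
  by (simp add: nw_def)

lemma nw_trans: "nw c d \<Longrightarrow> nw d e \<Longrightarrow> nw c e"
  by (auto simp: nw_def)

lemma nbr_nw: "nbr c d \<Longrightarrow> nw c d" "nbr c d \<Longrightarrow> c \<noteq> d"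
  by (auto simp: nbr_def nw_def prod_eq_iff)

lemma nw_nbr: assumes "nw c e" "c \<noteq> e" obtains d where "nbr c d" "nw d e"
proof -
  have "nw (fst c, Suc (snd c)) e \<or> nw (Suc (fst c), snd c) e"
    using assms by (auto simp: nw_def prod_eq_iff)
  then show ?thesis using that unfolding nbr_def by blast
qed

lemma nbr_nw_pred: assumes "nw c e" "c \<noteq> e" obtains d where "nbr d e" "nw c d"
proof (cases "snd c < snd e")
  case True
  then show ?thesis
    using that[of "(fst e, snd e - 1)"] assms by (auto simp: nw_def nbr_def prod_eq_iff)
next
  case False
  then have "fst c < fst e" using assms by (auto simp: nw_def prod_eq_iff)
  then show ?thesis
    using that[of "(fst e - 1, snd e)"] assms by (auto simp: nw_def nbr_def prod_eq_iff)
qed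

lemma convex_cellsD:
  "convex_cells D \<Longrightarrow> c \<in> D \<Longrightarrow> e \<in> D \<Longrightarrow> nw c d \<Longrightarrow> nw d e \<Longrightarrow> d \<in> D"
  unfolding convex_cells_def by blast

lemma increasingD:
  "increasing T \<Longrightarrow> T c = Some x \<Longrightarrow> T d = Some y \<Longrightarrow> nw c d \<Longrightarrow> c \<noteq> d \<Longrightarrow> x < y"
  unfolding increasing_def by blast

lemma increasingD_le:
  "increasing T \<Longrightarrow> T c = Some x \<Longrightarrow> T d = Some y \<Longrightarrow> nw c d \<Longrightarrow> x \<le> y"
  using increasingD[of T c x d y] by (cases "c = d") auto

lemma fills_inj: "fills T A \<Longrightarrow> T c = Some x \<Longrightarrow> T d = Some x \<Longrightarrow> c = d"
  unfolding fills_def by blast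

lemma fills_move:
  assumes "fills T A" "T h = None" "T c = Some x"
  shows "fills (T(h := Some x, c := None)) A"
proof -
  have "h \<noteq> c" using assms by auto
  let ?T = "T(h := Some x, c := None)"
  have "finite (dom ?T)" using assms(1) by (simp add: fills_def)
  moreover have "v \<in> ran ?T \<longleftrightarrow> v \<in> ran T" for v
  proof
    assume "v \<in> ran ?T"
    then obtain d where "?T d = Some v" unfolding ran_def by blast
    then have "T (if d = h then c else d) = Some v"
      using assms(3) by (auto simp: fun_upd_apply split: if_splits)
    then show "v \<in> ran T" unfolding ran_def by blast
  next
    assume "v \<in> ran T"
    then obtain d where d: "T d = Some v" unfolding ran_def by blast
    have "?T (if d = c then h else d) = Some v"
      using d assms(2,3) \<open>h \<noteq> c\<close> by (auto simp: fun_upd_apply)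
    then show "v \<in> ran ?T" unfolding ran_def by blast
  qed
  then have "ran ?T = ran T" by blast
  moreover have "p = q" if "?T p = Some y" "?T q = Some y" for p q y
    using that fills_inj[OF assms(1)] assms(3) by (auto simp: fun_upd_apply split: if_splits)
  ultimately show ?thesis using assms(1) unfolding fills_def by blast
qed

section \<open>Words of tableaux and counting in rows\<close>

definition row_of :: "tab \<Rightarrow> nat \<Rightarrow> nat" where
  "row_of T v = (THE i. in_row T v i)"

definition reading_word :: "tab \<Rightarrow> nat \<Rightarrow> nat \<Rightarrow> nat list" where
  "reading_word T m n = map (row_of T) [m..<n]"

lemma in_row_iff: "fills T A \<Longrightarrow> v \<in> A \<Longrightarrow> in_row T v i \<longleftrightarrow> row_of T v = i"
proof -
  assume T: "fills T A" and v: "v \<in> A"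
  then obtain c where c: "T c = Some v" unfolding fills_def ran_def by blast
  then have "in_row T v (fst c)" by (metis in_row_def prod.collapse)
  moreover have "k = fst c" if "in_row T v k" for k
    using that fills_inj[OF T c] by (auto simp: in_row_def)
  ultimately show ?thesis unfolding row_of_def by (metis the_equality)
qed

lemma row_of_eq: "fills T A \<Longrightarrow> T (i, j) = Some v \<Longrightarrow> row_of T v = i"
  using in_row_iff[of T A v i] unfolding fills_def ran_def in_row_def by blast

lemma length_reading_word [simp]: "length (reading_word T m n) = n - m"
  by (simp add: reading_word_def)

text \<open>Columns are collected instead of entries so that two adjacent rows can be compared by
  inclusion of sets.\<close>

definition entry_cols :: "tab \<Rightarrow> nat \<Rightarrow> nat \<Rightarrow> nat \<Rightarrow> nat set" where
  "entry_cols T l y z = {j. \<exists>v. T (l, j) = Some v \<and> y \<le> v \<and> v < z}"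

lemma finite_entry_cols: "finite (dom T) \<Longrightarrow> finite (entry_cols T l y z)"
  by (rule finite_subset[of _ "snd ` dom T"]) (force simp: entry_cols_def)+

lemma card_entry_cols_split:
  assumes "finite (dom T)" "x \<le> y" "y \<le> z"
  shows "card (entry_cols T l x z) = card (entry_cols T l x y) + card (entry_cols T l y z)"
proof -
  have "entry_cols T l x z = entry_cols T l x y \<union> entry_cols T l y z"
    using assms by (auto simp: entry_cols_def)
  moreover have "entry_cols T l x y \<inter> entry_cols T l y z = {}"
    by (auto simp: entry_cols_def)
  ultimately show ?thesis using finite_entry_cols[OF assms(1)] by (simp add: card_Un_disjoint)
qed

lemma take_upt_min: "take t [m..<n] = [m..<min n (m + t)]"
  by (cases "m + t \<le> n") (auto simp: min_def)

lemma count_reading_word: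
  assumes T: "fills T {m..<n}"
  shows "count_list (take t (reading_word T m n)) l = card (entry_cols T l m (m + t))"
proof -
  let ?vs = "filter (\<lambda>v. row_of T v = l) (take t [m..<n])"
  have cnt: "count_list (map f xs) l = length (filter (\<lambda>v. f v = l) xs)" for f :: "nat \<Rightarrow> nat" and xs
    by (induction xs) auto
  have "count_list (take t (reading_word T m n)) l = length ?vs"
    by (simp add: reading_word_def take_map cnt)
  also have "\<dots> = card (set ?vs)" by (rule distinct_card[symmetric]) simp
  also have "set ?vs = (\<lambda>j. the (T (l, j))) ` entry_cols T l m (m + t)"
  proof (intro equalityI subsetI)
    fix v assume v: "v \<in> set ?vs"
    then have "m \<le> v" "v < n" "v < m + t" "row_of T v = l"
      using set_take_subset[of t "[m..<n]"] by (auto simp: take_upt_min)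
    moreover from this have "in_row T v l" using in_row_iff[OF T] by simp
    ultimately show "v \<in> (\<lambda>j. the (T (l, j))) ` entry_cols T l m (m + t)"
      unfolding in_row_def entry_cols_def by force
  next
    fix v assume "v \<in> (\<lambda>j. the (T (l, j))) ` entry_cols T l m (m + t)"
    then obtain j where j: "T (l, j) = Some v" "m \<le> v" "v < m + t" by (auto simp: entry_cols_def)
    then have "v < n" using T unfolding fills_def ran_def by fastforce
    then show "v \<in> set ?vs" using j row_of_eq[OF T j(1)] by (simp add: take_upt_min)
  qed
  also have "card \<dots> = card (entry_cols T l m (m + t))"
  proof (rule card_image, rule inj_onI)
    fix j j' assume "j \<in> entry_cols T l m (m + t)" "j' \<in> entry_cols T l m (m + t)"
      "the (T (l, j)) = the (T (l, j'))"
    then show "j = j'" using fills_inj[OF T, of "(l, j)" _ "(l, j')"] by (auto simp: entry_cols_def)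
  qed
  finally show ?thesis .
qed

lemma exc_reading_word:
  assumes "fills T {m..<n}"
  shows "exc i (reading_word T m n) t =
    int (card (entry_cols T (Suc i) m (m + t))) - int (card (entry_cols T i m (m + t)))"
  using count_reading_word[OF assms] by (simp add: exc_def)

lemma row_of_cell: "fills T A \<Longrightarrow> T c = Some v \<Longrightarrow> row_of T v = fst c"
  using row_of_eq[of T A "fst c" "snd c" v] by simp

section \<open>Single jeu de taquin moves and their effect on words\<close>

lemma insert_dom_move:
  "T c = Some x \<Longrightarrow> insert c (dom (T(h := Some x, c := None))) = insert h (dom T)"
  by auto

text \<open>A cell southeast of the hole is reached through a neighbour of the hole, which is filled
  by convexity; minimality of \<open>x\<close> among the neighbours then gives the required
  inequality.\<close>

lemma punctured_tab_slide:
  assumes P: "punctured_tab A b T h" and c: "nbr h c" "T c = Some x"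
    and min: "\<And>d y. nbr h d \<Longrightarrow> T d = Some y \<Longrightarrow> x \<le> y"
  shows "punctured_tab A b (T(h := Some x, c := None)) c"
proof -
  let ?T = "T(h := Some x, c := None)"
  have T: "fills T A" "increasing T" "T h = None" and conv: "convex_cells (insert h (dom T))"
    and rows: "\<forall>c\<in>insert h (dom T). fst c < b"
    using P by (auto simp: punctured_tab_def)
  have "increasing ?T"
    unfolding increasing_def
  proof (intro allI impI)
    fix p q y z assume p: "?T p = Some y" and q: "?T q = Some z" and pq: "nw p q" "p \<noteq> q"
    have "p \<noteq> c" "q \<noteq> c" using p q by (auto split: if_splits)
    consider "p = h" | "q = h" | "p \<noteq> h" "q \<noteq> h" by blast
    then show "y < z"
    proof cases
      case 1
      then have "y = x" and Tq: "T q = Some z" using p q pq \<open>p \<noteq> c\<close> by (auto split: if_splits)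
      obtain d where d: "nbr h d" "nw d q" using nw_nbr pq 1 by blast
      have "d \<in> insert h (dom T)"
        using convex_cellsD[OF conv _ _ nbr_nw(1)[OF d(1)] d(2)] Tq by blast
      then obtain e where e: "T d = Some e" using nbr_nw(2)[OF d(1)] by blast
      have "x \<le> e" using min d e by blast
      moreover have "e \<le> z" using increasingD_le T(2) e Tq d by blast
      moreover have "x \<noteq> z" using fills_inj[OF T(1) c(2)] Tq \<open>q \<noteq> c\<close> by blast
      ultimately show ?thesis using \<open>y = x\<close> by simp
    next
      case 2
      then have "z = x" and Tp: "T p = Some y" using p q pq \<open>q \<noteq> c\<close> by (auto split: if_splits)
      have "nw p c" using nw_trans pq(1) 2 nbr_nw(1)[OF c(1)] by blast
      then show ?thesis using increasingD T(2) Tp c(2) \<open>p \<noteq> c\<close> \<open>z = x\<close> by blast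
    next
      case 3
      then show ?thesis using increasingD[OF T(2) _ _ pq] p q by (auto split: if_splits)
    qed
  qed
  moreover have "?T c = None" by simp
  ultimately show ?thesis
    unfolding punctured_tab_def insert_dom_move[where T = T, OF c(2)]
    using fills_move[OF T(1,3) c(2)] conv rows by blast
qed

lemma punctured_tab_out_slide:
  assumes P: "punctured_tab A b T h" and c: "nbr c h" "T c = Some x"
    and max: "\<And>d y. nbr d h \<Longrightarrow> T d = Some y \<Longrightarrow> y \<le> x"
  shows "punctured_tab A b (T(h := Some x, c := None)) c"
proof -
  let ?T = "T(h := Some x, c := None)"
  have T: "fills T A" "increasing T" "T h = None" and conv: "convex_cells (insert h (dom T))"
    and rows: "\<forall>c\<in>insert h (dom T). fst c < b"
    using P by (auto simp: punctured_tab_def)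
  have "increasing ?T"
    unfolding increasing_def
  proof (intro allI impI)
    fix p q y z assume p: "?T p = Some y" and q: "?T q = Some z" and pq: "nw p q" "p \<noteq> q"
    have "p \<noteq> c" "q \<noteq> c" using p q by (auto split: if_splits)
    consider "p = h" | "q = h" | "p \<noteq> h" "q \<noteq> h" by blast
    then show "y < z"
    proof cases
      case 1
      then have "y = x" and Tq: "T q = Some z" using p q pq \<open>p \<noteq> c\<close> by (auto split: if_splits)
      have "nw c q" using nw_trans pq(1) 1 nbr_nw(1)[OF c(1)] by blast
      then show ?thesis using increasingD T(2) Tq c(2) \<open>q \<noteq> c\<close> \<open>y = x\<close> by blast
    next
      case 2
      then have "z = x" and Tp: "T p = Some y" using p q pq \<open>q \<noteq> c\<close> by (auto split: if_splits)
      obtain d where d: "nbr d h" "nw p d" using nbr_nw_pred pq 2 by blast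
      have "d \<in> insert h (dom T)"
        using convex_cellsD[OF conv _ _ d(2) nbr_nw(1)[OF d(1)]] Tp by blast
      then obtain e where e: "T d = Some e" using nbr_nw(2)[OF d(1)] by blast
      have "e \<le> x" using max d e by blast
      moreover have "y \<le> e" using increasingD_le T(2) e Tp d by blast
      moreover have "x \<noteq> y" using fills_inj[OF T(1) c(2)] Tp \<open>p \<noteq> c\<close> by blast
      ultimately show ?thesis using \<open>z = x\<close> by simp
    next
      case 3
      then show ?thesis using increasingD[OF T(2) _ _ pq] p q by (auto split: if_splits)
    qed
  qed
  moreover have "?T c = None" by simp
  ultimately show ?thesis
    unfolding punctured_tab_def insert_dom_move[where T = T, OF c(2)]
    using fills_move[OF T(1,3) c(2)] conv rows by blast
qed

lemma row_of_move:
  assumes "fills T A" "T h = None" "T c = Some x" "v \<in> A"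
  shows "row_of (T(h := Some x, c := None)) v = (if v = x then fst h else row_of T v)"
proof -
  let ?T = "T(h := Some x, c := None)"
  have F: "fills ?T A" using fills_move assms by blast
  show ?thesis
  proof (cases "v = x")
    case True
    have "?T h = Some x" using assms by auto
    then show ?thesis using row_of_cell[OF F] True by simp
  next
    case False
    obtain d where d: "T d = Some v" using assms unfolding fills_def ran_def by blast
    have "?T d = Some v" using d False assms by auto
    then show ?thesis using row_of_cell[OF F] row_of_cell[OF assms(1) d] False by simp
  qed
qed

text \<open>Column strictness in the two rows around the hole says exactly that the entry moving up is
  the first peak: to its left every entry of the upper row has a larger one below it, to its right
  every entry of the lower row has a smaller one above it.\<close>

lemma reading_word_slide:
  assumes P: "punctured_tab {m..<n} b T h" and c: "nbr h c" "T c = Some x"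
    and min: "\<And>d y. nbr h d \<Longrightarrow> T d = Some y \<Longrightarrow> x \<le> y"
  shows "raises b (reading_word T m n) (reading_word (T(h := Some x, c := None)) m n)"
proof -
  let ?T = "T(h := Some x, c := None)"
  let ?y = "reading_word T m n"
  have T: "fills T {m..<n}" "increasing T" "T h = None" and conv: "convex_cells (insert h (dom T))"
    and rows: "\<forall>c\<in>insert h (dom T). fst c < b"
    using P by (auto simp: punctured_tab_def)
  have fin: "finite (dom T)" using T(1) by (simp add: fills_def)
  obtain i j where h: "h = (i, j)" by (cases h)
  have "x \<in> {m..<n}" using ranI[of T c x] c(2) T(1) unfolding fills_def by blast
  then have x: "m \<le> x" "x < n" by auto
  have word: "reading_word ?T m n = ?y[x - m := i]"
  proof (rule nth_equalityI)
    fix t assume "t < length (reading_word ?T m n)"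
    then have t: "t < n - m" by simp
    then have "[m..<n] ! t = m + t" "m + t \<in> {m..<n}" by auto
    then show "reading_word ?T m n ! t = ?y[x - m := i] ! t"
      using row_of_move[OF T(1,3) c(2), of "m + t"] t x h
      by (auto simp: reading_word_def nth_list_update)
  qed simp
  have row_c: "row_of T x = fst c" using row_of_cell[OF T(1) c(2)] .
  show ?thesis
  proof (cases "fst c = i")
    case True
    have "?y ! (x - m) = i" using row_c True x by (simp add: reading_word_def)
    then have "?y[x - m := i] = ?y" by (metis list_update_id)
    then show ?thesis using word by simp
  next
    case False
    then have c_eq: "c = (Suc i, j)" using c(1) h by (auto simp: nbr_def)
    have cx: "T (Suc i, j) = Some x" using c(2) c_eq by simp
    have "Suc i < b" using rows cx by (metis domI fst_conv insertI2)
    have right: "x < v" if v: "T (i, k) = Some v" and "j < k" for k v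
    proof -
      have "(i, Suc j) \<in> insert h (dom T)"
        using convex_cellsD[OF conv, of h "(i, k)" "(i, Suc j)"] v \<open>j < k\<close> h by (auto simp: nw_def)
      then obtain e where e: "T (i, Suc j) = Some e" using h by auto
      have "x \<le> e" using min[of "(i, Suc j)" e] e h by (simp add: nbr_def)
      moreover have "x \<noteq> e" using fills_inj[OF T(1) e, of "(Suc i, j)"] cx by auto
      moreover have "e \<le> v"
        using increasingD_le[OF T(2) e v] \<open>j < k\<close> by (simp add: nw_def)
      ultimately show ?thesis by simp
    qed
    have left: "k \<noteq> j \<and> (\<exists>v'. T (Suc i, k) = Some v' \<and> v < v' \<and> v' < x)"
      if v: "T (i, k) = Some v" "v \<le> x" for k v
    proof -
      have kj: "k < j"
      proof -
        have "k \<noteq> j" using T(3) h v by auto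
        moreover have "\<not> j < k" using right v by fastforce
        ultimately show ?thesis by simp
      qed
      have "(Suc i, k) \<in> insert h (dom T)"
        using convex_cellsD[OF conv, of "(i, k)" c "(Suc i, k)"] v c(2) c_eq kj by (auto simp: nw_def)
      then obtain v' where v': "T (Suc i, k) = Some v'" using h by auto
      moreover have "v < v'" using increasingD[OF T(2) v(1) v'] by (simp add: nw_def)
      moreover have "v' < x" using increasingD[OF T(2) v' cx] kj by (simp add: nw_def)
      ultimately show ?thesis using kj by blast
    qed
    have below: "\<exists>v'. T (i, k) = Some v' \<and> x < v' \<and> v' < v"
      if v: "T (Suc i, k) = Some v" "x < v" for k v
    proof -
      have jk: "j < k"
      proof (rule ccontr)
        assume "\<not> j < k"
        then show False using increasingD_le[OF T(2) v(1) cx] v(2) by (simp add: nw_def)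
      qed
      have "(i, k) \<in> insert h (dom T)"
        using convex_cellsD[OF conv, of h "(Suc i, k)" "(i, k)"] v h jk by (auto simp: nw_def)
      then obtain v' where v': "T (i, k) = Some v'" using h jk by auto
      moreover have "x < v'" using right v' jk by blast
      moreover have "v' < v" using increasingD[OF T(2) v' v(1)] by (simp add: nw_def)
      ultimately show ?thesis by blast
    qed
    define p where "p = x - m"
    have p: "m + Suc p = Suc x" using x by (simp add: p_def)
    have peak_left: "exc i ?y t < exc i ?y (Suc p)" if "t \<le> p" for t
    proof -
      have z: "m + t \<le> Suc x" "m + t \<le> x" using that x by (auto simp: p_def)
      let ?A = "entry_cols T (Suc i) (m + t) (Suc x)" and ?B = "entry_cols T i (m + t) (Suc x)"
      \<comment> \<open>Column \<open>j\<close> belongs to the lower row only, because the cell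
        above it is the hole; this makes the inequality of cardinalities strict.\<close>
      have "insert j ?B \<subseteq> ?A"
      proof
        fix k assume "k \<in> insert j ?B"
        then show "k \<in> ?A"
        proof
          assume "k = j"
          then show ?thesis using cx z by (simp add: entry_cols_def)
        next
          assume "k \<in> ?B"
          then obtain v where "T (i, k) = Some v" "m + t \<le> v" "v \<le> x"
            by (auto simp: entry_cols_def)
          with left[of k v] show ?thesis by (force simp: entry_cols_def)
        qed
      qed
      then have "card (insert j ?B) \<le> card ?A" by (rule card_mono[OF finite_entry_cols[OF fin]])
      moreover have "j \<notin> ?B" using left by (force simp: entry_cols_def)
      ultimately have "card ?B < card ?A" using finite_entry_cols[OF fin] by simp
      then show ?thesis
        using card_entry_cols_split[OF fin, of m "m + t" "Suc x"] z
        by (simp add: exc_reading_word[OF T(1)] p del: add_Suc_right)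
    qed
    moreover have "exc i ?y t \<le> exc i ?y (Suc p)" for t
    proof (cases "t \<le> p")
      case True
      then show ?thesis using peak_left by fastforce
    next
      case False
      then have z: "Suc x \<le> m + t" using x by (simp add: p_def)
      have "entry_cols T (Suc i) (Suc x) (m + t) \<subseteq> entry_cols T i (Suc x) (m + t)"
        using below by (force simp: entry_cols_def Suc_le_eq)
      then have "card (entry_cols T (Suc i) (Suc x) (m + t)) \<le> card (entry_cols T i (Suc x) (m + t))"
        by (rule card_mono[OF finite_entry_cols[OF fin]])
      then show ?thesis
        using card_entry_cols_split[OF fin, of m "Suc x" "m + t"] z x
        by (simp add: exc_reading_word[OF T(1)] p del: add_Suc_right)
    qed
    moreover have "p < length ?y" using x by (simp add: p_def)
    ultimately have "first_peak i ?y p" unfolding first_peak_def by blast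
    then have "raise b ?y (?y[p := i])" using \<open>Suc i < b\<close> unfolding raise_def by blast
    then show ?thesis using word by (simp add: p_def r_into_rtranclp)
  qed
qed

section \<open>Rectification\<close>

text \<open>Potential for termination: an inward move lowers it by 1, an outward move raises it by
  1.\<close>

definition weight :: "tab \<Rightarrow> nat" where
  "weight T = (\<Sum>c\<in>dom T. fst c + snd c)"

lemma weight_move:
  assumes "finite (dom T)" "T h = None" "T c = Some x"
  shows "weight (T(h := Some x, c := None)) + (fst c + snd c) = weight T + (fst h + snd h)"
proof -
  have "c \<in> dom T" "h \<notin> dom T - {c}" using assms by auto
  moreover have "dom (T(h := Some x, c := None)) = insert h (dom T - {c})" using assms by auto
  ultimately show ?thesis
    unfolding weight_def using assms(1) by (simp add: sum.remove)
qed

lemma can_slide_iff: "can_slide (T, h) \<longleftrightarrow> (\<exists>d. nbr h d \<and> T d \<noteq> None)"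
  by (cases h) (auto simp: can_slide_def nbr_def)

lemma can_out_slide_iff: "can_out_slide (T, h) \<longleftrightarrow> (\<exists>d. nbr d h \<and> T d \<noteq> None)"
proof -
  obtain i j where h: "h = (i, j)" by (cases h)
  show ?thesis
  proof
    assume "can_out_slide (T, h)"
    then consider "0 < j" "T (i, j - 1) \<noteq> None" | "0 < i" "T (i - 1, j) \<noteq> None"
      by (auto simp: can_out_slide_def h)
    then show "\<exists>d. nbr d h \<and> T d \<noteq> None"
    proof cases
      case 1
      then show ?thesis by (intro exI[of _ "(i, j - 1)"]) (simp add: nbr_def h)
    next
      case 2
      then show ?thesis by (intro exI[of _ "(i - 1, j)"]) (simp add: nbr_def h)
    qed
  next
    assume "\<exists>d. nbr d h \<and> T d \<noteq> None"
    then show "can_out_slide (T, h)" by (auto simp: can_out_slide_def nbr_def h)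
  qed
qed

text \<open>Merges the cases of the step function into the one fact used later, that the moved entry
  is the least among the filled neighbours.\<close>

lemma slide_stepE:
  assumes "can_slide (T, h)"
  obtains c x where "slide_step (T, h) = (T(h := Some x, c := None), c)" "nbr h c" "T c = Some x"
    "\<And>d y. nbr h d \<Longrightarrow> T d = Some y \<Longrightarrow> x \<le> y"
proof -
  obtain i j where h: "h = (i, j)" by (cases h)
  have nbr: "nbr h d \<longleftrightarrow> d = (i, Suc j) \<or> d = (Suc i, j)" for d by (simp add: nbr_def h)
  show ?thesis
  proof (cases "T (i, Suc j)")
    case None
    then obtain y where y: "T (Suc i, j) = Some y" using assms by (auto simp: can_slide_def h)
    show ?thesis
    proof (rule that)
      show "slide_step (T, h) = (T(h := Some y, (Suc i, j) := None), (Suc i, j))"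
        using y None by (simp add: slide_step_def h)
      show "nbr h (Suc i, j)" "T (Suc i, j) = Some y" using y nbr by simp_all
      show "y \<le> z" if "nbr h d" "T d = Some z" for d z
        using that y None unfolding nbr by auto
    qed
  next
    case (Some x)
    show ?thesis
    proof (cases "\<exists>y. T (Suc i, j) = Some y \<and> y \<le> x")
      case True
      then obtain y where y: "T (Suc i, j) = Some y" "y \<le> x" by blast
      show ?thesis
      proof (rule that)
        show "slide_step (T, h) = (T(h := Some y, (Suc i, j) := None), (Suc i, j))"
          using y Some by (simp add: slide_step_def h)
        show "nbr h (Suc i, j)" "T (Suc i, j) = Some y" using y nbr by simp_all
        show "y \<le> z" if "nbr h d" "T d = Some z" for d z
          using that y Some unfolding nbr by auto
      qed
    next
      case False
      show ?thesis
      proof (rule that)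
        show "slide_step (T, h) = (T(h := Some x, (i, Suc j) := None), (i, Suc j))"
          using Some False by (cases "T (Suc i, j)") (auto simp: slide_step_def h)
        show "nbr h (i, Suc j)" "T (i, Suc j) = Some x" using Some nbr by simp_all
        show "x \<le> z" if "nbr h d" "T d = Some z" for d z
          using that False Some unfolding nbr by auto
      qed
    qed
  qed
qed

lemma out_slide_stepE:
  assumes "can_out_slide (T, h)"
  obtains c x where "out_slide_step (T, h) = (T(h := Some x, c := None), c)" "nbr c h"
    "T c = Some x" "\<And>d y. nbr d h \<Longrightarrow> T d = Some y \<Longrightarrow> y \<le> x"
proof -
  obtain i j where h: "h = (i, j)" by (cases h)
  let ?l = "if 0 < j then T (i, j - 1) else None" and ?u = "if 0 < i then T (i - 1, j) else None"
  have nbr: "nbr d h \<Longrightarrow> T d = Some y \<Longrightarrow> ?l = Some y \<or> ?u = Some y" for d y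
    by (cases d) (auto simp: nbr_def h)
  have l: "nbr (i, j - 1) h" "T (i, j - 1) = Some x" if "?l = Some x" for x
    using that by (auto simp: nbr_def h split: if_splits)
  have u: "nbr (i - 1, j) h" "T (i - 1, j) = Some x" if "?u = Some x" for x
    using that by (auto simp: nbr_def h split: if_splits)
  have step: "out_slide_step (T, h) = (case (?l, ?u) of
        (Some x, Some y) \<Rightarrow>
          if y < x then (T((i,j) := Some x, (i, j - 1) := None), (i, j - 1))
          else (T((i,j) := Some y, (i - 1, j) := None), (i - 1, j))
      | (Some x, None) \<Rightarrow> (T((i,j) := Some x, (i, j - 1) := None), (i, j - 1))
      | (None, Some y) \<Rightarrow> (T((i,j) := Some y, (i - 1, j) := None), (i - 1, j))
      | (None, None) \<Rightarrow> (T, (i,j)))"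
    by (simp add: out_slide_step_def h)
  show ?thesis
  proof (cases ?l)
    case None
    obtain d y where "nbr d h" "T d = Some y" using assms unfolding can_out_slide_iff by blast
    then have y: "?u = Some y" using nbr None by fastforce
    show ?thesis
    proof (rule that)
      show "out_slide_step (T, h) = (T(h := Some y, (i - 1, j) := None), (i - 1, j))"
        unfolding step None y by (simp add: h)
      show "nbr (i - 1, j) h" "T (i - 1, j) = Some y" using u y by blast+
      show "z \<le> y" if "nbr d h" "T d = Some z" for d z
        using nbr[OF that] None y by simp
    qed
  next
    case (Some x)
    note x = this
    show ?thesis
    proof (cases "\<exists>y. ?u = Some y \<and> x \<le> y")
      case True
      then obtain y where y: "?u = Some y" "x \<le> y" by blast
      show ?thesis
      proof (rule that)
        show "out_slide_step (T, h) = (T(h := Some y, (i - 1, j) := None), (i - 1, j))"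
          unfolding step x y(1) using y(2) by (simp add: h)
        show "nbr (i - 1, j) h" "T (i - 1, j) = Some y" using u y by blast+
        show "z \<le> y" if "nbr d h" "T d = Some z" for d z
          using nbr[OF that] x y by auto
      qed
    next
      case False
      show ?thesis
      proof (rule that)
        show "out_slide_step (T, h) = (T(h := Some x, (i, j - 1) := None), (i, j - 1))"
          unfolding step x using False by (cases ?u) (simp_all add: h not_le)
        show "nbr (i, j - 1) h" "T (i, j - 1) = Some x" using l x by blast+
        show "z \<le> x" if "nbr d h" "T d = Some z" for d z
          using nbr[OF that] x False by (metis nat_le_linear option.inject)
      qed
    qed
  qed
qed

lemma skew_tab_slide_end:
  assumes P: "punctured_tab A b T h"
    and stuck: "\<And>d. nbr h d \<Longrightarrow> T d = None"
  shows "skew_tab A b T"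
proof -
  have T: "T h = None" and conv: "convex_cells (insert h (dom T))"
    using P by (auto simp: punctured_tab_def)
  have "convex_cells (dom T)"
    unfolding convex_cells_def
  proof (intro ballI allI impI)
    fix c e d assume ce: "c \<in> dom T" "e \<in> dom T" and "nw c d" "nw d e"
    then have "d \<in> insert h (dom T)" using convex_cellsD[OF conv] by blast
    moreover have "d \<noteq> h"
    proof
      assume "d = h"
      then have "nw h e" "h \<noteq> e" using \<open>nw d e\<close> ce T by auto
      then obtain f where f: "nbr h f" "nw f e" by (rule nw_nbr)
      then have "f \<in> insert h (dom T)"
        using convex_cellsD[OF conv _ _ nbr_nw(1)[OF f(1)] f(2)] ce by blast
      then show False using stuck[OF f(1)] nbr_nw(2)[OF f(1)] by auto
    qed
    ultimately show "d \<in> dom T" by blast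
  qed
  then show ?thesis using P unfolding punctured_tab_def skew_tab_def by blast
qed

lemma skew_tab_out_slide_end:
  assumes P: "punctured_tab A b T h"
    and stuck: "\<And>d. nbr d h \<Longrightarrow> T d = None"
  shows "skew_tab A b T"
proof -
  have T: "T h = None" and conv: "convex_cells (insert h (dom T))"
    using P by (auto simp: punctured_tab_def)
  have "convex_cells (dom T)"
    unfolding convex_cells_def
  proof (intro ballI allI impI)
    fix c e d assume ce: "c \<in> dom T" "e \<in> dom T" and "nw c d" "nw d e"
    then have "d \<in> insert h (dom T)" using convex_cellsD[OF conv] by blast
    moreover have "d \<noteq> h"
    proof
      assume "d = h"
      then have "nw c h" "c \<noteq> h" using \<open>nw c d\<close> ce T by auto
      then obtain f where f: "nbr f h" "nw c f" by (rule nbr_nw_pred)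
      then have "f \<in> insert h (dom T)"
        using convex_cellsD[OF conv _ _ f(2) nbr_nw(1)[OF f(1)]] ce by blast
      then show False using stuck[OF f(1)] nbr_nw(2)[OF f(1)] by auto
    qed
    ultimately show "d \<in> dom T" by blast
  qed
  then show ?thesis using P unfolding punctured_tab_def skew_tab_def by blast
qed

lemma jdt_slide:
  assumes P: "punctured_tab {m..<n} b T h"
  obtains T' h' where "jdt_slide T h = (T', h')" "T' h' = None" "skew_tab {m..<n} b T'"
    "\<And>d. nbr h' d \<Longrightarrow> T' d = None" "insert h' (dom T') = insert h (dom T)"
    "raises b (reading_word T m n) (reading_word T' m n)"
    "can_slide (T, h) \<Longrightarrow> weight T' < weight T"
proof -
  \<comment> \<open>The alternative \<open>T' = T\<close> covers the start, where the weight has not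
    yet dropped. The invariance of \<open>insert h' (dom T')\<close> later locates the final hole of
    a promotion.\<close>
  let ?P = "\<lambda>(T', h'). punctured_tab {m..<n} b T' h' \<and> insert h' (dom T') = insert h (dom T) \<and>
    raises b (reading_word T m n) (reading_word T' m n) \<and>
    (T' = T \<and> h' = h \<or> weight T' < weight T)"
  have step: "?P (slide_step s) \<and> weight (fst (slide_step s)) < weight (fst s)"
    if P: "?P s" and can: "can_slide s" for s
  proof -
    obtain U g where s: "s = (U, g)" by (cases s)
    obtain c x where c: "slide_step (U, g) = (U(g := Some x, c := None), c)" "nbr g c" "U c = Some x"
      "\<And>d y. nbr g d \<Longrightarrow> U d = Some y \<Longrightarrow> x \<le> y"
      using slide_stepE can s by metis
    have U: "punctured_tab {m..<n} b U g" "insert g (dom U) = insert h (dom T)"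
      "raises b (reading_word T m n) (reading_word U m n)" "U = T \<and> g = h \<or> weight U < weight T"
      using P s by auto
    let ?U = "U(g := Some x, c := None)"
    have "punctured_tab {m..<n} b ?U c" using punctured_tab_slide[OF U(1) c(2,3)] c(4) by blast
    moreover have "insert c (dom ?U) = insert h (dom T)"
      using insert_dom_move[where T = U, OF c(3)] U(2) by metis
    moreover have "raises b (reading_word T m n) (reading_word ?U m n)"
      using rtranclp_trans[OF U(3) reading_word_slide[OF U(1) c(2,3)]] c(4) by blast
    moreover have "weight ?U < weight U"
    proof -
      have "finite (dom U)" "U g = None" using U(1) by (auto simp: punctured_tab_def fills_def)
      from weight_move[OF this c(3)] show ?thesis using c(2) by (auto simp: nbr_def)
    qed
    ultimately show ?thesis using c(1) U(4) s by auto
  qed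
  have "?P (jdt_slide T h) \<and> \<not> can_slide (jdt_slide T h)"
    unfolding jdt_slide_def
  proof (rule while_rule[where P = ?P and r = "measure (\<lambda>s. weight (fst s))"])
    show "?P (T, h)" using P by simp
  next
    fix s assume "?P s" "can_slide s"
    then show "?P (slide_step s)" "(slide_step s, s) \<in> measure (\<lambda>s. weight (fst s))"
      using step by simp_all
  qed auto
  moreover obtain T' h' where eq: "jdt_slide T h = (T', h')" by (cases "jdt_slide T h")
  ultimately have P': "punctured_tab {m..<n} b T' h'" "insert h' (dom T') = insert h (dom T)"
    "raises b (reading_word T m n) (reading_word T' m n)" "T' = T \<and> h' = h \<or> weight T' < weight T"
    and stuck: "\<not> can_slide (T', h')" by auto
  have "T' d = None" if "nbr h' d" for d using stuck that unfolding can_slide_iff by blast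
  moreover from this have "skew_tab {m..<n} b T'" using skew_tab_slide_end[OF P'(1)] by blast
  moreover have "T' h' = None" using P'(1) by (simp add: punctured_tab_def)
  ultimately show ?thesis using that[OF eq] P' stuck by blast
qed

lemma jdt_out_slide:
  assumes P: "punctured_tab {m..<n} b T h"
  obtains T' h' where "jdt_out_slide T h = (T', h')" "skew_tab {m..<n} b T'"
    "insert h' (dom T') = insert h (dom T)"
    "raises b (reading_word T' m n) (reading_word T m n)"
    "can_out_slide (T, h) \<Longrightarrow> weight T < weight T'"
proof -
  let ?P = "\<lambda>(T', h'). punctured_tab {m..<n} b T' h' \<and> insert h' (dom T') = insert h (dom T) \<and>
    raises b (reading_word T' m n) (reading_word T m n) \<and>
    (T' = T \<and> h' = h \<or> weight T < weight T')"
  have step: "?P (out_slide_step s) \<and>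
      fst (snd (out_slide_step s)) + snd (snd (out_slide_step s)) < fst (snd s) + snd (snd s)"
    if P: "?P s" and can: "can_out_slide s" for s
  proof -
    obtain U g where s: "s = (U, g)" by (cases s)
    obtain c x where c: "out_slide_step (U, g) = (U(g := Some x, c := None), c)" "nbr c g"
      "U c = Some x" "\<And>d y. nbr d g \<Longrightarrow> U d = Some y \<Longrightarrow> y \<le> x"
      using out_slide_stepE can s by metis
    have U: "punctured_tab {m..<n} b U g" "insert g (dom U) = insert h (dom T)"
      "raises b (reading_word U m n) (reading_word T m n)" "U = T \<and> g = h \<or> weight T < weight U"
      using P s by auto
    have Ug: "finite (dom U)" "U g = None" "increasing U"
      using U(1) by (auto simp: punctured_tab_def fills_def)
    let ?U = "U(g := Some x, c := None)"
    have PU: "punctured_tab {m..<n} b ?U c" using punctured_tab_out_slide[OF U(1) c(2,3)] c(4) by blast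
    moreover have "insert c (dom ?U) = insert h (dom T)"
      using insert_dom_move[where T = U, OF c(3)] U(2) by metis
    \<comment> \<open>The outward move is undone by an inward move into the new hole
      \<open>c\<close>, with \<open>x\<close> least among the neighbours of \<open>c\<close> by
      monotonicity; the raising path therefore runs backwards.\<close>
    moreover have "raises b (reading_word ?U m n) (reading_word U m n)"
    proof -
      have "g \<noteq> c" using c(3) Ug(2) by auto
      then have "?U g = Some x" by simp
      moreover have "x \<le> y" if "nbr c d" "?U d = Some y" for d y
      proof (cases "d = g")
        case False
        then have "U d = Some y" using that nbr_nw(2)[OF that(1)] by (auto split: if_splits)
        then show ?thesis using increasingD_le[OF Ug(3) c(3)] nbr_nw(1)[OF that(1)] by blast
      qed (use that \<open>?U g = Some x\<close> in simp)
      ultimately have "raises b (reading_word ?U m n) (reading_word (?U(c := Some x, g := None)) m n)"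
        by (rule reading_word_slide[OF PU c(2)])
      moreover have "?U(c := Some x, g := None) = U"
        using c(3) Ug(2) \<open>g \<noteq> c\<close> by (auto simp: fun_eq_iff)
      ultimately show ?thesis by simp
    qed
    then have "raises b (reading_word ?U m n) (reading_word T m n)"
      using U(3) by (rule rtranclp_trans)
    moreover have "weight U < weight ?U"
      using weight_move[OF Ug(1,2) c(3)] c(2) by (auto simp: nbr_def)
    moreover have "fst c + snd c < fst g + snd g" using c(2) by (auto simp: nbr_def)
    ultimately show ?thesis using c(1) U(4) s by auto
  qed
  have "?P (jdt_out_slide T h) \<and> \<not> can_out_slide (jdt_out_slide T h)"
    unfolding jdt_out_slide_def
  proof (rule while_rule[where P = ?P and r = "measure (\<lambda>s. fst (snd s) + snd (snd s))"])
    show "?P (T, h)" using P by simp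
  next
    fix s assume "?P s" "can_out_slide s"
    then show "?P (out_slide_step s)"
      "(out_slide_step s, s) \<in> measure (\<lambda>s. fst (snd s) + snd (snd s))"
      using step by simp_all
  qed auto
  moreover obtain T' h' where eq: "jdt_out_slide T h = (T', h')" by (cases "jdt_out_slide T h")
  ultimately have P': "punctured_tab {m..<n} b T' h'" "insert h' (dom T') = insert h (dom T)"
    "raises b (reading_word T' m n) (reading_word T m n)" "T' = T \<and> h' = h \<or> weight T < weight T'"
    and stuck: "\<not> can_out_slide (T', h')" by auto
  have "T' d = None" if "nbr d h'" for d using stuck that unfolding can_out_slide_iff by blast
  then have "skew_tab {m..<n} b T'" using skew_tab_out_slide_end[OF P'(1)] by blast
  then show ?thesis using that[OF eq] P' stuck by blast
qed

lemma skew_tabD: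
  assumes "skew_tab A b T"
  shows "fills T A" "finite (dom T)" "increasing T" "convex_cells (dom T)"
    "\<And>c. c \<in> dom T \<Longrightarrow> fst c < b"
  using assms by (auto simp: skew_tab_def fills_def)

lemma finite_inner_holes: assumes "finite (dom T)" shows "finite (inner_holes T)"
proof (rule finite_subset)
  show "inner_holes T \<subseteq> (\<Union>c\<in>dom T. {..fst c} \<times> {..snd c})"
    unfolding inner_holes_def by force
qed (use assms in auto)

lemma inner_holes_iff: "d \<in> inner_holes T \<longleftrightarrow> T d = None \<and> (\<exists>e\<in>dom T. nw d e)"
proof -
  obtain i j where d: "d = (i, j)" by (cases d)
  have "(\<exists>e\<in>dom T. nw d e) \<longleftrightarrow> (\<exists>i' j'. T (i', j') \<noteq> None \<and> i \<le> i' \<and> j \<le> j')"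
    unfolding d nw_def by force
  then show ?thesis unfolding d inner_holes_def by simp
qed

text \<open>Taking the lowest row and then the rightmost column selects a hole that is maximal in
  the northwest order.\<close>

lemma inner_corner:
  assumes fin: "finite (dom T)" and ne: "inner_holes T \<noteq> {}"
  shows "inner_corner T \<in> inner_holes T"
    and "d \<in> inner_holes T \<Longrightarrow> nw (inner_corner T) d \<Longrightarrow> d = inner_corner T"
proof -
  define H where "H = inner_holes T"
  define i where "i = Max (fst ` H)"
  define j where "j = Max {j. (i, j) \<in> H}"
  have c: "inner_corner T = (i, j)" by (simp add: inner_corner_def H_def i_def j_def Let_def)
  have finH: "finite H" using finite_inner_holes[OF fin] by (simp add: H_def)
  have "H \<noteq> {}" using ne by (simp add: H_def)
  then have "i \<in> fst ` H" unfolding i_def using finH by (intro Max_in) auto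
  then have "{j. (i, j) \<in> H} \<noteq> {}" by force
  moreover have finj: "finite {j. (i, j) \<in> H}"
    by (rule finite_subset[of _ "snd ` H"]) (use finH in force)+
  ultimately have "j \<in> {j. (i, j) \<in> H}" unfolding j_def by (intro Max_in)
  then show "inner_corner T \<in> inner_holes T" by (simp add: c H_def)
  assume d: "d \<in> inner_holes T" "nw (inner_corner T) d"
  obtain k l where kl: "d = (k, l)" by (cases d)
  have "(k, l) \<in> H" using d kl by (simp add: H_def)
  then have "k \<in> fst ` H" by force
  then have "k \<le> i" unfolding i_def using finH by (intro Max_ge) auto
  moreover have "i \<le> k" "j \<le> l" using d(2) by (auto simp: kl c nw_def)
  ultimately have "k = i" by simp
  then have "l \<le> j" unfolding j_def using finj \<open>(k, l) \<in> H\<close> by (intro Max_ge) auto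
  then show "d = inner_corner T" using \<open>k = i\<close> \<open>j \<le> l\<close> by (simp add: kl c)
qed

text \<open>An empty cell between the hole and a filled cell would itself be a hole southeast of the
  chosen one, against its maximality. The filled neighbour guarantees that every round of
  \<open>Rect\<close> makes progress.\<close>

lemma punctured_tab_inner_corner:
  assumes T: "skew_tab A b T" and ne: "inner_holes T \<noteq> {}"
  shows "punctured_tab A b T (inner_corner T)" "can_slide (T, inner_corner T)"
proof -
  let ?h = "inner_corner T"
  note D = skew_tabD[OF T]
  have "?h \<in> inner_holes T" by (rule inner_corner(1)[OF D(2) ne])
  then obtain e where h: "T ?h = None" and e: "e \<in> dom T" "nw ?h e" using inner_holes_iff by blast
  have conv: "convex_cells (insert ?h (dom T))"
    unfolding convex_cells_def
  proof (intro ballI allI impI)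
    fix c f d assume c: "c \<in> insert ?h (dom T)" and f: "f \<in> insert ?h (dom T)"
      and cd: "nw c d" "nw d f"
    have de: "\<exists>e\<in>dom T. nw d e" using f cd(2) e nw_trans by blast
    show "d \<in> insert ?h (dom T)"
    proof (cases "c \<in> dom T")
      case True
      then show ?thesis using de cd(1) convex_cellsD[OF D(4)] by blast
    next
      case False
      then have "nw ?h d" using c cd by blast
      then have "d \<in> inner_holes T \<Longrightarrow> d = ?h" using inner_corner(2)[OF D(2) ne] by blast
      moreover have "d \<in> inner_holes T" if "T d = None" using that de inner_holes_iff by simp
      ultimately show ?thesis by (cases "T d") auto
    qed
  qed
  have "fst ?h < b" using e D(5)[OF e(1)] by (simp add: nw_def)
  then show "punctured_tab A b T ?h"
    using D h conv unfolding punctured_tab_def by blast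
  have "?h \<noteq> e" using h e by auto
  then obtain d where d: "nbr ?h d" "nw d e" using e(2) nw_nbr by blast
  have "d \<in> insert ?h (dom T)"
    using convex_cellsD[OF conv _ _ nbr_nw(1)[OF d(1)] d(2)] e by blast
  then have "d \<in> dom T" using nbr_nw(2)[OF d(1)] by blast
  then show "can_slide (T, ?h)" using d(1) unfolding can_slide_iff by blast
qed

lemma Rect:
  assumes T: "skew_tab {m..<n} b T"
  shows "skew_tab {m..<n} b (Rect T)" "inner_holes (Rect T) = {}"
    "raises b (reading_word T m n) (reading_word (Rect T) m n)"
proof -
  let ?P = "\<lambda>U. skew_tab {m..<n} b U \<and> raises b (reading_word T m n) (reading_word U m n)"
  let ?f = "\<lambda>U. fst (jdt_slide U (inner_corner U))"
  have step: "?P (?f U) \<and> weight (?f U) < weight U" if U: "?P U" and ne: "inner_holes U \<noteq> {}" for U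
  proof -
    note P = punctured_tab_inner_corner[OF conjunct1[OF U] ne]
    obtain U' h' where U': "jdt_slide U (inner_corner U) = (U', h')" "skew_tab {m..<n} b U'"
      "raises b (reading_word U m n) (reading_word U' m n)" "weight U' < weight U"
      using jdt_slide[OF P(1)] P(2) by metis
    then show ?thesis using U by (auto intro: rtranclp_trans)
  qed
  have "?P (Rect T) \<and> inner_holes (Rect T) = {}"
    unfolding Rect_def
  proof (rule while_rule[where P = ?P and r = "measure weight"])
    show "?P T" using T by simp
  next
    fix U assume "?P U" "inner_holes U \<noteq> {}"
    then show "?P (?f U)" "(?f U, U) \<in> measure weight" using step by simp_all
  qed auto
  then show "skew_tab {m..<n} b (Rect T)" "inner_holes (Rect T) = {}"
    "raises b (reading_word T m n) (reading_word (Rect T) m n)" by auto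
qed

text \<open>Without inner holes every entry has a smaller one directly above it, so each column
  counted for the lower row is also counted for the upper row.\<close>

lemma hw_straight:
  assumes T: "skew_tab {m..<n} b T" and "inner_holes T = {}"
  shows "hw b (reading_word T m n)"
  unfolding hw_def
proof (intro allI impI)
  fix i t
  note D = skew_tabD[OF T]
  have "entry_cols T (Suc i) m (m + t) \<subseteq> entry_cols T i m (m + t)"
  proof
    fix j assume "j \<in> entry_cols T (Suc i) m (m + t)"
    then obtain v where v: "T (Suc i, j) = Some v" "m \<le> v" "v < m + t"
      by (auto simp: entry_cols_def)
    have "T (i, j) \<noteq> None"
    proof
      assume "T (i, j) = None"
      moreover have "(Suc i, j) \<in> dom T" "nw (i, j) (Suc i, j)" using v(1) by (auto simp: nw_def)
      ultimately have "(i, j) \<in> inner_holes T" unfolding inner_holes_iff by blast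
      then show False using assms(2) by simp
    qed
    then obtain v' where v': "T (i, j) = Some v'" by blast
    then have "v' < v" using increasingD[OF D(3) v' v(1)] by (simp add: nw_def)
    moreover have "v' \<in> {m..<n}" using D(1) v' unfolding fills_def ran_def by blast
    ultimately show "j \<in> entry_cols T i m (m + t)" using v v' by (simp add: entry_cols_def)
  qed
  then have "card (entry_cols T (Suc i) m (m + t)) \<le> card (entry_cols T i m (m + t))"
    by (rule card_mono[OF finite_entry_cols[OF D(2)]])
  then show "exc i (reading_word T m n) t \<le> 0" by (simp add: exc_reading_word[OF D(1)])
qed

lemma reading_word_Rect:
  "skew_tab {m..<n} b T \<Longrightarrow> reading_word (Rect T) m n = top_word b (reading_word T m n)"
  using Rect hw_straight top_word_eqI by metis

section \<open>Outer rectification\<close>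

lemma outer_holes_iff:
  "d \<in> outer_holes b a T \<longleftrightarrow> fst d < b \<and> snd d < a \<and> T d = None \<and> (\<exists>e\<in>dom T. nw e d)"
proof -
  obtain i j where d: "d = (i, j)" by (cases d)
  have "(\<exists>e\<in>dom T. nw e d) \<longleftrightarrow> (\<exists>i' j'. T (i', j') \<noteq> None \<and> i' \<le> i \<and> j' \<le> j)"
    unfolding d nw_def by force
  then show ?thesis unfolding d outer_holes_def by simp
qed

lemma outer_corner:
  assumes ne: "outer_holes b a T \<noteq> {}"
  shows "outer_corner b a T \<in> outer_holes b a T"
    and "d \<in> outer_holes b a T \<Longrightarrow> nw d (outer_corner b a T) \<Longrightarrow> d = outer_corner b a T"
proof -
  define H where "H = outer_holes b a T"
  define i where "i = Min (fst ` H)"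
  define j where "j = Min {j. (i, j) \<in> H}"
  have c: "outer_corner b a T = (i, j)" by (simp add: outer_corner_def H_def i_def j_def Let_def)
  have finH: "finite H"
    by (rule finite_subset[of _ "{..<b} \<times> {..<a}"]) (auto simp: H_def outer_holes_def)
  have "H \<noteq> {}" using ne by (simp add: H_def)
  then have "i \<in> fst ` H" unfolding i_def using finH by (intro Min_in) auto
  then have "{j. (i, j) \<in> H} \<noteq> {}" by force
  moreover have finj: "finite {j. (i, j) \<in> H}"
    by (rule finite_subset[of _ "snd ` H"]) (use finH in force)+
  ultimately have "j \<in> {j. (i, j) \<in> H}" unfolding j_def by (intro Min_in)
  then show "outer_corner b a T \<in> outer_holes b a T" by (simp add: c H_def)
  assume d: "d \<in> outer_holes b a T" "nw d (outer_corner b a T)"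
  obtain k l where kl: "d = (k, l)" by (cases d)
  have "(k, l) \<in> H" using d kl by (simp add: H_def)
  then have "k \<in> fst ` H" by force
  then have "i \<le> k" unfolding i_def using finH by (intro Min_le) auto
  moreover have "k \<le> i" "l \<le> j" using d(2) by (auto simp: kl c nw_def)
  ultimately have "k = i" by simp
  then have "j \<le> l" unfolding j_def using finj \<open>(k, l) \<in> H\<close> by (intro Min_le) auto
  then show "d = outer_corner b a T" using \<open>k = i\<close> \<open>l \<le> j\<close> by (simp add: kl c)
qed

lemma punctured_tab_outer_corner:
  assumes T: "skew_tab A b T" and box: "\<forall>c\<in>dom T. snd c < a" and ne: "outer_holes b a T \<noteq> {}"
  shows "punctured_tab A b T (outer_corner b a T)" "can_out_slide (T, outer_corner b a T)"
    "snd (outer_corner b a T) < a"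
proof -
  let ?h = "outer_corner b a T"
  note D = skew_tabD[OF T]
  have "?h \<in> outer_holes b a T" by (rule outer_corner(1)[OF ne])
  then obtain e where h: "T ?h = None" "fst ?h < b" "snd ?h < a" and e: "e \<in> dom T" "nw e ?h"
    using outer_holes_iff by blast
  have conv: "convex_cells (insert ?h (dom T))"
    unfolding convex_cells_def
  proof (intro ballI allI impI)
    fix c f d assume c: "c \<in> insert ?h (dom T)" and f: "f \<in> insert ?h (dom T)"
      and cd: "nw c d" "nw d f"
    have ed: "\<exists>e\<in>dom T. nw e d" using c cd(1) e nw_trans by blast
    show "d \<in> insert ?h (dom T)"
    proof (cases "f \<in> dom T")
      case True
      then show ?thesis using ed cd(2) convex_cellsD[OF D(4)] by blast
    next
      case False
      then have dh: "nw d ?h" using f cd by blast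
      then have "d \<in> outer_holes b a T \<Longrightarrow> d = ?h" using outer_corner(2)[OF ne] by blast
      moreover have "fst d < b" "snd d < a" using dh h by (auto simp: nw_def)
      then have "d \<in> outer_holes b a T" if "T d = None" using that ed outer_holes_iff by simp
      ultimately show ?thesis by (cases "T d") auto
    qed
  qed
  show "punctured_tab A b T ?h"
    using D h conv unfolding punctured_tab_def by blast
  have "e \<noteq> ?h" using h e by auto
  then obtain d where d: "nbr d ?h" "nw e d" using e(2) nbr_nw_pred by blast
  have "d \<in> insert ?h (dom T)"
    using convex_cellsD[OF conv _ _ d(2) nbr_nw(1)[OF d(1)]] e by blast
  then have "d \<in> dom T" using nbr_nw(2)[OF d(1)] by blast
  then show "can_out_slide (T, ?h)" using d(1) unfolding can_out_slide_iff by blast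
  show "snd ?h < a" by (rule h(3))
qed

lemma card_dom_fills: assumes "fills T A" shows "card (dom T) = card A"
proof -
  have "ran T = (\<lambda>c. the (T c)) ` dom T" unfolding ran_def by force
  moreover have "inj_on (\<lambda>c. the (T c)) (dom T)"
    using fills_inj[OF assms] by (intro inj_onI) auto
  ultimately show ?thesis using assms card_image unfolding fills_def by metis
qed

lemma weight_le:
  assumes "skew_tab A b T" "\<forall>c\<in>dom T. snd c < a"
  shows "weight T \<le> card A * (b + a)"
proof -
  have "weight T \<le> (\<Sum>c\<in>dom T. b + a)"
    unfolding weight_def
  proof (rule sum_mono)
    fix c assume c: "c \<in> dom T"
    show "fst c + snd c \<le> b + a" using skew_tabD(5)[OF assms(1) c] bspec[OF assms(2) c] by simp
  qed
  then show ?thesis using card_dom_fills[OF skew_tabD(1)[OF assms(1)]] by simp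
qed

lemma RectStar:
  assumes T: "skew_tab {m..<n} b T"
  obtains a where "skew_tab {m..<n} b (RectStar b T)" "outer_holes b a (RectStar b T) = {}"
    "\<forall>c\<in>dom (RectStar b T). snd c < a"
    "raises b (reading_word (RectStar b T) m n) (reading_word T m n)"
proof -
  \<comment> \<open>The width fixed in the definition of \<open>RectStar\<close>. For an empty
    tableau \<open>Max\<close> is unspecified, but there are then no filled cells to bound.\<close>
  define a where "a = Suc (Max (snd ` dom T))"
  let ?P = "\<lambda>U. skew_tab {m..<n} b U \<and> (\<forall>c\<in>dom U. snd c < a) \<and>
    raises b (reading_word U m n) (reading_word T m n)"
  let ?f = "\<lambda>U. fst (jdt_out_slide U (outer_corner b a U))"
  \<comment> \<open>Outward slides increase \<open>weight\<close>, so termination needs an upper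
    bound: every cell stays inside \<open>b\<close> rows and \<open>a\<close> columns.\<close>
  let ?N = "card {m..<n} * (b + a)"
  have box: "snd c < a" if "c \<in> dom T" for c
    using skew_tabD(2)[OF T] that unfolding a_def less_Suc_eq_le by (intro Max_ge) auto
  have step: "?P (?f U) \<and> weight U < weight (?f U)"
    if U: "?P U" and ne: "outer_holes b a U \<noteq> {}" for U
  proof -
    let ?h = "outer_corner b a U"
    have P: "punctured_tab {m..<n} b U ?h" "can_out_slide (U, ?h)" "snd ?h < a"
      using punctured_tab_outer_corner U ne by blast+
    obtain U' h' where U': "jdt_out_slide U ?h = (U', h')" "skew_tab {m..<n} b U'"
      "insert h' (dom U') = insert ?h (dom U)"
      "raises b (reading_word U' m n) (reading_word U m n)" "weight U < weight U'"
      using jdt_out_slide[OF P(1)] P(2) by metis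
    have "\<forall>c\<in>dom U'. snd c < a"
    proof
      fix c assume "c \<in> dom U'"
      then have "c \<in> insert ?h (dom U)" using U'(3) by blast
      then show "snd c < a" using U P(3) by (elim insertE) simp_all
    qed
    then show ?thesis using U U' by (auto intro: rtranclp_trans)
  qed
  have "?P (RectStar b T) \<and> outer_holes b a (RectStar b T) = {}"
    unfolding RectStar_def Let_def a_def[symmetric]
  proof (rule while_rule[where P = ?P and r = "measure (\<lambda>U. ?N - weight U)"])
    show "?P T" using T box by simp
  next
    fix U assume U: "?P U" "outer_holes b a U \<noteq> {}"
    then show "?P (?f U)" using step by blast
    then have "weight (?f U) \<le> ?N" using weight_le by blast
    moreover have "weight U < weight (?f U)" using step[OF U] by blast
    ultimately have "?N - weight (?f U) < ?N - weight U" by (intro diff_less_mono2) linarith+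
    then show "(?f U, U) \<in> measure (\<lambda>U. ?N - weight U)" by (simp only: in_measure)
  qed auto
  then show ?thesis using that by blast
qed

lemma lw_antistraight:
  assumes T: "skew_tab {m..<n} b T" and box: "\<forall>c\<in>dom T. snd c < a"
    and holes: "outer_holes b a T = {}"
  shows "lw b (reading_word T m n)"
  unfolding lw_def
proof (intro allI impI)
  fix i t assume i: "Suc i < b"
  note D = skew_tabD[OF T]
  let ?y = "reading_word T m n"
  show "exc i ?y t \<le> exc i ?y (length ?y)"
  proof (cases "t < n - m")
    case False
    then show ?thesis using exc_beyond[of ?y t i] by simp
  next
    case True
    \<comment> \<open>The condition compares a prefix with the whole word, so the entries from
      \<open>m + t\<close> on are counted; each entry of the upper row has a larger one below
      it.\<close>
    have "entry_cols T i (m + t) n \<subseteq> entry_cols T (Suc i) (m + t) n"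
    proof
      fix j assume "j \<in> entry_cols T i (m + t) n"
      then obtain v where v: "T (i, j) = Some v" "m + t \<le> v" by (auto simp: entry_cols_def)
      have "T (Suc i, j) \<noteq> None"
      proof
        assume "T (Suc i, j) = None"
        moreover have ij: "(i, j) \<in> dom T" "nw (i, j) (Suc i, j)" using v(1) by (auto simp: nw_def)
        moreover have "j < a" using bspec[OF box ij(1)] by simp
        ultimately have "(Suc i, j) \<in> outer_holes b a T"
          using i unfolding outer_holes_iff fst_conv snd_conv by blast
        then show False using holes by simp
      qed
      then obtain v' where v': "T (Suc i, j) = Some v'" by blast
      then have "v < v'" using increasingD[OF D(3) v(1) v'] by (simp add: nw_def)
      moreover have "v' \<in> {m..<n}" using D(1) v' unfolding fills_def ran_def by blast
      ultimately show "j \<in> entry_cols T (Suc i) (m + t) n" using v v' by (simp add: entry_cols_def)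
    qed
    then have "card (entry_cols T i (m + t) n) \<le> card (entry_cols T (Suc i) (m + t) n)"
      by (rule card_mono[OF finite_entry_cols[OF D(2)]])
    then show ?thesis
      using True card_entry_cols_split[OF D(2), of m "m + t" n]
      by (simp add: exc_reading_word[OF D(1)])
  qed
qed

lemma reading_word_set:
  assumes "skew_tab {m..<n} b T"
  shows "set (reading_word T m n) \<subseteq> {..<b}"
proof -
  have "row_of T v < b" if "v \<in> {m..<n}" for v
  proof -
    note D = skew_tabD[OF assms]
    obtain c where c: "T c = Some v" using D(1) \<open>v \<in> {m..<n}\<close> unfolding fills_def ran_def by blast
    then show ?thesis using row_of_cell[OF D(1) c] D(5)[of c] by auto
  qed
  then show ?thesis by (auto simp: reading_word_def)
qed

lemma reading_word_RectStar:
  assumes "skew_tab {m..<n} b T"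
  shows "reading_word (RectStar b T) m n = bot_word b (reading_word T m n)"
  using RectStar[OF assms] lw_antistraight reading_word_set bot_word_eqI by metis

text \<open>Two cells in northwest order are compared through the corner cell \<open>(i, l)\<close>,
  which convexity supplies.\<close>

lemma skew_tabI:
  assumes "fills T A" "convex_cells (dom T)" and rows: "\<And>c. c \<in> dom T \<Longrightarrow> fst c < b"
    and row: "\<And>i j j' x y. T (i, j) = Some x \<Longrightarrow> T (i, j') = Some y \<Longrightarrow> j < j' \<Longrightarrow> x < y"
    and col: "\<And>i i' j x y. T (i, j) = Some x \<Longrightarrow> T (i', j) = Some y \<Longrightarrow> i < i' \<Longrightarrow> x < y"
  shows "skew_tab A b T"
proof -
  have "increasing T"
    unfolding increasing_def
  proof (intro allI impI)
    fix c d x y assume x: "T c = Some x" and y: "T d = Some y" and cd: "nw c d" "c \<noteq> d"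
    obtain i j where c: "c = (i, j)" by (cases c)
    obtain k l where d: "d = (k, l)" by (cases d)
    have le: "i \<le> k" "j \<le> l" using cd(1) by (auto simp: c d nw_def)
    have "(i, l) \<in> dom T"
      using convex_cellsD[OF assms(2), of c d "(i, l)"] x y le by (auto simp: c d nw_def)
    then obtain z where z: "T (i, l) = Some z" by blast
    have "x < z \<or> x = z \<and> j = l" using row[OF x[unfolded c] z] le(2) z x c by (cases "j = l") auto
    moreover have "z < y \<or> z = y \<and> i = k" using col[OF z y[unfolded d]] le(1) z y d by (cases "i = k") auto
    ultimately show "x < y" using cd(2) c d by auto
  qed
  then show ?thesis using assms unfolding skew_tab_def by blast
qed

lemma fills_bij_betw:
  "fills T A \<longleftrightarrow> finite (dom T) \<and> bij_betw (\<lambda>c. the (T c)) (dom T) A"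
proof -
  have ran: "(\<lambda>c. the (T c)) ` dom T = ran T" unfolding ran_def by force
  have "inj_on (\<lambda>c. the (T c)) (dom T) \<longleftrightarrow>
      (\<forall>c d x. T c = Some x \<longrightarrow> T d = Some x \<longrightarrow> c = d)" (is "?L \<longleftrightarrow> ?R")
  proof
    assume inj: ?L
    have "c = d" if "T c = Some x" "T d = Some x" for c d x
      using inj_onD[OF inj, of c d] that by auto
    then show ?R by blast
  next
    assume R: ?R
    have "c = d" if "T c = Some x" "T d = Some y" "the (T c) = the (T d)" for c d x y
      using R that by (metis option.sel)
    then show ?L by (intro inj_onI) blast
  qed
  then show ?thesis unfolding fills_def bij_betw_def ran by blast
qed

lemma skew_tab_standard:
  assumes "standard_filling T n" "convex_cells (dom T)" "\<And>c. c \<in> dom T \<Longrightarrow> fst c < b"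
  shows "skew_tab {1..<Suc n} b T"
proof (rule skew_tabI)
  show "fills T {1..<Suc n}"
    using assms(1) unfolding fills_bij_betw standard_filling_def atLeastLessThanSuc_atLeastAtMost by blast
qed (use assms in \<open>unfold standard_filling_def; blast\<close>)+

lemma standard_filling_skew_tab:
  assumes "skew_tab {1..<Suc n} b T"
  shows "standard_filling T n"
proof -
  note D = skew_tabD[OF assms]
  have "x < y" if "T (i, j) = Some x" "T (i, j') = Some y" "j < j'" for i j j' x y
    using increasingD[OF D(3) that(1,2)] that(3) by (simp add: nw_def)
  moreover have "x < y" if "T (i, j) = Some x" "T (i', j) = Some y" "i < i'" for i i' j x y
    using increasingD[OF D(3) that(1,2)] that(3) by (simp add: nw_def)
  ultimately show ?thesis
    using D(1) unfolding fills_bij_betw standard_filling_def atLeastLessThanSuc_atLeastAtMost by blast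
qed

text \<open>Row \<open>i\<close> of the tableau encoded by \<open>y\<close>; entries start at 1 and
  list positions at 0, hence \<open>Suc\<close>.\<close>

definition rows_of :: "nat list \<Rightarrow> nat \<Rightarrow> nat list" where
  "rows_of y i = map Suc (filter (\<lambda>t. y ! t = i) [0..<length y])"

text \<open>Concatenating words amounts to concatenating rows, with entries shifted by the length of
  the first word. This matches the shape of the definition of \<open>R_a\<close>.\<close>

lemma rows_of_append: "rows_of (x @ y) i = rows_of x i @ map (\<lambda>v. v + length x) (rows_of y i)"
proof -
  have "[0..<length (x @ y)] = [0..<length x] @ map (\<lambda>t. t + length x) [0..<length y]"
    by (simp add: map_add_upt upt_add_eq_append[of 0, simplified] add.commute)
  moreover have "filter (\<lambda>t. (x @ y) ! t = i) [0..<length x] = filter (\<lambda>t. x ! t = i) [0..<length x]"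
    by (rule filter_cong) (auto simp: nth_append)
  ultimately show ?thesis
    by (simp add: rows_of_def filter_map o_def nth_append)
qed

text \<open>Both lists are strictly increasing and have the same elements. The columns are
  forgotten, which is harmless because \<open>R_a\<close> uses row contents only.\<close>

lemma row_list_eq_rows_of:
  assumes "skew_tab {1..<Suc n} b T"
  shows "row_list T i = rows_of (reading_word T 1 (Suc n)) i"
proof -
  note D = skew_tabD[OF assms]
  let ?J = "{j. T (i, j) \<noteq> None}" and ?f = "\<lambda>j. the (T (i, j))"
  let ?R = "rows_of (reading_word T 1 (Suc n)) i"
  have fin: "finite ?J"
    by (rule finite_subset[of _ "snd ` dom T"]) (use D(2) in force)+
  have mono: "?f j < ?f j'" if "j \<in> ?J" "j' \<in> ?J" "j < j'" for j j'
    using that increasingD[OF D(3), of "(i, j)" _ "(i, j')"] by (auto simp: nw_def)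
  have "sorted_wrt (<) (row_list T i)"
    unfolding row_list_def sorted_wrt_map
    by (rule sorted_wrt_mono_rel[OF _ strict_sorted_list_of_set]) (use fin mono in auto)
  moreover have "sorted_wrt (<) ?R"
    by (simp add: rows_of_def sorted_wrt_map sorted_wrt_filter)
  moreover have "set (row_list T i) = set ?R"
  proof -
    have "v \<in> set ?R \<longleftrightarrow> v \<in> {1..<Suc n} \<and> row_of T v = i" for v
    proof -
      have "v \<in> set ?R \<longleftrightarrow> (\<exists>t<n. reading_word T 1 (Suc n) ! t = i \<and> v = Suc t)"
        by (auto simp: rows_of_def)
      also have "\<dots> \<longleftrightarrow> (\<exists>t<n. row_of T (Suc t) = i \<and> v = Suc t)"
        by (auto simp: reading_word_def simp del: upt_Suc)
      also have "\<dots> \<longleftrightarrow> v \<in> {1..<Suc n} \<and> row_of T v = i"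
        by (cases v) auto
      finally show ?thesis .
    qed
    moreover have "v \<in> set (row_list T i) \<longleftrightarrow> v \<in> {1..<Suc n} \<and> row_of T v = i" for v
    proof -
      have "v \<in> set (row_list T i) \<longleftrightarrow> in_row T v i"
        using fin by (force simp: row_list_def in_row_def)
      moreover have "v \<in> {1..<Suc n}" if "in_row T v i"
        using that D(1) unfolding fills_def ran_def in_row_def by blast
      ultimately show ?thesis using in_row_iff[OF D(1), of v i] by blast
    qed
    ultimately show ?thesis by blast
  qed
  ultimately show ?thesis by (metis strict_sorted_equal)
qed

lemma row_list_shift: "row_list (shift T x) i = map (\<lambda>v. v + x) (row_list T i)"
proof (cases "finite {j. T (i, j) \<noteq> None}")
  case True
  then show ?thesis by (auto simp: row_list_def shift_def)
next
  case False
  then show ?thesis by (simp add: row_list_def shift_def)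
qed

lemma nth_concat_map_upt:
  assumes "\<And>t. length (f t) = r" "q < k * r"
  shows "concat (map f [0..<k]) ! q = f (q div r) ! (q mod r)"
  using assms(2)
proof (induction k)
  case (Suc k)
  have len: "length (concat (map f [0..<k])) = k * r"
    using assms(1) by (induction k) auto
  show ?case
  proof (cases "q < k * r")
    case True
    then show ?thesis using Suc.IH len by (simp add: nth_append)
  next
    case False
    then obtain s where s: "q = k * r + s" using le_Suc_ex not_less by blast
    then have "s < r" using Suc.prems by simp
    then have "q div r = k" "q mod r = s" using s by auto
    then show ?thesis using len s by (simp add: nth_append)
  qed
qed simp

lemma power_word_nth:
  "t < k * length w \<Longrightarrow> power_word w k ! t = w ! (t mod length w)"
  using nth_concat_map_upt[of "\<lambda>_. w" "length w" t k]
  by (simp add: power_word_def map_replicate_const)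

section \<open>Powers of a skew tableau\<close>

lemma skew_tab_count_row:
  assumes "skew_tab {m..<n} b T"
  shows "count_list (reading_word T m n) l = card {j. T (l, j) \<noteq> None}"
proof -
  note D = skew_tabD[OF assms]
  have "entry_cols T l m (m + (n - m)) = {j. T (l, j) \<noteq> None}"
  proof (intro equalityI subsetI)
    fix j assume "j \<in> {j. T (l, j) \<noteq> None}"
    then obtain v where v: "T (l, j) = Some v" by blast
    then have "v \<in> {m..<n}" using D(1) unfolding fills_def ran_def by blast
    then show "j \<in> entry_cols T l m (m + (n - m))" using v by (auto simp: entry_cols_def)
  qed (auto simp: entry_cols_def)
  then show ?thesis using count_reading_word[OF D(1), of "n - m" l] by simp
qed

text \<open>Entries are numbered from 1, so 1 is subtracted before dividing into blocks of
  \<open>m\<close>.\<close>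

lemma entry_div_mod:
  fixes s m q :: nat
  assumes "1 \<le> s" "s \<le> m"
  shows "(s + q * m - 1) div m = q" "Suc ((s + q * m - 1) mod m) = s"
proof -
  obtain x where "s = Suc x" using assms(1) by (cases s) auto
  then show "(s + q * m - 1) div m = q" "Suc ((s + q * m - 1) mod m) = s"
    using assms(2) by simp_all
qed

context
  fixes S :: tab and b r :: nat and c :: "nat \<Rightarrow> nat"
  assumes r: "1 \<le> r"
    and c_mono: "\<And>i i'. i \<le> i' \<Longrightarrow> i' < b \<Longrightarrow> c i' \<le> c i"
    and dom_S: "dom S = {(i, j). i < b \<and> c i \<le> j \<and> j < c i + r}"
    and std: "standard_filling S (b * r)"
begin

lemma convex_rows:
  "convex_cells {(i, j). i < b \<and> c i \<le> j \<and> j < c i + n}"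
  unfolding convex_cells_def
proof (intro ballI allI impI)
  fix p q d assume p: "p \<in> {(i, j). i < b \<and> c i \<le> j \<and> j < c i + n}"
    and q: "q \<in> {(i, j). i < b \<and> c i \<le> j \<and> j < c i + n}" and d: "nw p d" "nw d q"
  have "fst d < b" using q d by (auto simp: nw_def)
  then have "c (fst d) \<le> c (fst p)" "c (fst q) \<le> c (fst d)"
    using p q d c_mono by (auto simp: nw_def)
  then show "d \<in> {(i, j). i < b \<and> c i \<le> j \<and> j < c i + n}"
    using p q d \<open>fst d < b\<close> by (auto simp: nw_def)
qed

lemma skew_tab_S: "skew_tab {1..<Suc (b * r)} b S"
proof (rule skew_tab_standard[OF std])
  show "convex_cells (dom S)" unfolding dom_S by (rule convex_rows)
  show "fst d < b" if "d \<in> dom S" for d using that dom_S by auto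
qed

lemma card_dom_S: "card (dom S) = b * r"
  using card_dom_fills[OF skew_tabD(1)[OF skew_tab_S]] by simp

lemma S_cell: 
  assumes "i < b" "q < r"
  obtains s where "S (i, c i + q) = Some s" "1 \<le> s" "s \<le> b * r"
proof -
  have "(i, c i + q) \<in> dom S" using assms dom_S by simp
  then obtain s where s: "S (i, c i + q) = Some s" by blast
  moreover have "s \<in> {1..<Suc (b * r)}"
    using ranI[of S "(i, c i + q)" s] s skew_tabD(1)[OF skew_tab_S] unfolding fills_def by blast
  ultimately show ?thesis using that by simp
qed

text \<open>At offset \<open>j - c i\<close> in a row, the quotient by \<open>r\<close> numbers the
  copy of \<open>S\<close> and the remainder gives the place inside the copy.\<close>

lemma tab_power_eq:
  "tab_power S k (i, j) = (if i < b \<and> c i \<le> j \<and> j - c i < k * r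
     then Some (the (S (i, c i + (j - c i) mod r)) + (j - c i) div r * (b * r)) else None)"
proof (cases "i < b")
  case True
  have row: "{j. S (i, j) \<noteq> None} = {c i..<c i + r}"
    using dom_S True by (auto simp: dom_def set_eq_iff)
  have start: "row_start S i = c i" unfolding row_start_def row using r by (intro Min_eqI) auto
  have rl: "row_list S i = map (\<lambda>j. the (S (i, j))) [c i..<c i + r]"
    unfolding row_list_def row by simp
  let ?L = "concat (map (\<lambda>t. map (\<lambda>v. v + t * (b * r)) (row_list S i)) [0..<k])"
  have len: "length ?L = k * r" using rl by (induction k) auto
  have nth: "?L ! q = the (S (i, c i + q mod r)) + q div r * (b * r)" if "q < k * r" for q
  proof -
    have "?L ! q = map (\<lambda>v. v + q div r * (b * r)) (row_list S i) ! (q mod r)"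
      by (rule nth_concat_map_upt) (use rl that in auto)
    then show ?thesis using r by (simp add: rl)
  qed
  show ?thesis
    unfolding tab_power_def Let_def prod.case card_dom_S start len using nth True by simp
next
  case False
  then have "{j. S (i, j) \<noteq> None} = {}" using dom_S by (auto simp: dom_def set_eq_iff)
  then have "row_list S i = []" by (simp add: row_list_def)
  then have L: "concat (map (\<lambda>t. map (\<lambda>v. v + t * card (dom S)) (row_list S i)) [0..<k]) = []"
    by simp
  show ?thesis unfolding tab_power_def Let_def prod.case L using False by simp
qed

lemma tab_power_SomeE:
  assumes "tab_power S k (i, j) = Some v"
  obtains q s where "i < b" "j = c i + q" "q < k * r" "S (i, c i + q mod r) = Some s"
    "v = s + q div r * (b * r)" "1 \<le> s" "s \<le> b * r"
proof -
  have ij: "i < b" "c i \<le> j" "j - c i < k * r"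
    "v = the (S (i, c i + (j - c i) mod r)) + (j - c i) div r * (b * r)"
    using assms by (auto simp: tab_power_eq split: if_splits)
  obtain s where s: "S (i, c i + (j - c i) mod r) = Some s" "1 \<le> s" "s \<le> b * r"
    using S_cell[OF ij(1), of "(j - c i) mod r"] r by auto
  show ?thesis by (rule that[of "j - c i" s]) (use ij s in auto)
qed

lemma tab_power_SomeD:
  assumes "tab_power S k (i, j) = Some v"
  shows "\<exists>q s. j = c i + q \<and> S (i, c i + q mod r) = Some s \<and> v = s + q div r * (b * r) \<and>
    1 \<le> s \<and> s \<le> b * r \<and> i < b"
  by (rule tab_power_SomeE[OF assms]) blast

lemma dom_tab_power: "dom (tab_power S k) = {(i, j). i < b \<and> c i \<le> j \<and> j < c i + k * r}"
  by (auto simp: dom_def tab_power_eq split: if_splits)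

lemma fills_tab_power: "fills (tab_power S k) {1..<Suc (k * (b * r))}"
proof -
  let ?T = "tab_power S k"
  have finS: "fills S {1..<Suc (b * r)}" by (rule skew_tabD(1)[OF skew_tab_S])
  have "finite (dom ?T)"
  proof (rule finite_subset)
    show "dom ?T \<subseteq> (\<Union>i<b. {i} \<times> {c i..<c i + k * r})" unfolding dom_tab_power by auto
  qed auto
  moreover have "ran ?T = {1..<Suc (k * (b * r))}"
  proof (intro equalityI subsetI)
    fix v assume "v \<in> ran ?T"
    then obtain d where "?T d = Some v" by (auto simp: ran_def)
    then obtain i j where "?T (i, j) = Some v" by (cases d) auto
    then obtain q s where q: "q < k * r" "v = s + q div r * (b * r)" "1 \<le> s" "s \<le> b * r"
      by (rule tab_power_SomeE)
    have "q div r < k" using q(1) r by (simp add: less_mult_imp_div_less)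
    then have "Suc (q div r) * (b * r) \<le> k * (b * r)" by (intro mult_right_mono) auto
    then show "v \<in> {1..<Suc (k * (b * r))}" using q by auto
  next
    \<comment> \<open>Here \<open>s\<close> is the entry of \<open>S\<close> whose shifted copy is
      \<open>v\<close>, and \<open>e\<close> is the number of the copy.\<close>
    fix v assume v: "v \<in> {1..<Suc (k * (b * r))}"
    then have "0 < b * r" by (cases "b * r") auto
    define s where "s = Suc ((v - 1) mod (b * r))"
    define e where "e = (v - 1) div (b * r)"
    have "s \<in> ran S" using finS \<open>0 < b * r\<close> by (auto simp: fills_def s_def Suc_le_eq)
    then obtain d where d: "S d = Some s" by (auto simp: ran_def)
    obtain i j where ij: "d = (i, j)" by (cases d)
    have "(i, j) \<in> dom S" using d ij by auto
    then have i: "i < b" "c i \<le> j" "j < c i + r" using dom_S by auto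
    define p where "p = j - c i"
    have p: "p < r" "j = c i + p" using i by (auto simp: p_def)
    have "v - 1 < k * (b * r)" using v by auto
    then have "e < k" unfolding e_def by (rule less_mult_imp_div_less)
    then have "Suc e * r \<le> k * r" by (intro mult_right_mono) auto
    then have "e * r + p < k * r" using p(1) by simp
    moreover have "(e * r + p) mod r = p" "(e * r + p) div r = e" using p(1) by auto
    moreover have "s + e * (b * r) = v"
      using v mod_div_mult_eq[of "v - 1" "b * r"] unfolding s_def e_def by auto
    ultimately have "?T (i, c i + (e * r + p)) = Some v"
      using i d ij p by (simp add: tab_power_eq)
    then show "v \<in> ran ?T" by (auto simp: ran_def)
  qed
  moreover have "p = d" if pv: "?T p = Some v" and dv: "?T d = Some v" for p d v
  proof -
    obtain i j i' j' where pd: "p = (i, j)" "d = (i', j')" by (metis surj_pair)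
    obtain q s where q: "j = c i + q" "S (i, c i + q mod r) = Some s"
      "v = s + q div r * (b * r)" "1 \<le> s" "s \<le> b * r"
      using tab_power_SomeD[OF pv[unfolded pd]] by blast
    obtain q' s' where q': "j' = c i' + q'" "S (i', c i' + q' mod r) = Some s'"
      "v = s' + q' div r * (b * r)" "1 \<le> s'" "s' \<le> b * r"
      using tab_power_SomeD[OF dv[unfolded pd]] by blast
    have "(v - 1) div (b * r) = q div r" "Suc ((v - 1) mod (b * r)) = s"
      unfolding q(3) by (rule entry_div_mod[OF q(4,5)])+
    moreover have "(v - 1) div (b * r) = q' div r" "Suc ((v - 1) mod (b * r)) = s'"
      unfolding q'(3) by (rule entry_div_mod[OF q'(4,5)])+
    ultimately have div: "q div r = q' div r" and "s = s'" by auto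
    then have "(i, c i + q mod r) = (i', c i' + q' mod r)"
      using fills_inj[OF finS q(2)] q'(2) by blast
    then have "i = i'" "q mod r = q' mod r" by auto
    then show ?thesis using div q q' pd by (metis div_mult_mod_eq)
  qed
  ultimately show ?thesis unfolding fills_def by blast
qed

lemma row_of_tab_power:
  assumes "v \<in> {1..<Suc (k * (b * r))}"
  shows "row_of (tab_power S k) v = row_of S (Suc ((v - 1) mod (b * r)))"
proof -
  have "v \<in> ran (tab_power S k)" using assms fills_tab_power unfolding fills_def by blast
  then obtain d where d: "tab_power S k d = Some v" by (auto simp: ran_def)
  obtain i j where ij: "d = (i, j)" by (cases d)
  obtain q s where q: "S (i, c i + q mod r) = Some s" "v = s + q div r * (b * r)" "1 \<le> s" "s \<le> b * r"
    using tab_power_SomeD[OF d[unfolded ij]] by blast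
  have "row_of S s = i" by (rule row_of_eq[OF skew_tabD(1)[OF skew_tab_S] q(1)])
  moreover have "row_of (tab_power S k) v = i" using row_of_eq[OF fills_tab_power] d ij by blast
  ultimately show ?thesis using entry_div_mod(2)[OF q(3,4)] q(2) by simp
qed

text \<open>Lower rows start weakly further left, so down a column the copy number never decreases.
  Within one copy the order of \<open>S\<close> decides; between copies the shift exceeds every
  difference of entries of \<open>S\<close>.\<close>

lemma skew_tab_tab_power: "skew_tab {1..<Suc (k * (b * r))} b (tab_power S k)"
proof (rule skew_tabI[OF fills_tab_power])
  show "convex_cells (dom (tab_power S k))" unfolding dom_tab_power by (rule convex_rows)
  show "fst d < b" if "d \<in> dom (tab_power S k)" for d using that dom_tab_power by auto
  have S_inc: "increasing S" using skew_tabD(3)[OF skew_tab_S] .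
  have block: "x + q * (b * r) < y + q' * (b * r)" if "x \<le> b * r" "1 \<le> y" "q < q'" for x y q q'
  proof -
    have "Suc q * (b * r) \<le> q' * (b * r)" using that(3) by (intro mult_right_mono) auto
    then show ?thesis using that by simp
  qed
  fix i i' j j' x y
  {
    assume x: "tab_power S k (i, j) = Some x" and y: "tab_power S k (i, j') = Some y" and "j < j'"
    obtain q s where q: "j = c i + q" "S (i, c i + q mod r) = Some s"
      "x = s + q div r * (b * r)" "1 \<le> s" "s \<le> b * r"
      using tab_power_SomeD[OF x] by blast
    obtain q' s' where q': "j' = c i + q'" "S (i, c i + q' mod r) = Some s'"
      "y = s' + q' div r * (b * r)" "1 \<le> s'" "s' \<le> b * r"
      using tab_power_SomeD[OF y] by blast
    have "q < q'" using \<open>j < j'\<close> q q' by simp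
    then have le: "q div r \<le> q' div r" by (simp add: div_le_mono)
    show "x < y"
    proof (cases "q div r = q' div r")
      case True
      then have "q mod r < q' mod r"
        using \<open>q < q'\<close> by (metis div_mult_mod_eq nat_add_left_cancel_less)
      then have "s < s'" using increasingD[OF S_inc q(2) q'(2)] by (simp add: nw_def)
      then show ?thesis using q q' True by simp
    next
      case False
      then show ?thesis using block[OF q(5) q'(4)] le q(3) q'(3) by simp
    qed
  next
    assume x: "tab_power S k (i, j) = Some x" and y: "tab_power S k (i', j) = Some y" and "i < i'"
    obtain q s where q: "j = c i + q" "S (i, c i + q mod r) = Some s"
      "x = s + q div r * (b * r)" "1 \<le> s" "s \<le> b * r"
      using tab_power_SomeD[OF x] by blast
    obtain q' s' where q': "j = c i' + q'" "S (i', c i' + q' mod r) = Some s'"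
      "y = s' + q' div r * (b * r)" "1 \<le> s'" "s' \<le> b * r" "i' < b"
      using tab_power_SomeD[OF y] by blast
    have "q \<le> q'" using c_mono[of i i'] \<open>i < i'\<close> q(1) q'(1,6) by simp
    then have le: "q div r \<le> q' div r" by (simp add: div_le_mono)
    show "x < y"
    proof (cases "q div r = q' div r")
      case True
      have "c i + q mod r + q div r * r = c i' + q' mod r + q' div r * r"
        using q(1) q'(1) by (metis add.assoc add.commute div_mult_mod_eq)
      then have "c i + q mod r = c i' + q' mod r" by (simp only: True add_right_cancel)
      then have "s < s'"
        using increasingD[OF S_inc q(2) q'(2)] \<open>i < i'\<close> by (simp add: nw_def)
      then show ?thesis using q q' True by simp
    next
      case False
      then show ?thesis using block[OF q(5) q'(4)] le q(3) q'(3) by simp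
    qed
  }
qed

lemma reading_word_tab_power:
  "reading_word (tab_power S k) 1 (Suc (k * (b * r))) = power_word (reading_word S 1 (Suc (b * r))) k"
  (is "?x = power_word ?w k")
proof (rule nth_equalityI)
  fix t assume "t < length ?x"
  then have t: "t < k * (b * r)" by simp
  then have "t mod (b * r) < b * r" by (cases "b * r = 0") auto
  then have "?w ! (t mod (b * r)) = row_of S (Suc (t mod (b * r)))"
    by (simp add: reading_word_def del: upt_Suc)
  moreover have "?x ! t = row_of (tab_power S k) (Suc t)"
    using t by (simp add: reading_word_def del: upt_Suc)
  moreover have "\<dots> = row_of S (Suc (t mod (b * r)))" using row_of_tab_power[of "Suc t" k] t by simp
  ultimately show "?x ! t = power_word ?w k ! t" using power_word_nth[of t k ?w] t by simp
qed (simp add: length_power_word)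

lemma count_reading_word_S: "l < b \<Longrightarrow> count_list (reading_word S 1 (Suc (b * r))) l = r"
proof -
  assume "l < b"
  then have "{j. S (l, j) \<noteq> None} = {c l..<c l + r}" using dom_S by (auto simp: dom_def set_eq_iff)
  then show ?thesis using skew_tab_count_row[OF skew_tab_S, of l] by simp
qed

text \<open>By \<open>top_word_append\<close> the top word of the longer power starts with that of
  the shorter one in any case, so the definition only tests whether the last block is still
  \<open>w\<close>.\<close>

lemma stabilizes_at_iff:
  "stabilizes_at S (Suc K) \<longleftrightarrow>
     (let w = reading_word S 1 (Suc (b * r)) in
      top_word b (power_word w (Suc K)) = top_word b (power_word w K) @ w)"
proof -
  define w where "w = reading_word S 1 (Suc (b * r))"
  define n where "n = Suc K * (b * r)"
  let ?P = "tab_power S (Suc K)"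
  have P: "skew_tab {1..<Suc n} b ?P" unfolding n_def by (rule skew_tab_tab_power)
  have wP: "reading_word ?P 1 (Suc n) = power_word w (Suc K)"
    unfolding n_def w_def by (rule reading_word_tab_power)
  have wR: "reading_word (Rect ?P) 1 (Suc n) = top_word b (power_word w (Suc K))"
    using reading_word_Rect[OF P] wP by simp
  have nthP: "row_of ?P (Suc t) = power_word w (Suc K) ! t" if "t < n" for t
    using that unfolding wP[symmetric] by (simp add: reading_word_def del: upt_Suc)
  have nthR: "row_of (Rect ?P) (Suc t) = top_word b (power_word w (Suc K)) ! t" if "t < n" for t
    using that unfolding wR[symmetric] by (simp add: reading_word_def del: upt_Suc)
  have len: "length w = b * r" by (simp add: w_def)
  have split: "power_word w (Suc K) = power_word w K @ w" by (rule power_word_Suc_right)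
  obtain y where y: "top_word b (power_word w (Suc K)) = top_word b (power_word w K) @ y"
    unfolding split by (rule top_word_append)
  then have "length (top_word b (power_word w K) @ y) = length (power_word w (Suc K))"
    by (metis top_word_length)
  then have leny: "length y = length w" by (simp add: split)
  have in_row: "(\<forall>i. in_row (Rect ?P) v i \<longleftrightarrow> in_row ?P v i) \<longleftrightarrow> row_of (Rect ?P) v = row_of ?P v"
    if "v \<in> {1..<Suc n}" for v
    using in_row_iff[OF skew_tabD(1)[OF P] that] in_row_iff[OF skew_tabD(1)[OF Rect(1)[OF P]] that]
    by metis
  have "stabilizes_at S (Suc K) \<longleftrightarrow>
      (\<forall>v\<in>{K * (b * r) + 1..n}. \<forall>i. in_row (Rect ?P) v i \<longleftrightarrow> in_row ?P v i)"
    by (simp add: stabilizes_at_def card_dom_S n_def Let_def)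
  also have "\<dots> \<longleftrightarrow> (\<forall>v\<in>{K * (b * r) + 1..n}. row_of (Rect ?P) v = row_of ?P v)"
    using in_row by (intro ball_cong) auto
  also have "\<dots> \<longleftrightarrow> (\<forall>s<b * r. row_of (Rect ?P) (Suc (K * (b * r) + s)) = row_of ?P (Suc (K * (b * r) + s)))"
    (is "?A \<longleftrightarrow> ?B")
  proof
    assume A: ?A
    show ?B using A by (auto simp: n_def)
  next
    assume B: ?B
    show ?A
    proof
      fix v assume v: "v \<in> {K * (b * r) + 1..n}"
      then have "K * (b * r) + 1 \<le> v" "v \<le> n" by auto
      then obtain s where s: "v = K * (b * r) + 1 + s" using le_iff_add by blast
      then have "s < b * r" using \<open>v \<le> n\<close> by (simp add: n_def)
      then show "row_of (Rect ?P) v = row_of ?P v" using B s by simp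
    qed
  qed
  also have "\<dots> \<longleftrightarrow> (\<forall>s<b * r. y ! s = w ! s)"
  proof -
    have "row_of (Rect ?P) (Suc (K * (b * r) + s)) = y ! s"
      "row_of ?P (Suc (K * (b * r) + s)) = w ! s" if "s < b * r" for s
    proof -
      have "(top_word b (power_word w K) @ y) ! (K * (b * r) + s) = y ! s"
        "(power_word w K @ w) ! (K * (b * r) + s) = w ! s"
        by (simp_all add: nth_append length_power_word len)
      then show "row_of (Rect ?P) (Suc (K * (b * r) + s)) = y ! s"
        "row_of ?P (Suc (K * (b * r) + s)) = w ! s"
        using that nthP[of "K * (b * r) + s", unfolded split] nthR[of "K * (b * r) + s", unfolded y]
        unfolding n_def
        by simp_all
    qed
    then show ?thesis by auto
  qed
  also have "\<dots> \<longleftrightarrow> y = w" using leny len by (metis nth_equalityI)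
  finally show ?thesis using y by (simp add: w_def Let_def)
qed

text \<open>\<open>LEAST\<close> carries information only because some stable exponent exists, which
  is \<open>top_word_power_stable_ex\<close>.\<close>

lemma stab_stable:
  assumes "w = reading_word S 1 (Suc (b * r))"
  shows "1 \<le> stab S"
    "top_word b (power_word w (Suc (stab S - 1))) = top_word b (power_word w (stab S - 1)) @ w"
proof -
  have w: "set w \<subseteq> {..<b}" "\<And>l. l < b \<Longrightarrow> count_list w l = r"
    using reading_word_set[OF skew_tab_S] count_reading_word_S assms by auto
  obtain K where "stabilizes_at S (Suc K)"
    using top_word_power_stable_ex[OF w] stabilizes_at_iff assms unfolding Let_def by metis
  then have "1 \<le> Suc K \<and> stabilizes_at S (Suc K)" by simp
  then have st: "1 \<le> stab S \<and> stabilizes_at S (stab S)" unfolding stab_def by (rule LeastI)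
  then show "1 \<le> stab S" by simp
  then have "stab S = Suc (stab S - 1)" by simp
  then show "top_word b (power_word w (Suc (stab S - 1))) = top_word b (power_word w (stab S - 1)) @ w"
    using st stabilizes_at_iff assms unfolding Let_def by metis
qed

end

section \<open>Rectangular tableaux\<close>

lemma length_rows_of: "length (rows_of y i) = count_list y i"
proof -
  have "count_list y i = length (filter (\<lambda>a. a = i) y)" by (induction y) auto
  also have "\<dots> = card {t. t < length y \<and> y ! t = i}" by (rule length_filter_conv_card)
  also have "\<dots> = card (set (filter (\<lambda>t. y ! t = i) [0..<length y]))"
    by (rule arg_cong[where f = card]) auto
  also have "\<dots> = length (filter (\<lambda>t. y ! t = i) [0..<length y])" by (rule distinct_card) simp
  finally show ?thesis by (simp add: rows_of_def)
qed

lemma set_rows_of: "set (rows_of y i) = {v. 1 \<le> v \<and> v \<le> length y \<and> y ! (v - 1) = i}"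
proof -
  have "v \<in> set (rows_of y i) \<longleftrightarrow> 1 \<le> v \<and> v \<le> length y \<and> y ! (v - 1) = i" for v
    by (cases v) (auto simp: rows_of_def)
  then show ?thesis by blast
qed

lemma strict_sorted_rows_of: "sorted_wrt (<) (rows_of y i)"
  by (simp add: rows_of_def sorted_wrt_map sorted_wrt_filter)

text \<open>Splitting the word at \<open>t\<close> splits the row into entries up to
  \<open>t\<close> and larger ones. This turns prefix counts into inequalities between
  entries.\<close>

lemma rows_of_nth_le_iff:
  assumes "j < length (rows_of y i)"
  shows "rows_of y i ! j \<le> t \<longleftrightarrow> j < count_list (take t y) i"
proof -
  have split: "rows_of y i = rows_of (take t y) i @ map (\<lambda>v. v + length (take t y)) (rows_of (drop t y) i)"
    using rows_of_append[of "take t y" "drop t y" i] by simp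
  show ?thesis
  proof (cases "j < count_list (take t y) i")
    case True
    then have "rows_of y i ! j \<in> set (rows_of (take t y) i)"
      unfolding split by (simp add: nth_append length_rows_of)
    then have "rows_of y i ! j \<le> t" by (simp add: set_rows_of)
    then show ?thesis using True by simp
  next
    case False
    let ?k = "j - count_list (take t y) i"
    have k: "?k < length (rows_of (drop t y) i)"
      using assms False unfolding split by (simp add: length_rows_of)
    then have "t < length y" by (cases "t < length y") (simp_all add: rows_of_def)
    have "rows_of y i ! j = rows_of (drop t y) i ! ?k + length (take t y)"
      unfolding split using False k by (simp add: nth_append length_rows_of)
    moreover have "rows_of (drop t y) i ! ?k \<in> set (rows_of (drop t y) i)" using k by (rule nth_mem)
    then have "1 \<le> rows_of (drop t y) i ! ?k" by (simp add: set_rows_of)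
    ultimately show ?thesis using False \<open>t < length y\<close> by simp
  qed
qed

definition tab_of_word :: "nat \<Rightarrow> nat list \<Rightarrow> tab" where
  "tab_of_word b y = of_rows (map (rows_of y) [0..<b])"

lemma rect_word_length: assumes "rect_word b p y" shows "length y = b * p"
proof -
  have "filter (\<lambda>l. l < b) y = y" using assms by (auto simp: rect_word_def intro: filter_True)
  then have "length y = (\<Sum>l<b. count_list y l)" by (simp only: sum_count_list)
  also have "\<dots> = (\<Sum>l<b. p)" using assms by (intro sum.cong) (auto simp: rect_word_def)
  finally show ?thesis by simp
qed

lemma convex_rect: "convex_cells {(i, j). i < b \<and> j < p}"
  by (auto simp: convex_cells_def nw_def)

lemma rect_syt_skew_tab:
  assumes "rect_syt T b p"
  shows "skew_tab {1..<Suc (b * p)} b T"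
proof (rule skew_tab_standard)
  show "standard_filling T (b * p)" using assms by (simp add: rect_syt_def)
  have "dom T = {(i, j). i < b \<and> j < p}" using assms by (simp add: rect_syt_def)
  then show "convex_cells (dom T)" "\<And>c. c \<in> dom T \<Longrightarrow> fst c < b" using convex_rect by auto
qed

context
  fixes b p :: nat and y :: "nat list"
  assumes y: "rect_word b p y"
begin

lemma tab_of_word_eq:
  "tab_of_word b y (i, j) = (if i < b \<and> j < p then Some (rows_of y i ! j) else None)"
  using y by (auto simp: tab_of_word_def of_rows_def length_rows_of rect_word_def)

lemma fills_tab_of_word: "fills (tab_of_word b y) {1..<Suc (b * p)}"
proof -
  let ?T = "tab_of_word b y"
  have len: "length (rows_of y i) = p" if "i < b" for i
    using y that by (simp add: length_rows_of rect_word_def)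
  have "finite (dom ?T)"
    by (rule finite_subset[of _ "{..<b} \<times> {..<p}"]) (auto simp: tab_of_word_eq split: if_splits)
  moreover have "ran ?T = {1..<Suc (b * p)}"
  proof (intro equalityI subsetI)
    fix v assume "v \<in> ran ?T"
    then obtain i j where "?T (i, j) = Some v" by (auto simp: ran_def)
    then have "i < b" "j < p" "v = rows_of y i ! j" by (auto simp: tab_of_word_eq split: if_splits)
    then have "v \<in> set (rows_of y i)" using len by simp
    then show "v \<in> {1..<Suc (b * p)}" using rect_word_length[OF y] by (auto simp: set_rows_of)
  next
    fix v assume v: "v \<in> {1..<Suc (b * p)}"
    let ?i = "y ! (v - 1)"
    have vl: "1 \<le> v" "v \<le> length y" using v rect_word_length[OF y] by auto
    then have "?i \<in> set y" by simp
    then have i: "?i < b" using y unfolding rect_word_def by blast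
    have "v \<in> set (rows_of y ?i)" using vl by (simp add: set_rows_of)
    then obtain j where "j < p" "rows_of y ?i ! j = v" using len[OF i] by (auto simp: in_set_conv_nth)
    then have "?T (?i, j) = Some v" using i by (simp add: tab_of_word_eq)
    then show "v \<in> ran ?T" by (rule ranI)
  qed
  moreover have "c = d" if c: "?T c = Some v" and d: "?T d = Some v" for c d v
  proof -
    obtain i j k l where cd: "c = (i, j)" "d = (k, l)" by (cases c; cases d)
    have ij: "i < b" "j < p" "v = rows_of y i ! j" and kl: "k < b" "l < p" "v = rows_of y k ! l"
      using c d by (auto simp: cd tab_of_word_eq split: if_splits)
    have "v \<in> set (rows_of y i)" using nth_mem[of j "rows_of y i"] ij len by simp
    moreover have "v \<in> set (rows_of y k)" using nth_mem[of l "rows_of y k"] kl len by simp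
    ultimately have "i = k" by (simp add: set_rows_of)
    moreover have "distinct (rows_of y i)"
      using strict_sorted_rows_of strict_sorted_iff by blast
    ultimately have "j = l" using ij kl len by (metis nth_eq_iff_index_eq)
    then show ?thesis using cd \<open>i = k\<close> by simp
  qed
  ultimately show ?thesis unfolding fills_def by blast
qed

text \<open>Let \<open>?z\<close> be the lower entry. The prefix of length \<open>?z\<close> has
  more than \<open>j\<close> letters \<open>Suc i\<close>, hence by the ballot condition more than
  \<open>j\<close> letters \<open>i\<close>, so the upper entry has already appeared.\<close>

lemma tab_of_word_column:
  assumes i: "Suc i < b" and j: "j < p"
  shows "rows_of y i ! j < rows_of y (Suc i) ! j"
proof -
  let ?z = "rows_of y (Suc i) ! j"
  have len: "length (rows_of y k) = p" if "k < b" for k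
    using y that by (simp add: length_rows_of rect_word_def)
  have jl: "j < length (rows_of y i)" "j < length (rows_of y (Suc i))" using len i j by simp_all
  have "j < count_list (take ?z y) (Suc i)" using rows_of_nth_le_iff[OF jl(2)] by blast
  moreover have "exc i y ?z \<le> 0" using y i unfolding rect_word_def hw_def by blast
  ultimately have "j < count_list (take ?z y) i" by (simp add: exc_def)
  then have "rows_of y i ! j \<le> ?z" using rows_of_nth_le_iff[OF jl(1)] by blast
  moreover have "rows_of y i ! j \<in> set (rows_of y i)" "?z \<in> set (rows_of y (Suc i))"
    using jl by simp_all
  then have "rows_of y i ! j \<noteq> ?z" by (auto simp: set_rows_of)
  ultimately show ?thesis by simp
qed

lemma skew_tab_tab_of_word: "skew_tab {1..<Suc (b * p)} b (tab_of_word b y)"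
proof (rule skew_tabI[OF fills_tab_of_word])
  have dom: "dom (tab_of_word b y) = {(i, j). i < b \<and> j < p}"
    by (auto simp: dom_def tab_of_word_eq split: if_splits)
  show "convex_cells (dom (tab_of_word b y))" unfolding dom by (rule convex_rect)
  show "fst c < b" if "c \<in> dom (tab_of_word b y)" for c using that dom by auto
  fix i j i' j' x z
  {
    assume "tab_of_word b y (i, j) = Some x" "tab_of_word b y (i, j') = Some z" "j < j'"
    then have "i < b" "j' < p" "x = rows_of y i ! j" "z = rows_of y i ! j'" "j < j'"
      by (auto simp: tab_of_word_eq split: if_splits)
    then show "x < z"
      using sorted_wrt_nth_less[OF strict_sorted_rows_of, of j j' y i] y
      by (simp add: length_rows_of rect_word_def)
  next
    assume "tab_of_word b y (i, j) = Some x" "tab_of_word b y (i', j) = Some z" "i < i'"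
    then have xz: "j < p" "x = rows_of y i ! j" "z = rows_of y i' ! j" "i' < b" "i < i'"
      by (auto simp: tab_of_word_eq split: if_splits)
    have "Suc i \<le> i'" using xz by simp
    then have "i' < b \<longrightarrow> rows_of y i ! j < rows_of y i' ! j"
    proof (induction i' rule: dec_induct)
      case base
      then show ?case using tab_of_word_column xz(1) by blast
    next
      case (step k)
      then show ?case
        using tab_of_word_column[of k j] xz(1) Suc_lessD[of k b] less_trans by blast
    qed
    then show "x < z" using xz by simp
  }
qed

lemma rect_syt_tab_of_word: "rect_syt (tab_of_word b y) b p"
  unfolding rect_syt_def
proof
  show "dom (tab_of_word b y) = {(i, j). i < b \<and> j < p}"
    by (auto simp: dom_def tab_of_word_eq split: if_splits)
  show "standard_filling (tab_of_word b y) (b * p)"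
    by (rule standard_filling_skew_tab[OF skew_tab_tab_of_word])
qed

lemma reading_word_tab_of_word: "reading_word (tab_of_word b y) 1 (Suc (b * p)) = y"
proof (rule nth_equalityI)
  show "length (reading_word (tab_of_word b y) 1 (Suc (b * p))) = length y"
    using rect_word_length[OF y] by simp
  fix t assume "t < length (reading_word (tab_of_word b y) 1 (Suc (b * p)))"
  then have t: "t < b * p" by simp
  then have "Suc t \<in> ran (tab_of_word b y)" using fills_tab_of_word unfolding fills_def by auto
  then obtain i j where ij: "tab_of_word b y (i, j) = Some (Suc t)" by (auto simp: ran_def)
  then have "i < b" "j < p" "Suc t = rows_of y i ! j"
    by (auto simp: tab_of_word_eq split: if_splits)
  then have "Suc t \<in> set (rows_of y i)" using y by (simp add: length_rows_of rect_word_def)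
  then have "y ! t = i" by (simp add: set_rows_of)
  moreover have "row_of (tab_of_word b y) (Suc t) = i" by (rule row_of_eq[OF fills_tab_of_word ij])
  ultimately show "reading_word (tab_of_word b y) 1 (Suc (b * p)) ! t = y ! t"
    using t by (simp add: reading_word_def del: upt_Suc)
qed

end

text \<open>The word determines a rectangular tableau, since its rows are left-justified; an
  equality of words thereby becomes an equality of tableaux.\<close>

lemma rect_syt_eq_tab_of_word:
  assumes "rect_syt T b p"
  shows "T = tab_of_word b (reading_word T 1 (Suc (b * p)))"
proof
  fix c :: "nat \<times> nat"
  obtain i j where c: "c = (i, j)" by (cases c)
  have dom: "dom T = {(i, j). i < b \<and> j < p}" using assms by (simp add: rect_syt_def)
  have some: "T (i, j) \<noteq> None \<longleftrightarrow> i < b \<and> j < p" for i j using dom by (auto simp: dom_def set_eq_iff)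
  note rl = row_list_eq_rows_of[OF rect_syt_skew_tab[OF assms]]
  show "T c = tab_of_word b (reading_word T 1 (Suc (b * p))) c"
  proof (cases "i < b")
    case True
    then have "{j. T (i, j) \<noteq> None} = {0..<p}" using some by auto
    then have "row_list T i = map (\<lambda>j. the (T (i, j))) [0..<p]" by (simp add: row_list_def)
    then have "rows_of (reading_word T 1 (Suc (b * p))) i = map (\<lambda>j. the (T (i, j))) [0..<p]"
      using rl by simp
    then have "tab_of_word b (reading_word T 1 (Suc (b * p))) (i, j) =
        (if j < p then Some (the (T (i, j))) else None)"
      using True by (simp add: tab_of_word_def of_rows_def)
    then show ?thesis using True some[of i j] c by (cases "j < p") auto
  next
    case False
    then show ?thesis using some[of i j] by (simp add: c tab_of_word_def of_rows_def)
  qed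
qed

lemma rect_word_reading_word:
  assumes "rect_syt T b p"
  shows "rect_word b p (reading_word T 1 (Suc (b * p)))"
proof -
  have dom: "dom T = {(i, j). i < b \<and> j < p}" using assms by (simp add: rect_syt_def)
  have some: "T (i, j) \<noteq> None \<longleftrightarrow> i < b \<and> j < p" for i j using dom by (auto simp: dom_def set_eq_iff)
  note T = rect_syt_skew_tab[OF assms]
  have "inner_holes T = {}" using some by (auto simp: inner_holes_def)
  moreover have "{j. T (l, j) \<noteq> None} = {0..<p}" if "l < b" for l using that some by auto
  then have "count_list (reading_word T 1 (Suc (b * p))) l = p" if "l < b" for l
    using skew_tab_count_row[OF T, of l] that by (simp only: card_atLeastLessThan diff_zero)
  ultimately show ?thesis
    unfolding rect_word_def using reading_word_set[OF T] hw_straight[OF T] by blast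
qed

section \<open>Promotion\<close>

text \<open>Erasing 1 removes the first letter, which is 0, the slide raises the remaining word, and
  the new largest entry in the bottom row appends \<open>b - 1\<close>.\<close>

lemma promotion_rect_syt:
  assumes T: "rect_syt T b p" and "1 \<le> b" "1 \<le> p"
  shows "rect_syt (promotion T) b p"
    and "promotes b (reading_word T 1 (Suc (b * p))) (reading_word (promotion T) 1 (Suc (b * p)))"
proof -
  define N where "N = b * p"
  have N: "1 \<le> N" using assms(2,3) by (simp add: N_def)
  have dom: "dom T = {(i, j). i < b \<and> j < p}" using T by (simp add: rect_syt_def)
  have ST: "skew_tab {1..<Suc N} b T" unfolding N_def by (rule rect_syt_skew_tab[OF T])
  note D = skew_tabD[OF ST]
  have card: "card (dom T) = N" using card_dom_fills[OF D(1)] by simp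
  have T00: "T (0, 0) = Some 1"
  proof -
    have "(0, 0) \<in> dom T" using dom assms by auto
    then obtain x where x: "T (0, 0) = Some x" by blast
    have "1 \<in> ran T" using D(1) N by (simp add: fills_def)
    then obtain c where c: "T c = Some 1" by (auto simp: ran_def)
    have "x \<le> 1" using increasingD_le[OF D(3) x c] by (simp add: nw_def)
    moreover have "x \<in> {1..<Suc N}" using ranI[of T "(0, 0)" x] x D(1) by (simp add: fills_def)
    ultimately show ?thesis using x by simp
  qed
  define U where "U = T((0, 0) := None)"
  have the: "(THE c. T c = Some 1) = (0, 0)"
  proof (rule the_equality)
    show "T (0, 0) = Some 1" by (rule T00)
    show "c = (0, 0)" if "T c = Some 1" for c using fills_inj[OF D(1)] that T00 by blast
  qed
  have fillsU: "fills U {2..<Suc N}"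
  proof -
    have "finite (dom U)" using D(2) by (simp add: U_def)
    moreover have "v \<in> ran U \<longleftrightarrow> v \<in> {2..<Suc N}" for v
    proof -
      have "v \<in> ran U \<longleftrightarrow> v \<in> ran T \<and> v \<noteq> 1"
      proof
        assume "v \<in> ran U"
        then obtain c where "U c = Some v" by (auto simp: ran_def)
        then have c: "T c = Some v" "c \<noteq> (0, 0)" by (auto simp: U_def split: if_splits)
        then have "v \<noteq> 1" using fills_inj[OF D(1) _ T00, of c] by blast
        then show "v \<in> ran T \<and> v \<noteq> 1" using ranI[of T c v] c(1) by blast
      next
        assume "v \<in> ran T \<and> v \<noteq> 1"
        then obtain c where "T c = Some v" "v \<noteq> 1" by (auto simp: ran_def)
        then have "U c = Some v" using T00 by (auto simp: U_def)
        then show "v \<in> ran U" by (rule ranI)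
      qed
      then show ?thesis using D(1) by (auto simp: fills_def)
    qed
    then have "ran U = {2..<Suc N}" by blast
    moreover have "c = d" if "U c = Some x" "U d = Some x" for c d x
      using that fills_inj[OF D(1), of c x d] by (auto simp: U_def split: if_splits)
    ultimately show ?thesis unfolding fills_def by blast
  qed
  have domU: "insert (0, 0) (dom U) = dom T" using T00 by (auto simp: U_def)
  have incU: "increasing U"
    unfolding increasing_def
  proof (intro allI impI)
    fix c d x y assume "U c = Some x" "U d = Some y" "nw c d" "c \<noteq> d"
    then show "x < y" using increasingD[OF D(3), of c x d y] by (auto simp: U_def split: if_splits)
  qed
  have "U (0, 0) = None" by (simp add: U_def)
  then have "punctured_tab {2..<Suc N} b U (0, 0)"
    unfolding punctured_tab_def domU using fillsU incU D(4,5) by blast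
  from jdt_slide[OF this] obtain V h where V: "jdt_slide U (0, 0) = (V, h)" "V h = None"
    "skew_tab {2..<Suc N} b V" "\<And>d. nbr h d \<Longrightarrow> V d = None" "insert h (dom V) = dom T"
    "raises b (reading_word U 2 (Suc N)) (reading_word V 2 (Suc N))"
    unfolding domU by metis
  note DV = skew_tabD[OF V(3)]
  \<comment> \<open>The hole stops without filled neighbours to the east or south while the cells
    together with the hole still form the rectangle; only the southeast corner fits.\<close>
  have h: "h = (b - 1, p - 1)"
  proof -
    obtain i j where ij: "h = (i, j)" by (cases h)
    have "(i, j) \<in> dom T" using V(5) ij by blast
    then have lt: "i < b" "j < p" using dom by auto
    have "d \<notin> dom T" if "nbr h d" for d
    proof -
      have "d \<notin> dom V" using V(4)[OF that] by (simp add: domIff)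
      then show ?thesis using nbr_nw(2)[OF that] by (simp only: V(5)[symmetric] insert_iff simp_thms not_sym)
    qed
    then have "(Suc i, j) \<notin> dom T" "(i, Suc j) \<notin> dom T" using ij by (simp_all add: nbr_def)
    then show ?thesis using lt dom ij by auto
  qed
  define W where "W = V(h := Some (Suc N))"
  have domW: "dom W = dom T" using V(5) by (auto simp: W_def)
  have V_lt: "x < Suc N" "2 \<le> x" if "V c = Some x" for c x
    using ranI[of V c x] that DV(1) by (auto simp: fills_def)
  have incW: "increasing W"
    unfolding increasing_def
  proof (intro allI impI)
    fix c d x y assume cd: "W c = Some x" "W d = Some y" "nw c d" "c \<noteq> d"
    have "d \<in> dom T" using cd(2) domW by blast
    then have "c \<noteq> h" using cd(3,4) h dom by (auto simp: nw_def)
    then have c: "V c = Some x" using cd(1) by (simp add: W_def)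
    show "x < y"
    proof (cases "d = h")
      case True
      then show ?thesis using V_lt[OF c] cd(2) by (simp add: W_def)
    next
      case False
      then show ?thesis using increasingD[OF DV(3) c _ cd(3,4)] cd(2) by (simp add: W_def)
    qed
  qed
  \<comment> \<open>Entries are at least 2, so the truncated subtraction of 1 is injective and
    leaves positive entries.\<close>
  have W_ge: "2 \<le> x" if "W c = Some x" for c x
    using that V_lt N by (auto simp: W_def split: if_splits)
  have fillsW: "fills W {2..<Suc (Suc N)}"
  proof -
    have "finite (dom W)" using D(2) domW by simp
    moreover have "ran W = insert (Suc N) (ran V)" unfolding W_def using V(2) by (rule ran_map_upd)
    then have "ran W = {2..<Suc (Suc N)}" using DV(1) N by (auto simp: fills_def)
    moreover have "c = d" if "W c = Some x" "W d = Some x" for c d x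
      using that fills_inj[OF DV(1), of c x d] V_lt[of c] V_lt[of d]
      by (auto simp: W_def split: if_splits)
    ultimately show ?thesis unfolding fills_def by blast
  qed
  define Z where "Z = promotion T"
  have Z: "Z = (\<lambda>c. map_option (\<lambda>v. v - 1) (W c))"
    unfolding Z_def promotion_def Let_def the card using V(1) by (simp add: U_def[symmetric] W_def)
  have Z_some: "Z c = Some v \<longleftrightarrow> W c = Some (Suc v) \<and> 1 \<le> v" for c v
  proof (cases "W c")
    case (Some x)
    then show ?thesis using W_ge[OF Some] by (auto simp: Z)
  qed (simp add: Z)
  have domZ: "dom Z = dom T" using domW by (auto simp: Z dom_def)
  have fillsZ: "fills Z {1..<Suc N}"
  proof -
    have "finite (dom Z)" using D(2) domZ by simp
    moreover have "v \<in> ran Z \<longleftrightarrow> v \<in> {1..<Suc N}" for v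
    proof -
      have "v \<in> ran Z \<longleftrightarrow> Suc v \<in> ran W \<and> 1 \<le> v" by (auto simp: ran_def Z_some)
      then show ?thesis using fillsW by (auto simp: fills_def)
    qed
    then have "ran Z = {1..<Suc N}" by blast
    moreover have "c = d" if "Z c = Some x" "Z d = Some x" for c d x
      using that fills_inj[OF fillsW] unfolding Z_some by blast
    ultimately show ?thesis unfolding fills_def by blast
  qed
  have incZ: "increasing Z"
    unfolding increasing_def
  proof (intro allI impI)
    fix c d x y assume "Z c = Some x" "Z d = Some y" "nw c d" "c \<noteq> d"
    then show "x < y" using increasingD[OF incW, of c "Suc x" d "Suc y"] by (simp add: Z_some)
  qed
  have SZ: "skew_tab {1..<Suc N} b Z"
    unfolding skew_tab_def domZ using fillsZ incZ D(4,5) by blast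
  then show "rect_syt (promotion T) b p"
    using standard_filling_skew_tab domZ dom unfolding rect_syt_def Z_def N_def by blast
  have "reading_word T 1 (Suc N) = 0 # reading_word U 2 (Suc N)"
  proof -
    have "row_of T v = row_of U v" if v: "v \<in> {2..<Suc N}" for v
    proof -
      have "v \<in> ran U" using fillsU v by (simp add: fills_def)
      then obtain c where c: "U c = Some v" by (auto simp: ran_def)
      then have "T c = Some v" by (auto simp: U_def split: if_splits)
      then show ?thesis using row_of_cell[OF fillsU c] row_of_cell[OF D(1)] by simp
    qed
    then have "map (row_of T) [2..<Suc N] = reading_word U 2 (Suc N)"
      unfolding reading_word_def by (intro map_cong) auto
    moreover have "row_of T 1 = 0" using row_of_eq[OF D(1) T00] .
    moreover have "[1..<Suc N] = 1 # [2..<Suc N]" using N by (simp add: upt_conv_Cons numeral_2_eq_2 del: upt_Suc)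
    ultimately show ?thesis by (simp add: reading_word_def del: upt_Suc)
  qed
  moreover have "reading_word Z 1 (Suc N) = reading_word V 2 (Suc N) @ [b - 1]"
  proof -
    have row: "row_of Z v = fst c" if "W c = Some (Suc v)" "1 \<le> v" for v c
      using row_of_cell[OF fillsZ, of c v] that by (simp add: Z_some)
    have "row_of Z v = row_of V (Suc v)" if v: "v \<in> {1..<N}" for v
    proof -
      have "Suc v \<in> ran V" using DV(1) v by (auto simp: fills_def)
      then obtain c where c: "V c = Some (Suc v)" by (auto simp: ran_def)
      then have "W c = Some (Suc v)" using V(2) by (auto simp: W_def)
      then show ?thesis using row row_of_cell[OF DV(1) c] v by simp
    qed
    then have "map (row_of Z) [1..<N] = map (row_of V) (map Suc [1..<N])"
      unfolding map_map by (intro map_cong) auto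
    also have "map Suc [1..<N] = [2..<Suc N]" by (simp only: map_Suc_upt numeral_2_eq_2 One_nat_def)
    finally have "map (row_of Z) [1..<N] = map (row_of V) [2..<Suc N]" .
    moreover have "row_of Z N = b - 1" using row[of h N] N h by (simp add: W_def)
    moreover have "[1..<Suc N] = [1..<N] @ [N]" using N by simp
    ultimately show ?thesis unfolding reading_word_def by (simp only: map_append list.map)
  qed
  ultimately show "promotes b (reading_word T 1 (Suc (b * p))) (reading_word (promotion T) 1 (Suc (b * p)))"
    using V(6) unfolding promotes_def N_def[symmetric] Z_def by blast
qed

section \<open>The word of \<open>R_a\<close> and the conclusion\<close>

lemma std_skew_rowsE:
  assumes "std_skew_rows S b r"
  obtains c :: "nat \<Rightarrow> nat" where "\<And>i i'. i \<le> i' \<Longrightarrow> i' < b \<Longrightarrow> c i' \<le> c i"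
    "dom S = {(i, j). i < b \<and> c i \<le> j \<and> j < c i + r}" "standard_filling S (b * r)"
proof -
  obtain c :: "nat \<Rightarrow> nat" where c: "\<forall>i i'. i \<le> i' \<longrightarrow> i' < b \<longrightarrow> c i' \<le> c i"
    "dom S = {(i, j). i < b \<and> c i \<le> j \<and> j < c i + r}" and std: "standard_filling S (b * r)"
    using assms unfolding std_skew_rows_def by (elim conjE exE)
  show thesis by (rule that[OF _ c(2) std]) (use c(1) in simp)
qed

text \<open>The two shifts in \<open>R_a\<close> are the lengths of the preceding blocks of the
  word, so \<open>rows_of_append\<close> reproduces the rows one by one.\<close>

lemma R_a_eq_tab_of_word:
  assumes S: "std_skew_rows S b r" and "1 \<le> r" and k: "1 \<le> stab S" and a: "2 * stab S - 1 \<le> a"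
    and w: "w = reading_word S 1 (Suc (b * r))" and K: "K = stab S - 1"
  shows "R_a a b r S = tab_of_word b (top_word b (power_word w K) @ power_word w (a - 2 * K) @
    bot_word b (power_word w K))"
proof -
  obtain c :: "nat \<Rightarrow> nat" where c: "\<And>i i'. i \<le> i' \<Longrightarrow> i' < b \<Longrightarrow> c i' \<le> c i"
    "dom S = {(i, j). i < b \<and> c i \<le> j \<and> j < c i + r}" and std: "standard_filling S (b * r)"
    using std_skew_rowsE[OF S] by blast
  note P = skew_tab_tab_power[OF \<open>1 \<le> r\<close> c std] and wP = reading_word_tab_power[OF \<open>1 \<le> r\<close> c std, folded w]
  have len: "length w = b * r" by (simp add: w)
  define d where "d = a - 2 * K"
  \<comment> \<open>With \<open>stab S = K + 1\<close> the middle block has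
    \<open>d = a - 2 * K\<close> copies, and the blocks before the last one have
    \<open>K + d\<close> times \<open>b * r\<close> letters.\<close>
  have num: "a + 2 - 2 * stab S = d" "a + 1 - stab S = K + d"
    using k a K by (auto simp: d_def)
  have rect: "row_list (Rect (tab_power S n)) i = rows_of (top_word b (power_word w n)) i" for n i
    using row_list_eq_rows_of[OF Rect(1)[OF P]] reading_word_Rect[OF P] wP by simp
  have pow: "row_list (tab_power S n) i = rows_of (power_word w n) i" for n i
    using row_list_eq_rows_of[OF P] wP by simp
  obtain x where "skew_tab {1..<Suc (K * (b * r))} b (RectStar b (tab_power S K))"
    using RectStar[OF P] by metis
  then have star: "row_list (RectStar b (tab_power S K)) i = rows_of (bot_word b (power_word w K)) i" for i
    using row_list_eq_rows_of reading_word_RectStar[OF P] wP by simp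
  show ?thesis
    unfolding R_a_def Let_def tab_of_word_def num K[symmetric] d_def[symmetric]
    by (rule arg_cong[where f = of_rows], rule map_cong[OF refl])
      (simp add: rows_of_append row_list_shift rect pow star length_power_word len algebra_simps)
qed

theorem mainTheorem12:
  fixes a b r :: nat and S :: tab
  assumes "1 \<le> b" and "1 \<le> r"
    and "std_skew_rows S b r"
    and "2 * stab S - 1 \<le> a"
  shows "rect_syt (R_a a b r S) b (a * r) \<and> (promotion ^^ (b * r)) (R_a a b r S) = R_a a b r S"
proof -
  obtain c :: "nat \<Rightarrow> nat" where c: "\<And>i i'. i \<le> i' \<Longrightarrow> i' < b \<Longrightarrow> c i' \<le> c i"
    "dom S = {(i, j). i < b \<and> c i \<le> j \<and> j < c i + r}" and std: "standard_filling S (b * r)"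
    using std_skew_rowsE[OF assms(3)] by blast
  define w where "w = reading_word S 1 (Suc (b * r))"
  define K where "K = stab S - 1"
  define Y where "Y = top_word b (power_word w K) @ power_word w (a - 2 * K) @ bot_word b (power_word w K)"
  have stable: "1 \<le> stab S" "top_word b (power_word w (Suc K)) = top_word b (power_word w K) @ w"
    using stab_stable[OF assms(2) c std w_def] by (simp_all add: K_def)
  have w: "set w \<subseteq> {..<b}" "\<And>l. l < b \<Longrightarrow> count_list w l = r"
    using reading_word_set[OF skew_tab_S[OF assms(2) c std]] count_reading_word_S[OF assms(2) c std]
    by (simp_all add: w_def)
  have len: "length w = b * r" by (simp add: w_def)
  \<comment> \<open>The bound on \<open>a\<close> gives \<open>a - 2 * K\<close> at least 1: one
    middle copy of \<open>w\<close> is there to be promoted, which \<open>promotes_power\<close>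
    expresses by \<open>Suc c\<close>.\<close>
  have a: "2 * K + (a - 2 * K) = a" "Suc (a - 2 * K - 1) = a - 2 * K"
    using assms(4) stable(1) by (auto simp: K_def)
  have R: "R_a a b r S = tab_of_word b Y"
    unfolding Y_def by (rule R_a_eq_tab_of_word[OF assms(3,2) stable(1) assms(4) w_def K_def])
  have Y: "rect_word b (a * r) Y"
    using rect_word_stable[OF w stable(2), of "a - 2 * K"] unfolding a(1) Y_def .
  have rect0: "rect_syt (R_a a b r S) b (a * r)" unfolding R by (rule rect_syt_tab_of_word[OF Y])
  \<comment> \<open>The equation \<open>a(2)\<close> makes \<open>a - 2 * K\<close> a successor, so
    \<open>a\<close> is positive and the rectangle is nonempty, as promotion requires.\<close>
  have "1 \<le> a" using a(2) by linarith
  then have ar: "1 \<le> a * r" using assms(2) by simp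
  define T where "T s = (promotion ^^ s) (R_a a b r S)" for s
  have rect: "rect_syt (T s) b (a * r)" for s
    by (induction s) (simp_all add: T_def rect0 promotion_rect_syt(1)[OF _ assms(1) ar])
  define y where "y s = reading_word (T s) 1 (Suc (b * (a * r)))" for s
  have y0: "y 0 = Y"
    using reading_word_tab_of_word[OF Y] by (simp add: y_def T_def R)
  have "y (length w) = y 0"
  proof (rule promotes_power[OF w stable(2)])
    show "y 0 = top_word b (power_word w K) @ power_word w (Suc (a - 2 * K - 1)) @ bot_word b (power_word w K)"
      unfolding y0 a(2) Y_def ..
    show "promotes b (y s) (y (Suc s))" for s
      using promotion_rect_syt(2)[OF rect assms(1) ar, of s] by (simp add: y_def T_def)
    show "rect_word b (a * r) (y s)" for s
      unfolding y_def by (rule rect_word_reading_word[OF rect])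
  qed
  then have "T (b * r) = T 0"
    using rect_syt_eq_tab_of_word[OF rect, of "b * r"] rect_syt_eq_tab_of_word[OF rect, of 0]
    unfolding y_def len by simp
  then show ?thesis using rect0 by (simp add: T_def)
qed

end
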